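(* Let $(\Lambda_\bullet,W^\Lambda_\bullet)$ and $(\Omega_\bullet,W^\Omega_\bullet)$ be two $1$-cells from the $0$-cell $(\Gamma_\bullet,\mu^\bullet)$ to the $0$-cell $(\Delta_\bullet,\nu^\bullet)$ in $\mathbf{UC}^{\mathrm{tr}}$ such that there exist a "period" $K\in\mathbb N$ and a "Perron-Frobenius value" $d>0$ satisfying: (i) (periodicity) $\Gamma_k$, $\Delta_k$, $\Lambda_k$, $\Omega_k$, $W^\Lambda_k$ and $W^\Omega_k$ repeat with periodicity $K$ eventually for all $k$ (i.e. there is $L$ such that each of these, with index $k+K$, equals that with index $k$, for all $k\ge L$); (ii) (PF condition) eventually for all $k$, $$d^{-1}\,\Gamma_{k+K}\cdots\Gamma_{k+1}\,\mu^k=\mu^k=d\,\mu^{k+K},\qquad d^{-1}\,\Delta_{k+K}\cdots\Delta_{k+1}\,\nu^k=\nu^k=d\,\nu^{k+K},$$ where $\Gamma_j,\Delta_j$ here denote adjacency matrices and $\mu^k,\nu^k$ column vectors. Then every bounded quasi-flat sequence from $(\Lambda_\bullet,W^\Lambda_\bullet)$ to $(\Omega_\bullet,W^\Omega_\bullet)$ is flat.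
   Context: **Conventions.** A finite semisimple C*-category is a semisimple C*-category (finite-dimensional morphism spaces, closed under finite direct sums and subobjects) with finitely many isomorphism classes of simple objects; $V_{\mathcal M}$ is a set of representatives of the simple objects of $\mathcal M$. A $*$-linear functor is bi-faithful if it and its adjoint are faithful. Composition of functors is juxtaposition; $\mathrm{NT}(F,G)$ is the space of natural linear transformations $F\to G$; $F(\eta)$, $\eta_F$ are whiskerings; $\|\eta\|=\|\eta^*\eta\|^{1/2}$ is the C*-norm. The adjacency matrix of $F:\mathcal M\to\mathcal N$ is $(\dim\mathcal N(v,Fu))_{v\in V_{\mathcal N},u\in V_{\mathcal M}}$; it is denoted by the same symbol as $F$. **Weights.** A weight function on $\mathcal M$ is a map $\mu:V_{\mathcal M}\to(0,\infty)$. On $\mathcal M(v,x)$ ($v\in V_{\mathcal M}$) use $\tau^*\sigma=\langle\sigma,\tau\rangle_{v,x}1_v$. For $*$-linear bi-faithful $F:\mathcal M\to\mathcal N$ with adjoint $F'$ and weight functions $\mu,\nu$ on $\mathcal M,\mathcal N$, the tracial solution to the conjugate equations commensurate with $(\mu,\nu)$ is a pair $\rho:\mathrm{id}_{\mathcal N}\to FF'$, $\rho':\mathrm{id}_{\mathcal M}\to F'F$ solving the conjugate (zig-zag) equations, with $(\rho'_u)^*F'(\sigma\tau^* )\rho'_u=\frac{\nu_v}{\mu_u}\langle\sigma,\tau\rangle_{v,Fu}1_u$ for $\sigma,\tau\in\mathcal N(v,Fu)$ and $\rho_v^*F(\sigma\tau^* )\rho_v=\frac{\mu_u}{\nu_v}\langle\sigma,\tau\rangle_{u,F'v}1_v$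 for $\sigma,\tau\in\mathcal M(u,F'v)$. **$\mathbf{UC}^{\mathrm{tr}}$.** A 0-cell $(\Gamma_\bullet,\mu^\bullet)$: $*$-linear bi-faithful functors $\Gamma_k:\mathcal M_{k-1}\to\mathcal M_k$ ($k\ge1$) between finite semisimple C*-categories, with weight functions $\mu^k$ on $\mathcal M_k$ such that $\sum_{v\in V_{\mathcal M_0}}\mu^0_v=1$ and $\Gamma_k^{t}\mu^k=\mu^{k-1}$ ($k\ge1$; transpose of the adjacency matrix). A 1-cell $(\Lambda_\bullet,W^\Lambda_\bullet)$ from $(\Gamma_\bullet,\mu^\bullet)$ to $(\Delta_\bullet=\{\Delta_k:\mathcal N_{k-1}\to\mathcal N_k\},\nu^\bullet)$: $*$-linear bi-faithful functors $\Lambda_k:\mathcal M_k\to\mathcal N_k$ ($k\ge0$) and natural unitaries $W^\Lambda_k:\Delta_k\Lambda_{k-1}\to\Lambda_k\Gamma_k$ ($k\ge1$) such that for some $\epsilon,M>0$: $\epsilon\mu^k_v\le[\Lambda_k^t\nu^k]_v\le M\mu^k_v$ for all $k\ge0$, $v\in V_{\mathcal M_k}$. **Loop operators, quasi-flat and flat sequences.** For $k\ge1$, with $\rho'_k:\mathrm{id}_{\mathcal N_{k-1}}\to\Delta_k'\Delta_k$ from the tracial solution for $\Delta_k$ commensurate with $(\nu^{k-1},\nu^k)$, the loop operator $S_k:\mathrm{NT}(\Lambda_k,\Omega_k)\to\mathrm{NT}(\Lambda_{k-1},\Omega_{k-1})$ is $S_k\eta=(\rho_k'^{*})_{\Omega_{k-1}}\circ\Delta_k'\big((W^\Omega_k)^*\circ\eta_{\Gamma_k}\circ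 W^\Lambda_k\big)\circ(\rho'_k)_{\Lambda_{k-1}}$. A bounded quasi-flat sequence (BQFS) is $\{\eta^{(k)}\in\mathrm{NT}(\Lambda_k,\Omega_k)\}_{k\ge0}$ with $\sup_k\|\eta^{(k)}\|<\infty$ and $S_{k+1}\eta^{(k+1)}=\eta^{(k)}$ for all $k\ge0$. A quasi-flat sequence is flat if there is $N$ such that for every $k\ge N$ the pair $(\eta^{(k)},\eta^{(k+1)})$ satisfies the exchange relation $W^\Omega_{k+1}\circ\Delta_{k+1}(\eta^{(k)})=\eta^{(k+1)}_{\Gamma_{k+1}}\circ W^\Lambda_{k+1}$. *)

theory Defs
  imports Complex_Main
begin

section \<open>Complex vector spaces\<close>

class complex_vector = ab_group_add +
  fixes scaleC :: "complex \<Rightarrow> 'a \<Rightarrow> 'a"  (infixr "*\<^sub>C" 75)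
  assumes scaleC_add_right: "a *\<^sub>C (x + y) = a *\<^sub>C x + a *\<^sub>C y"
    and scaleC_add_left: "(a + b) *\<^sub>C x = a *\<^sub>C x + b *\<^sub>C x"
    and scaleC_scaleC: "a *\<^sub>C (b *\<^sub>C x) = (a * b) *\<^sub>C x"
    and scaleC_one: "1 *\<^sub>C x = x"

global_interpretation complex_vector: vector_space "scaleC :: complex \<Rightarrow> 'a \<Rightarrow> 'a::complex_vector"
  by unfold_locales
    (simp_all add: scaleC_add_right scaleC_add_left scaleC_scaleC scaleC_one)


section \<open>Finite semisimple C*-categories\<close>

text \<open>
  All morphism spaces of a category are subspaces of one ambient complex vector space \<open>'m\<close>
  (think of the direct sum of all morphism spaces), and composition and involution are operations
  on \<open>'m\<close> that matter only on composable morphisms. In that model distinct morphism spaces share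
  only \<open>0\<close>, so a linear functor can act on morphisms through a single map. A set \<open>reps\<close> of
  representatives of the simple objects belongs to the data.
\<close>

record ('o, 'm) ccat =
  obj  :: "'o set"
  hom  :: "'o \<Rightarrow> 'o \<Rightarrow> 'm set"
  idn  :: "'o \<Rightarrow> 'm"
  cmp  :: "'m \<Rightarrow> 'm \<Rightarrow> 'm"  (infixl "\<cdot>\<index>" 70)
  star :: "'m \<Rightarrow> 'm"
  nrm  :: "'m \<Rightarrow> real"
  reps :: "'o set"

locale star_category =
  fixes C :: "('o, 'm::complex_vector) ccat" (structure)
  assumes hom_subspace: "\<lbrakk>x \<in> obj C; y \<in> obj C\<rbrakk> \<Longrightarrow> complex_vector.subspace (hom C x y)"
    and idn_hom: "x \<in> obj C \<Longrightarrow> idn C x \<in> hom C x x"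
    and cmp_hom: "\<lbrakk>x \<in> obj C; y \<in> obj C; z \<in> obj C; f \<in> hom C x y; g \<in> hom C y z\<rbrakk>
      \<Longrightarrow> g \<cdot> f \<in> hom C x z"
    and cmp_assoc: "\<lbrakk>w \<in> obj C; x \<in> obj C; y \<in> obj C; z \<in> obj C;
        f \<in> hom C w x; g \<in> hom C x y; h \<in> hom C y z\<rbrakk> \<Longrightarrow> (h \<cdot> g) \<cdot> f = h \<cdot> (g \<cdot> f)"
    and cmp_idn_right: "\<lbrakk>x \<in> obj C; y \<in> obj C; f \<in> hom C x y\<rbrakk> \<Longrightarrow> f \<cdot> idn C x = f"
    and cmp_idn_left: "\<lbrakk>x \<in> obj C; y \<in> obj C; f \<in> hom C x y\<rbrakk> \<Longrightarrow> idn C y \<cdot> f = f"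
    and cmp_add_right: "\<lbrakk>x \<in> obj C; y \<in> obj C; z \<in> obj C;
        f \<in> hom C x y; f' \<in> hom C x y; g \<in> hom C y z\<rbrakk> \<Longrightarrow> g \<cdot> (f + f') = g \<cdot> f + g \<cdot> f'"
    and cmp_add_left: "\<lbrakk>x \<in> obj C; y \<in> obj C; z \<in> obj C;
        f \<in> hom C x y; g \<in> hom C y z; g' \<in> hom C y z\<rbrakk> \<Longrightarrow> (g + g') \<cdot> f = g \<cdot> f + g' \<cdot> f"
    and cmp_scale_right: "\<lbrakk>x \<in> obj C; y \<in> obj C; z \<in> obj C; f \<in> hom C x y; g \<in> hom C y z\<rbrakk>
      \<Longrightarrow> g \<cdot> (c *\<^sub>C f) = c *\<^sub>C (g \<cdot> f)"
    and cmp_scale_left: "\<lbrakk>x \<in> obj C; y \<in> obj C; z \<in> obj C; f \<in> hom C x y; g \<in> hom C y z\<rbrakk>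
      \<Longrightarrow> (c *\<^sub>C g) \<cdot> f = c *\<^sub>C (g \<cdot> f)"
    and star_hom: "\<lbrakk>x \<in> obj C; y \<in> obj C; f \<in> hom C x y\<rbrakk> \<Longrightarrow> star C f \<in> hom C y x"
    and star_star: "\<lbrakk>x \<in> obj C; y \<in> obj C; f \<in> hom C x y\<rbrakk> \<Longrightarrow> star C (star C f) = f"
    and star_add: "\<lbrakk>x \<in> obj C; y \<in> obj C; f \<in> hom C x y; g \<in> hom C x y\<rbrakk>
      \<Longrightarrow> star C (f + g) = star C f + star C g"
    and star_scale: "\<lbrakk>x \<in> obj C; y \<in> obj C; f \<in> hom C x y\<rbrakk>
      \<Longrightarrow> star C (c *\<^sub>C f) = cnj c *\<^sub>C star C f"
    and star_cmp: "\<lbrakk>x \<in> obj C; y \<in> obj C; z \<in> obj C; f \<in> hom C x y; g \<in> hom C y z\<rbrakk>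
      \<Longrightarrow> star C (g \<cdot> f) = star C f \<cdot> star C g"

text \<open>Completeness of the morphism spaces is automatic because they are finite-dimensional.\<close>

locale fd_cstar_category = star_category +
  assumes hom_fin_dim: "\<lbrakk>x \<in> obj C; y \<in> obj C\<rbrakk>
      \<Longrightarrow> \<exists>B. finite B \<and> hom C x y = complex_vector.span B"
    and nrm_nonneg: "\<lbrakk>x \<in> obj C; y \<in> obj C; f \<in> hom C x y\<rbrakk> \<Longrightarrow> 0 \<le> nrm C f"
    and nrm_eq_0_iff: "\<lbrakk>x \<in> obj C; y \<in> obj C; f \<in> hom C x y\<rbrakk> \<Longrightarrow> nrm C f = 0 \<longleftrightarrow> f = 0"
    and nrm_triangle: "\<lbrakk>x \<in> obj C; y \<in> obj C; f \<in> hom C x y; g \<in> hom C x y\<rbrakk>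
      \<Longrightarrow> nrm C (f + g) \<le> nrm C f + nrm C g"
    and nrm_scale: "\<lbrakk>x \<in> obj C; y \<in> obj C; f \<in> hom C x y\<rbrakk>
      \<Longrightarrow> nrm C (c *\<^sub>C f) = cmod c * nrm C f"
    and nrm_cmp: "\<lbrakk>x \<in> obj C; y \<in> obj C; z \<in> obj C; f \<in> hom C x y; g \<in> hom C y z\<rbrakk>
      \<Longrightarrow> nrm C (g \<cdot> f) \<le> nrm C g * nrm C f"
    and cstar_identity: "\<lbrakk>x \<in> obj C; y \<in> obj C; f \<in> hom C x y\<rbrakk>
      \<Longrightarrow> nrm C (star C f \<cdot> f) = (nrm C f)\<^sup>2"
    and star_cmp_positive: "\<lbrakk>x \<in> obj C; y \<in> obj C; f \<in> hom C x y\<rbrakk>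
      \<Longrightarrow> \<exists>g \<in> hom C x x. star C f \<cdot> f = star C g \<cdot> g"

definition simple_obj :: "('o, 'm::complex_vector) ccat \<Rightarrow> 'o \<Rightarrow> bool" where
  "simple_obj C x \<longleftrightarrow> x \<in> obj C \<and> idn C x \<noteq> 0 \<and> hom C x x = range (\<lambda>c. c *\<^sub>C idn C x)"

definition iso_obj :: "('o, 'm) ccat \<Rightarrow> 'o \<Rightarrow> 'o \<Rightarrow> bool" where
  "iso_obj C x y \<longleftrightarrow>
    (\<exists>f \<in> hom C x y. \<exists>g \<in> hom C y x. g \<cdot>\<^bsub>C\<^esub> f = idn C x \<and> f \<cdot>\<^bsub>C\<^esub> g = idn C y)"

locale finite_semisimple_cstar_category = fd_cstar_category +
  assumes zero_object: "\<exists>z \<in> obj C. idn C z = 0"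
    and direct_sums: "\<lbrakk>x \<in> obj C; y \<in> obj C\<rbrakk> \<Longrightarrow>
      \<exists>z \<in> obj C. \<exists>i \<in> hom C x z. \<exists>j \<in> hom C y z.
        star C i \<cdot> i = idn C x \<and> star C j \<cdot> j = idn C y \<and> i \<cdot> star C i + j \<cdot> star C j = idn C z"
    and subobjects: "\<lbrakk>x \<in> obj C; p \<in> hom C x x; p \<cdot> p = p; star C p = p\<rbrakk> \<Longrightarrow>
      \<exists>y \<in> obj C. \<exists>i \<in> hom C y x. star C i \<cdot> i = idn C y \<and> i \<cdot> star C i = p"
    and finite_reps: "finite (reps C)"
    and reps_simple: "v \<in> reps C \<Longrightarrow> simple_obj C v"
    and reps_representatives: "simple_obj C x \<Longrightarrow> \<exists>!v. v \<in> reps C \<and> iso_obj C x v"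


section \<open>Functors and natural transformations\<close>

record ('o, 'm, 'p, 'n) cfunctor =
  ob :: "'o \<Rightarrow> 'p"
  ar :: "'m \<Rightarrow> 'n"

definition id_functor :: "('o, 'm, 'o, 'm) cfunctor" where
  "id_functor = \<lparr>ob = (\<lambda>x. x), ar = (\<lambda>f. f)\<rparr>"

definition comp_functor ::
    "('p, 'n, 'q, 'l) cfunctor \<Rightarrow> ('o, 'm, 'p, 'n) cfunctor \<Rightarrow> ('o, 'm, 'q, 'l) cfunctor" where
  "comp_functor G F = \<lparr>ob = (\<lambda>x. ob G (ob F x)), ar = (\<lambda>f. ar G (ar F f))\<rparr>"

definition star_functor ::
    "('o, 'm::complex_vector) ccat \<Rightarrow> ('p, 'n::complex_vector) ccat
      \<Rightarrow> ('o, 'm, 'p, 'n) cfunctor \<Rightarrow> bool" where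
  "star_functor M N F \<longleftrightarrow>
    (\<forall>x \<in> obj M. ob F x \<in> obj N \<and> ar F (idn M x) = idn N (ob F x)) \<and>
    (\<forall>x \<in> obj M. \<forall>y \<in> obj M. \<forall>f \<in> hom M x y.
        ar F f \<in> hom N (ob F x) (ob F y) \<and>
        ar F (star M f) = star N (ar F f) \<and>
        (\<forall>c. ar F (c *\<^sub>C f) = c *\<^sub>C ar F f) \<and>
        (\<forall>g \<in> hom M x y. ar F (f + g) = ar F f + ar F g)) \<and>
    (\<forall>x \<in> obj M. \<forall>y \<in> obj M. \<forall>z \<in> obj M. \<forall>f \<in> hom M x y. \<forall>g \<in> hom M y z.
        ar F (g \<cdot>\<^bsub>M\<^esub> f) = ar F g \<cdot>\<^bsub>N\<^esub> ar F f)"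

definition faithful ::
    "('o, 'm) ccat \<Rightarrow> ('o, 'm, 'p, 'n) cfunctor \<Rightarrow> bool" where
  "faithful M F \<longleftrightarrow> (\<forall>x \<in> obj M. \<forall>y \<in> obj M. inj_on (ar F) (hom M x y))"

definition nat_trans ::
    "('o, 'm) ccat \<Rightarrow> ('p, 'n) ccat
      \<Rightarrow> ('o, 'm, 'p, 'n) cfunctor \<Rightarrow> ('o, 'm, 'p, 'n) cfunctor \<Rightarrow> ('o \<Rightarrow> 'n) \<Rightarrow> bool" where
  "nat_trans M N F G \<eta> \<longleftrightarrow>
    (\<forall>x \<in> obj M. \<eta> x \<in> hom N (ob F x) (ob G x)) \<and>
    (\<forall>x \<in> obj M. \<forall>y \<in> obj M. \<forall>f \<in> hom M x y.
        ar G f \<cdot>\<^bsub>N\<^esub> \<eta> x = \<eta> y \<cdot>\<^bsub>N\<^esub> ar F f)"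

definition nat_unitary ::
    "('o, 'm) ccat \<Rightarrow> ('p, 'n) ccat
      \<Rightarrow> ('o, 'm, 'p, 'n) cfunctor \<Rightarrow> ('o, 'm, 'p, 'n) cfunctor \<Rightarrow> ('o \<Rightarrow> 'n) \<Rightarrow> bool" where
  "nat_unitary M N F G W \<longleftrightarrow> nat_trans M N F G W \<and>
    (\<forall>x \<in> obj M. star N (W x) \<cdot>\<^bsub>N\<^esub> W x = idn N (ob F x) \<and>
                 W x \<cdot>\<^bsub>N\<^esub> star N (W x) = idn N (ob G x))"

text \<open>
  The norm on the C*-algebra of natural endomorphisms is the supremum of the norms of the
  components; it is finite because a component is determined by those at simple objects.
\<close>

definition nt_norm :: "('o, 'm) ccat \<Rightarrow> ('p, 'n) ccat \<Rightarrow> ('o \<Rightarrow> 'n) \<Rightarrow> real" where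
  "nt_norm M N \<eta> = sqrt (SUP x \<in> obj M. nrm N (star N (\<eta> x) \<cdot>\<^bsub>N\<^esub> \<eta> x))"

definition adjacency ::
    "('p, 'n::complex_vector) ccat \<Rightarrow> ('o, 'm, 'p, 'n) cfunctor \<Rightarrow> 'p \<Rightarrow> 'o \<Rightarrow> real" where
  "adjacency N F v u = real (complex_vector.dim (hom N v (ob F u)))"


section \<open>Adjoints and tracial solutions of the conjugate equations\<close>

definition conjugate_solution ::
    "('o, 'm::complex_vector) ccat \<Rightarrow> ('p, 'n::complex_vector) ccat
      \<Rightarrow> ('o, 'm, 'p, 'n) cfunctor \<Rightarrow> ('p, 'n, 'o, 'm) cfunctor
      \<Rightarrow> ('p \<Rightarrow> 'n) \<Rightarrow> ('o \<Rightarrow> 'm) \<Rightarrow> bool" where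
  "conjugate_solution M N F F' \<rho> \<rho>' \<longleftrightarrow>
    star_functor N M F' \<and>
    nat_trans N N id_functor (comp_functor F F') \<rho> \<and>
    nat_trans M M id_functor (comp_functor F' F) \<rho>' \<and>
    (\<forall>x \<in> obj M. star N (ar F (\<rho>' x)) \<cdot>\<^bsub>N\<^esub> \<rho> (ob F x) = idn N (ob F x)) \<and>
    (\<forall>y \<in> obj N. star M (ar F' (\<rho> y)) \<cdot>\<^bsub>M\<^esub> \<rho>' (ob F' y) = idn M (ob F' y))"

definition bifaithful ::
    "('o, 'm::complex_vector) ccat \<Rightarrow> ('p, 'n::complex_vector) ccat
      \<Rightarrow> ('o, 'm, 'p, 'n) cfunctor \<Rightarrow> bool" where
  "bifaithful M N F \<longleftrightarrow> star_functor M N F \<and> faithful M F \<and>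
    (\<exists>F' \<rho> \<rho>'. conjugate_solution M N F F' \<rho> \<rho>' \<and> faithful N F')"

definition weight_function :: "('o, 'm) ccat \<Rightarrow> ('o \<Rightarrow> real) \<Rightarrow> bool" where
  "weight_function M \<mu> \<longleftrightarrow> (\<forall>v \<in> reps M. 0 < \<mu> v)"

definition hom_inner :: "('o, 'm::complex_vector) ccat \<Rightarrow> 'o \<Rightarrow> 'm \<Rightarrow> 'm \<Rightarrow> complex" where
  "hom_inner C v \<sigma> \<tau> = (THE c. star C \<tau> \<cdot>\<^bsub>C\<^esub> \<sigma> = c *\<^sub>C idn C v)"

definition tracial_solution ::
    "('o, 'm::complex_vector) ccat \<Rightarrow> ('p, 'n::complex_vector) ccat
      \<Rightarrow> ('o \<Rightarrow> real) \<Rightarrow> ('p \<Rightarrow> real)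
      \<Rightarrow> ('o, 'm, 'p, 'n) cfunctor \<Rightarrow> ('p, 'n, 'o, 'm) cfunctor
      \<Rightarrow> ('p \<Rightarrow> 'n) \<Rightarrow> ('o \<Rightarrow> 'm) \<Rightarrow> bool" where
  "tracial_solution M N \<mu> \<nu> F F' \<rho> \<rho>' \<longleftrightarrow>
    conjugate_solution M N F F' \<rho> \<rho>' \<and>
    (\<forall>u \<in> reps M. \<forall>v \<in> reps N. \<forall>\<sigma> \<in> hom N v (ob F u). \<forall>\<tau> \<in> hom N v (ob F u).
      star M (\<rho>' u) \<cdot>\<^bsub>M\<^esub> ar F' (\<sigma> \<cdot>\<^bsub>N\<^esub> star N \<tau>) \<cdot>\<^bsub>M\<^esub> \<rho>' u
        = (complex_of_real (\<nu> v / \<mu> u) * hom_inner N v \<sigma> \<tau>) *\<^sub>C idn M u) \<and>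
    (\<forall>u \<in> reps M. \<forall>v \<in> reps N. \<forall>\<sigma> \<in> hom M u (ob F' v). \<forall>\<tau> \<in> hom M u (ob F' v).
      star N (\<rho> v) \<cdot>\<^bsub>N\<^esub> ar F (\<sigma> \<cdot>\<^bsub>M\<^esub> star M \<tau>) \<cdot>\<^bsub>N\<^esub> \<rho> v
        = (complex_of_real (\<mu> u / \<nu> v) * hom_inner M u \<sigma> \<tau>) *\<^sub>C idn N v)"


section \<open>Cells of the 2-category\<close>

text \<open>
  The functors \<open>\<Gamma> k\<close>, the unitaries \<open>W k\<close> and the adjoint data are indexed by \<open>k \<ge> 1\<close>;
  their values at \<open>0\<close> play no role.
\<close>

definition zero_cell ::
    "(nat \<Rightarrow> ('o, 'm::complex_vector) ccat) \<Rightarrow> (nat \<Rightarrow> ('o, 'm, 'o, 'm) cfunctor)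
      \<Rightarrow> (nat \<Rightarrow> 'o \<Rightarrow> real) \<Rightarrow> bool" where
  "zero_cell M \<Gamma> \<mu> \<longleftrightarrow>
    (\<forall>k. finite_semisimple_cstar_category (M k)) \<and>
    (\<forall>k. bifaithful (M k) (M (Suc k)) (\<Gamma> (Suc k))) \<and>
    (\<forall>k. weight_function (M k) (\<mu> k)) \<and>
    (\<Sum>v \<in> reps (M 0). \<mu> 0 v) = 1 \<and>
    (\<forall>k. \<forall>u \<in> reps (M k).
      (\<Sum>v \<in> reps (M (Suc k)). adjacency (M (Suc k)) (\<Gamma> (Suc k)) v u * \<mu> (Suc k) v) = \<mu> k u)"

definition one_cell ::
    "(nat \<Rightarrow> ('o, 'm::complex_vector) ccat) \<Rightarrow> (nat \<Rightarrow> ('o, 'm, 'o, 'm) cfunctor)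
      \<Rightarrow> (nat \<Rightarrow> 'o \<Rightarrow> real)
      \<Rightarrow> (nat \<Rightarrow> ('p, 'n::complex_vector) ccat) \<Rightarrow> (nat \<Rightarrow> ('p, 'n, 'p, 'n) cfunctor)
      \<Rightarrow> (nat \<Rightarrow> 'p \<Rightarrow> real)
      \<Rightarrow> (nat \<Rightarrow> ('o, 'm, 'p, 'n) cfunctor) \<Rightarrow> (nat \<Rightarrow> 'o \<Rightarrow> 'n) \<Rightarrow> bool" where
  "one_cell M \<Gamma> \<mu> N \<Delta> \<nu> \<Lambda> W \<longleftrightarrow>
    (\<forall>k. bifaithful (M k) (N k) (\<Lambda> k)) \<and>
    (\<forall>k. nat_unitary (M k) (N (Suc k))
      (comp_functor (\<Delta> (Suc k)) (\<Lambda> k)) (comp_functor (\<Lambda> (Suc k)) (\<Gamma> (Suc k))) (W (Suc k))) \<and>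
    (\<exists>\<epsilon> > 0. \<exists>B > 0. \<forall>k. \<forall>u \<in> reps (M k).
      \<epsilon> * \<mu> k u \<le> (\<Sum>v \<in> reps (N k). adjacency (N k) (\<Lambda> k) v u * \<nu> k v) \<and>
      (\<Sum>v \<in> reps (N k). adjacency (N k) (\<Lambda> k) v u * \<nu> k v) \<le> B * \<mu> k u)"


section \<open>Quasi-flat and flat sequences\<close>

text \<open>
  \<open>loop_operator N \<Delta>' \<rho>' \<Gamma> \<Lambda> \<Omega> W\<Lambda> W\<Omega> k\<close> is the loop operator with index \<open>k + 1\<close>, from
  transformations \<open>\<Lambda> (k+1) \<rightarrow> \<Omega> (k+1)\<close> to transformations \<open>\<Lambda> k \<rightarrow> \<Omega> k\<close>. Here \<open>\<rho>'\<close> comes from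
  tracial solutions for \<open>\<Delta>\<close>; these are unique up to a unitary change of \<open>\<Delta>'\<close>, which does not
  affect the operator.
\<close>

definition loop_operator ::
    "(nat \<Rightarrow> ('p, 'n) ccat) \<Rightarrow> (nat \<Rightarrow> ('p, 'n, 'p, 'n) cfunctor) \<Rightarrow> (nat \<Rightarrow> 'p \<Rightarrow> 'n)
      \<Rightarrow> (nat \<Rightarrow> ('o, 'm, 'o, 'm) cfunctor)
      \<Rightarrow> (nat \<Rightarrow> ('o, 'm, 'p, 'n) cfunctor) \<Rightarrow> (nat \<Rightarrow> ('o, 'm, 'p, 'n) cfunctor)
      \<Rightarrow> (nat \<Rightarrow> 'o \<Rightarrow> 'n) \<Rightarrow> (nat \<Rightarrow> 'o \<Rightarrow> 'n) \<Rightarrow> nat \<Rightarrow> ('o \<Rightarrow> 'n) \<Rightarrow> 'o \<Rightarrow> 'n" where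
  "loop_operator N \<Delta>' \<rho>' \<Gamma> \<Lambda> \<Omega> W\<Lambda> W\<Omega> k \<eta> = (\<lambda>x.
     star (N k) (\<rho>' (Suc k) (ob (\<Omega> k) x)) \<cdot>\<^bsub>N k\<^esub>
     ar (\<Delta>' (Suc k))
       (star (N (Suc k)) (W\<Omega> (Suc k) x) \<cdot>\<^bsub>N (Suc k)\<^esub> \<eta> (ob (\<Gamma> (Suc k)) x)
          \<cdot>\<^bsub>N (Suc k)\<^esub> W\<Lambda> (Suc k) x) \<cdot>\<^bsub>N k\<^esub>
     \<rho>' (Suc k) (ob (\<Lambda> k) x))"

definition quasi_flat ::
    "(nat \<Rightarrow> ('o, 'm) ccat) \<Rightarrow> (nat \<Rightarrow> ('p, 'n) ccat)
      \<Rightarrow> (nat \<Rightarrow> ('p, 'n, 'p, 'n) cfunctor) \<Rightarrow> (nat \<Rightarrow> 'p \<Rightarrow> 'n)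
      \<Rightarrow> (nat \<Rightarrow> ('o, 'm, 'o, 'm) cfunctor)
      \<Rightarrow> (nat \<Rightarrow> ('o, 'm, 'p, 'n) cfunctor) \<Rightarrow> (nat \<Rightarrow> ('o, 'm, 'p, 'n) cfunctor)
      \<Rightarrow> (nat \<Rightarrow> 'o \<Rightarrow> 'n) \<Rightarrow> (nat \<Rightarrow> 'o \<Rightarrow> 'n) \<Rightarrow> (nat \<Rightarrow> 'o \<Rightarrow> 'n) \<Rightarrow> bool" where
  "quasi_flat M N \<Delta>' \<rho>' \<Gamma> \<Lambda> \<Omega> W\<Lambda> W\<Omega> \<eta> \<longleftrightarrow>
    (\<forall>k. nat_trans (M k) (N k) (\<Lambda> k) (\<Omega> k) (\<eta> k)) \<and>
    (\<forall>k. \<forall>x \<in> obj (M k). loop_operator N \<Delta>' \<rho>' \<Gamma> \<Lambda> \<Omega> W\<Lambda> W\<Omega> k (\<eta> (Suc k)) x = \<eta> k x)"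

definition bounded_quasi_flat ::
    "(nat \<Rightarrow> ('o, 'm) ccat) \<Rightarrow> (nat \<Rightarrow> ('p, 'n) ccat)
      \<Rightarrow> (nat \<Rightarrow> ('p, 'n, 'p, 'n) cfunctor) \<Rightarrow> (nat \<Rightarrow> 'p \<Rightarrow> 'n)
      \<Rightarrow> (nat \<Rightarrow> ('o, 'm, 'o, 'm) cfunctor)
      \<Rightarrow> (nat \<Rightarrow> ('o, 'm, 'p, 'n) cfunctor) \<Rightarrow> (nat \<Rightarrow> ('o, 'm, 'p, 'n) cfunctor)
      \<Rightarrow> (nat \<Rightarrow> 'o \<Rightarrow> 'n) \<Rightarrow> (nat \<Rightarrow> 'o \<Rightarrow> 'n) \<Rightarrow> (nat \<Rightarrow> 'o \<Rightarrow> 'n) \<Rightarrow> bool" where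
  "bounded_quasi_flat M N \<Delta>' \<rho>' \<Gamma> \<Lambda> \<Omega> W\<Lambda> W\<Omega> \<eta> \<longleftrightarrow>
    quasi_flat M N \<Delta>' \<rho>' \<Gamma> \<Lambda> \<Omega> W\<Lambda> W\<Omega> \<eta> \<and>
    bdd_above (range (\<lambda>k. nt_norm (M k) (N k) (\<eta> k)))"

definition exchange_relation ::
    "(nat \<Rightarrow> ('o, 'm) ccat) \<Rightarrow> (nat \<Rightarrow> ('p, 'n) ccat)
      \<Rightarrow> (nat \<Rightarrow> ('o, 'm, 'o, 'm) cfunctor) \<Rightarrow> (nat \<Rightarrow> ('p, 'n, 'p, 'n) cfunctor)
      \<Rightarrow> (nat \<Rightarrow> 'o \<Rightarrow> 'n) \<Rightarrow> (nat \<Rightarrow> 'o \<Rightarrow> 'n) \<Rightarrow> (nat \<Rightarrow> 'o \<Rightarrow> 'n) \<Rightarrow> nat \<Rightarrow> bool" where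
  "exchange_relation M N \<Gamma> \<Delta> W\<Lambda> W\<Omega> \<eta> k \<longleftrightarrow>
    (\<forall>x \<in> obj (M k).
      W\<Omega> (Suc k) x \<cdot>\<^bsub>N (Suc k)\<^esub> ar (\<Delta> (Suc k)) (\<eta> k x)
        = \<eta> (Suc k) (ob (\<Gamma> (Suc k)) x) \<cdot>\<^bsub>N (Suc k)\<^esub> W\<Lambda> (Suc k) x)"

definition flat ::
    "(nat \<Rightarrow> ('o, 'm) ccat) \<Rightarrow> (nat \<Rightarrow> ('p, 'n) ccat)
      \<Rightarrow> (nat \<Rightarrow> ('o, 'm, 'o, 'm) cfunctor) \<Rightarrow> (nat \<Rightarrow> ('p, 'n, 'p, 'n) cfunctor)
      \<Rightarrow> (nat \<Rightarrow> 'o \<Rightarrow> 'n) \<Rightarrow> (nat \<Rightarrow> 'o \<Rightarrow> 'n) \<Rightarrow> (nat \<Rightarrow> 'o \<Rightarrow> 'n) \<Rightarrow> bool" where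
  "flat M N \<Gamma> \<Delta> W\<Lambda> W\<Omega> \<eta> \<longleftrightarrow> (\<exists>n. \<forall>k \<ge> n. exchange_relation M N \<Gamma> \<Delta> W\<Lambda> W\<Omega> \<eta> k)"


section \<open>Periodicity and the Perron-Frobenius condition\<close>

text \<open>
  Equality of categories and of functors disregards the values of the record fields outside the
  objects and morphisms.
\<close>

definition same_cat :: "('o, 'm::complex_vector) ccat \<Rightarrow> ('o, 'm) ccat \<Rightarrow> bool" where
  "same_cat C D \<longleftrightarrow>
    obj C = obj D \<and> reps C = reps D \<and>
    (\<forall>x \<in> obj C. idn C x = idn D x) \<and>
    (\<forall>x \<in> obj C. \<forall>y \<in> obj C. hom C x y = hom D x y \<and>
      (\<forall>f \<in> hom C x y. star C f = star D f \<and> nrm C f = nrm D f)) \<and>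
    (\<forall>x \<in> obj C. \<forall>y \<in> obj C. \<forall>z \<in> obj C. \<forall>f \<in> hom C x y. \<forall>g \<in> hom C y z.
      g \<cdot>\<^bsub>C\<^esub> f = g \<cdot>\<^bsub>D\<^esub> f)"

definition same_functor ::
    "('o, 'm) ccat \<Rightarrow> ('o, 'm, 'p, 'n) cfunctor \<Rightarrow> ('o, 'm, 'p, 'n) cfunctor \<Rightarrow> bool" where
  "same_functor M F G \<longleftrightarrow>
    (\<forall>x \<in> obj M. ob F x = ob G x) \<and>
    (\<forall>x \<in> obj M. \<forall>y \<in> obj M. \<forall>f \<in> hom M x y. ar F f = ar G f)"

text \<open>\<open>adj_product M \<Gamma> k n \<mu>\<close> is the vector \<open>\<Gamma>\<^bsub>k+n\<^esub> \<cdots> \<Gamma>\<^bsub>k+1\<^esub> \<mu>\<close>.\<close>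

primrec adj_product ::
    "(nat \<Rightarrow> ('o, 'm::complex_vector) ccat) \<Rightarrow> (nat \<Rightarrow> ('o, 'm, 'o, 'm) cfunctor)
      \<Rightarrow> nat \<Rightarrow> nat \<Rightarrow> ('o \<Rightarrow> real) \<Rightarrow> 'o \<Rightarrow> real" where
  "adj_product M \<Gamma> k 0 \<mu> = \<mu>"
| "adj_product M \<Gamma> k (Suc n) \<mu> = (\<lambda>v. \<Sum>u \<in> reps (M (k + n)).
     adjacency (M (Suc (k + n))) (\<Gamma> (Suc (k + n))) v u * adj_product M \<Gamma> k n \<mu> u)"

definition eventually_periodic ::
    "nat \<Rightarrow> (nat \<Rightarrow> ('o, 'm::complex_vector) ccat) \<Rightarrow> (nat \<Rightarrow> ('o, 'm, 'o, 'm) cfunctor) \<Rightarrow> bool" where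
  "eventually_periodic K M \<Gamma> \<longleftrightarrow>
    (\<forall>\<^sub>F k in sequentially. same_cat (M (k + K)) (M k) \<and>
       same_functor (M k) (\<Gamma> (Suc k + K)) (\<Gamma> (Suc k)))"

definition eventually_periodic_cell ::
    "nat \<Rightarrow> (nat \<Rightarrow> ('o, 'm) ccat) \<Rightarrow> (nat \<Rightarrow> ('o, 'm, 'p, 'n) cfunctor)
      \<Rightarrow> (nat \<Rightarrow> 'o \<Rightarrow> 'n) \<Rightarrow> bool" where
  "eventually_periodic_cell K M \<Lambda> W \<longleftrightarrow>
    (\<forall>\<^sub>F k in sequentially. same_functor (M k) (\<Lambda> (k + K)) (\<Lambda> k) \<and>
       (\<forall>x \<in> obj (M k). W (Suc k + K) x = W (Suc k) x))"

definition PF_condition ::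
    "nat \<Rightarrow> real \<Rightarrow> (nat \<Rightarrow> ('o, 'm::complex_vector) ccat) \<Rightarrow> (nat \<Rightarrow> ('o, 'm, 'o, 'm) cfunctor)
      \<Rightarrow> (nat \<Rightarrow> 'o \<Rightarrow> real) \<Rightarrow> bool" where
  "PF_condition K d M \<Gamma> \<mu> \<longleftrightarrow>
    (\<forall>\<^sub>F k in sequentially. \<forall>v \<in> reps (M k).
       inverse d * adj_product M \<Gamma> k K (\<mu> k) v = \<mu> k v \<and> \<mu> k v = d * \<mu> (k + K) v)"

end

theory Submission
  imports Defs "HOL-Computational_Algebra.Fundamental_Theorem_Algebra"
    "HOL-Analysis.Topology_Euclidean_Space"
begin

text \<open>
  The weights define traces on the endomorphism algebras of the \<open>N k\<close>, for which \<open>\<Delta>\<close> is isometric and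
  the loop operator is the adjoint of \<open>\<alpha> \<mapsto> W \<Delta>(\<alpha>) W\<^sup>*\<close>. Hence, for the Hilbert norm on
  transformations \<open>\<Lambda> k \<rightarrow> \<Omega> k\<close> that weights the component at \<open>u\<close> by \<open>w u\<close>, with \<open>w\<close> transported
  along the adjacency matrices of \<open>\<Gamma>\<close>, the loop operator is a contraction, and Pythagoras shows that it
  preserves the norm of \<open>\<eta> (k + 1)\<close> only if the pair \<open>(\<eta> k, \<eta> (k + 1))\<close> satisfies the exchange
  relation. By periodicity and the Perron-Frobenius condition, \<open>K\<close> consecutive loop operators become a
  contraction \<open>S\<close> of one finite-dimensional Hilbert space, and the \<open>a\<^sub>n = \<eta> (k + n K)\<close> form a bounded
  backward orbit of \<open>S\<close>. Some \<open>a\<^sub>i\<close> and \<open>a\<^bsub>i+m\<^esub>\<close> are arbitrarily close, so \<open>a\<^sub>0\<close> and \<open>a\<^sub>m\<close> are as close;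
  as the norms of the \<open>a\<^sub>n\<close> increase with \<open>n\<close>, those of \<open>a\<^sub>0\<close> and \<open>a\<^sub>1\<close> agree, and no step from \<open>k\<close> to
  \<open>k + K\<close> loses norm.
\<close>


text \<open>The Perron-Frobenius condition enters through an exact cancellation. Transport along one
  period turns \<open>\<mu> k\<close> into \<open>d * \<mu> k\<close>, that is
  \<open>d\<^sup>2 * \<mu> (k + K)\<close>. On the other side both weights in the Hilbert norm,
  \<open>\<mu>\<close> outside and \<open>\<nu>\<close> inside the traces, shrink by
  \<open>d\<close> over a period, so the squared norm formed at \<open>k + K\<close> is the one at
  \<open>k\<close> divided by \<open>d\<^sup>2\<close>. Without this balance a power of
  \<open>d\<close> would remain after each period, and the operator over a period would not contract
  a fixed norm. Two obstacles account for the length of the preparations. The axioms of the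
  categories do not mention decompositions into simple objects, so these have to be derived from
  finite dimension, the C*-identity, positivity and the splitting of projections before a trace can
  be written down. And the given bound concerns a supremum over all objects, possibly infinitely
  many, which controls a component only once the supremum is known to be finite.\<close>

section \<open>Composition of morphisms\<close>

text \<open>Bundles the three side conditions that the axioms ask of each morphism, so that typing
  facts can be chained with \<open>OF\<close>.\<close>

definition arr :: "('o, 'm) ccat \<Rightarrow> 'o \<Rightarrow> 'o \<Rightarrow> 'm \<Rightarrow> bool" where
  "arr C x y f \<longleftrightarrow> x \<in> obj C \<and> y \<in> obj C \<and> f \<in> hom C x y"

lemma arrD: "arr C x y f \<Longrightarrow> x \<in> obj C" "arr C x y f \<Longrightarrow> y \<in> obj C" "arr C x y f \<Longrightarrow> f \<in> hom C x y"
  by (simp_all add: arr_def)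

lemma scaleC_zero_left [simp]: "0 *\<^sub>C (x::'a::complex_vector) = 0"
  by (rule complex_vector.scale_zero_left)

lemma scaleC_zero_right [simp]: "c *\<^sub>C (0::'a::complex_vector) = 0"
  by (rule complex_vector.scale_zero_right)

context star_category
begin

lemma arr_idn: "x \<in> obj C \<Longrightarrow> arr C x x (idn C x)"
  by (simp add: arr_def idn_hom)

lemma arr_cmp: "\<lbrakk>arr C x y f; arr C y z g\<rbrakk> \<Longrightarrow> arr C x z (g \<cdot> f)"
  by (auto simp: arr_def intro: cmp_hom)

lemma arr_star: "arr C x y f \<Longrightarrow> arr C y x (star C f)"
  by (auto simp: arr_def intro: star_hom)

lemma arr_add: "\<lbrakk>arr C x y f; arr C x y g\<rbrakk> \<Longrightarrow> arr C x y (f + g)"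
  by (auto simp: arr_def intro: complex_vector.subspace_add hom_subspace)

lemma arr_diff: "\<lbrakk>arr C x y f; arr C x y g\<rbrakk> \<Longrightarrow> arr C x y (f - g)"
  by (auto simp: arr_def intro: complex_vector.subspace_diff hom_subspace)

lemma arr_scale: "arr C x y f \<Longrightarrow> arr C x y (c *\<^sub>C f)"
  by (auto simp: arr_def intro: complex_vector.subspace_scale hom_subspace)

lemma arr_zero: "\<lbrakk>x \<in> obj C; y \<in> obj C\<rbrakk> \<Longrightarrow> arr C x y 0"
  by (auto simp: arr_def intro: complex_vector.subspace_0 hom_subspace)

lemma arr_sum: "\<lbrakk>x \<in> obj C; y \<in> obj C; \<And>i. i \<in> I \<Longrightarrow> arr C x y (f i)\<rbrakk> \<Longrightarrow> arr C x y (\<Sum>i\<in>I. f i)"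
  by (auto simp: arr_def intro: complex_vector.subspace_sum hom_subspace)

lemma assoc: "\<lbrakk>arr C w x f; arr C x y g; arr C y z h\<rbrakk> \<Longrightarrow> (h \<cdot> g) \<cdot> f = h \<cdot> (g \<cdot> f)"
  by (auto simp: arr_def intro: cmp_assoc)

lemma idr: "arr C x y f \<Longrightarrow> f \<cdot> idn C x = f"
  by (auto simp: arr_def intro: cmp_idn_right)

lemma idl: "arr C x y f \<Longrightarrow> idn C y \<cdot> f = f"
  by (auto simp: arr_def intro: cmp_idn_left)

lemma addr: "\<lbrakk>arr C x y f; arr C x y f'; arr C y z g\<rbrakk> \<Longrightarrow> g \<cdot> (f + f') = g \<cdot> f + g \<cdot> f'"
  by (auto simp: arr_def intro: cmp_add_right)

lemma addl: "\<lbrakk>arr C x y f; arr C y z g; arr C y z g'\<rbrakk> \<Longrightarrow> (g + g') \<cdot> f = g \<cdot> f + g' \<cdot> f"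
  by (auto simp: arr_def intro: cmp_add_left)

lemma scaler: "\<lbrakk>arr C x y f; arr C y z g\<rbrakk> \<Longrightarrow> g \<cdot> (c *\<^sub>C f) = c *\<^sub>C (g \<cdot> f)"
  by (auto simp: arr_def intro: cmp_scale_right)

lemma scalel: "\<lbrakk>arr C x y f; arr C y z g\<rbrakk> \<Longrightarrow> (c *\<^sub>C g) \<cdot> f = c *\<^sub>C (g \<cdot> f)"
  by (auto simp: arr_def intro: cmp_scale_left)

lemma zeror: "\<lbrakk>x \<in> obj C; arr C y z g\<rbrakk> \<Longrightarrow> g \<cdot> 0 = 0"
  using scaler[of x y 0 z g 0] arr_zero[of x y] by (simp add: arr_def)

lemma zerol: "\<lbrakk>z \<in> obj C; arr C x y f\<rbrakk> \<Longrightarrow> 0 \<cdot> f = 0"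
  using scalel[of x y f z 0 0] arr_zero[of y z] by (simp add: arr_def)

lemma diffr: assumes "arr C x y f" "arr C x y f'" "arr C y z g" shows "g \<cdot> (f - f') = g \<cdot> f - g \<cdot> f'"
  using addr[OF arr_diff[OF assms(1,2)] assms(2,3)] by simp

lemma diffl: assumes "arr C x y f" "arr C y z g" "arr C y z g'" shows "(g - g') \<cdot> f = g \<cdot> f - g' \<cdot> f"
  using addl[OF assms(1) arr_diff[OF assms(2,3)] assms(3)] by simp

lemma sumr:
  assumes "x \<in> obj C" "arr C y z g" "\<And>i. i \<in> I \<Longrightarrow> arr C x y (f i)"
  shows "g \<cdot> (\<Sum>i\<in>I. f i) = (\<Sum>i\<in>I. g \<cdot> f i)"
  using assms(3)
proof (induction I rule: infinite_finite_induct)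
  case (insert i I)
  then show ?case
    using assms(1,2) by (simp add: addr[of x y _ _ z] arr_sum arrD(1)[OF assms(2)])
qed (auto simp: zeror[OF assms(1,2)])

lemma suml:
  assumes "z \<in> obj C" "arr C x y f" "\<And>i. i \<in> I \<Longrightarrow> arr C y z (g i)"
  shows "(\<Sum>i\<in>I. g i) \<cdot> f = (\<Sum>i\<in>I. g i \<cdot> f)"
  using assms(3)
proof (induction I rule: infinite_finite_induct)
  case (insert i I)
  then show ?case
    using assms(1,2) by (simp add: addl[of x y _ z] arr_sum arrD(2)[OF assms(2)])
qed (auto simp: zerol[OF assms(1,2)])

lemma starstar: "arr C x y f \<Longrightarrow> star C (star C f) = f"
  by (auto simp: arr_def intro: star_star)

lemma staradd: "\<lbrakk>arr C x y f; arr C x y g\<rbrakk> \<Longrightarrow> star C (f + g) = star C f + star C g"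
  by (auto simp: arr_def intro: star_add)

lemma starscale: "arr C x y f \<Longrightarrow> star C (c *\<^sub>C f) = cnj c *\<^sub>C star C f"
  by (auto simp: arr_def intro: star_scale)

lemma starcmp: "\<lbrakk>arr C x y f; arr C y z g\<rbrakk> \<Longrightarrow> star C (g \<cdot> f) = star C f \<cdot> star C g"
  by (auto simp: arr_def intro: star_cmp)

lemma starzero: "\<lbrakk>x \<in> obj C; y \<in> obj C\<rbrakk> \<Longrightarrow> star C 0 = 0"
  using starscale[of x y 0 0] arr_zero[of x y] by simp

lemma stardiff: assumes "arr C x y f" "arr C x y g" shows "star C (f - g) = star C f - star C g"
  using staradd[OF arr_diff[OF assms] assms(2)] by simp

lemma staridn: assumes "x \<in> obj C" shows "star C (idn C x) = idn C x"
proof -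
  note I = arr_idn[OF assms] and S = arr_star[OF arr_idn[OF assms]]
  have "idn C x = star C (star C (idn C x) \<cdot> idn C x)"
    using idr[OF S] starstar[OF I] by simp
  then show ?thesis
    using starcmp[OF I S] starstar[OF I] idr[OF S] by simp
qed

end


section \<open>Endomorphism algebras\<close>

context star_category
begin

text \<open>Horner evaluation of a polynomial at \<open>h\<close>. Composition is meaningful only on
  composable elements of \<open>'m\<close>, so the ambient type offers no ring in which to
  evaluate.\<close>

definition pev :: "'o \<Rightarrow> 'm \<Rightarrow> complex poly \<Rightarrow> 'm" where
  "pev x h p = fold_coeffs (\<lambda>a acc. a *\<^sub>C idn C x + h \<cdot> acc) p 0"

context
  fixes x h assumes h: "arr C x x h"
begin

lemma pev_0 [simp]: "pev x h 0 = 0"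
  by (simp add: pev_def)

lemma pev_pCons [simp]: "pev x h (pCons a p) = a *\<^sub>C idn C x + h \<cdot> pev x h p"
  using zeror[OF arrD(1)[OF h] h] by (cases "p = 0 \<and> a = 0") (auto simp: pev_def)

lemma arr_pev: "arr C x x (pev x h p)"
  by (induction p) (use h in \<open>auto intro!: arr_zero arr_add arr_scale arr_idn arr_cmp dest: arrD\<close>)

lemma pev_add: "pev x h (p + q) = pev x h p + pev x h q"
proof (induction p q rule: poly_induct2)
  case (pCons a p b q)
  then show ?case
    by (simp add: addr[OF arr_pev arr_pev h] scaleC_add_left)
qed auto

lemma pev_smult: "pev x h (smult c p) = c *\<^sub>C pev x h p"
  by (induction p) (auto simp: scaler[OF arr_pev h] scaleC_add_right scaleC_scaleC)

lemma pev_mult: "pev x h (p * q) = pev x h p \<cdot> pev x h q"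
proof (induction p)
  case 0
  then show ?case using zerol[OF arrD(1)[OF h] arr_pev] by simp
next
  case (pCons a p)
  have 1: "arr C x x (a *\<^sub>C idn C x)" using h by (auto intro: arr_scale arr_idn arrD)
  show ?case
    by (simp add: pev_add pev_smult pCons.IH addl[OF arr_pev 1 arr_cmp[OF arr_pev h]]
        scalel[OF arr_pev arr_idn] arrD[OF h] idl[OF arr_pev] assoc[OF arr_pev arr_pev h])
qed

lemma pev_monom_sum: "pev x h (\<Sum>i\<in>I. f i) = (\<Sum>i\<in>I. pev x h (f i))"
  by (induction I rule: infinite_finite_induct) (auto simp: pev_add)

end

end

section \<open>Spectral projections of self-adjoint endomorphisms\<close>

context fd_cstar_category
begin

text \<open>By the C*-identity both norms vanish together.\<close>

lemma eq_0_iff: assumes "arr C x y f" shows "star C f \<cdot> f = 0 \<longleftrightarrow> f = 0"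
proof -
  have "nrm C (star C f \<cdot> f) = (nrm C f)\<^sup>2" using assms by (auto simp: arr_def intro: cstar_identity)
  moreover have "arr C x x (star C f \<cdot> f)" using assms arr_cmp arr_star by blast
  ultimately show ?thesis using assms nrm_eq_0_iff[of x x "star C f \<cdot> f"] nrm_eq_0_iff[of x y f]
    by (auto simp: arr_def)
qed

text \<open>The \<open>card B + 1\<close> lowest powers of \<open>h\<close> lie in the span of
  \<open>card B\<close> vectors. A repetition among them is treated apart, because linear dependence
  is a property of their set, in which equal powers collapse.\<close>

lemma annihilating_poly:
  assumes h: "arr C x x h"
  shows "\<exists>p. p \<noteq> 0 \<and> pev x h p = 0"
proof -
  obtain B where B: "finite B" "hom C x x = complex_vector.span B"
    using hom_fin_dim[of x x] h unfolding arr_def by blast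
  define m where "m = (\<lambda>i. pev x h (monom 1 i))"
  have m: "m i \<in> complex_vector.span B" for i
    using arr_pev[OF h] B by (auto simp: m_def arr_def)
  show ?thesis
  proof (cases "inj_on m {..card B}")
    case False
    then obtain i j where ij: "i \<noteq> j" "m i = m j" by (auto simp: inj_on_def)
    have "pev x h (monom 1 i + smult (- 1) (monom 1 j)) = 0"
      using ij(2) by (simp only: pev_add[OF h] pev_smult[OF h])
        (simp add: m_def complex_vector.scale_minus_left scaleC_one)
    moreover have "coeff (monom 1 i + smult (- 1) (monom 1 j)) i \<noteq> (0::complex)" using ij(1) by simp
    ultimately show ?thesis by (metis coeff_0)
  next
    case True
    have "complex_vector.dependent (m ` {..card B})"
    proof (rule ccontr)
      assume "\<not> ?thesis"
      then have "card (m ` {..card B}) \<le> card B"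
        using complex_vector.independent_span_bound[OF B(1)] m by blast
      then show False using card_image[OF True] by simp
    qed
    then obtain u v where u: "(\<Sum>v\<in>m ` {..card B}. u v *\<^sub>C v) = 0" "v \<in> m ` {..card B}" "u v \<noteq> 0"
      unfolding complex_vector.dependent_finite[OF finite_imageI[OF finite_atMost]] by blast
    define p where "p = (\<Sum>i\<le>card B. smult (u (m i)) (monom 1 i))"
    have "pev x h p = (\<Sum>i\<le>card B. u (m i) *\<^sub>C m i)"
      by (simp only: p_def pev_monom_sum[OF h] pev_smult[OF h] m_def)
    also have "\<dots> = 0" using u(1) by (simp add: sum.reindex[OF True])
    finally have "pev x h p = 0" .
    moreover obtain i where i: "i \<le> card B" "v = m i" using u(2) by blast
    have "coeff p i = u (m i)"
      using i(1) by (simp add: p_def coeff_sum if_distrib if_distribR cong: if_cong)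
    then have "p \<noteq> 0" using u(3) i by auto
    ultimately show ?thesis by blast
  qed
qed

text \<open>With \<open>(t - r) g(t)\<close> a minimal polynomial of \<open>h\<close>, the spectral projection of \<open>h\<close> at \<open>r\<close> is
  \<open>g(h) / g(r)\<close>.\<close>

lemma selfadjoint_scalar:
  assumes h: "arr C x x h" "star C h = h"
    and triv: "\<And>q. \<lbrakk>arr C x x q; q \<cdot> q = q; star C q = q\<rbrakk> \<Longrightarrow> q = 0 \<or> q = idn C x"
  shows "\<exists>c. h = c *\<^sub>C idn C x"
proof (cases "idn C x = 0")
  case True
  then show ?thesis using idl[OF h(1)] zerol[OF _ h(1)] h(1) by (auto simp: arr_def)
next
  case False
  have x: "x \<in> obj C" using h(1) by (simp add: arr_def)
  have I: "arr C x x (idn C x)" using x by (rule arr_idn)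
  note P = arr_pev[OF h(1)]
  \<comment> \<open>A minimal polynomial up to a scalar: least degree guarantees that
    \<open>g(h)\<close> stays nonzero once a linear factor is split off.\<close>
  obtain p where p: "p \<noteq> 0" "pev x h p = 0"
      and least: "\<And>q. q \<noteq> 0 \<Longrightarrow> pev x h q = 0 \<Longrightarrow> degree p \<le> degree q"
    using ex_has_least_nat[of "\<lambda>p. p \<noteq> 0 \<and> pev x h p = 0" _ degree] annihilating_poly[OF h(1)]
    by metis
  have "degree p \<noteq> 0"
  proof
    assume "degree p = 0"
    then obtain c where c: "p = [:c:]" by (metis degree_eq_zeroE)
    then show False using p False zeror[OF x h(1)] h by auto
  qed
  then have "\<not> constant (poly p)" by (simp add: constant_degree)
  then obtain r where "poly p r = 0" using fundamental_theorem_of_algebra by blast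
  then obtain g where g: "p = [:- r, 1:] * g" by (metis poly_eq_0_iff_dvd dvd_def)
  have "g \<noteq> 0" using p g by auto
  then have "degree p = Suc (degree g)" unfolding g by (subst degree_mult_eq) auto
  then have G0: "pev x h g \<noteq> 0" using least[OF \<open>g \<noteq> 0\<close>] by fastforce
  define y where "y = pev x h g"
  have y: "arr C x x y" "y \<noteq> 0" using P G0 by (auto simp: y_def)
  have lin: "pev x h [:- a, 1:] = h - a *\<^sub>C idn C x" for a
    using h I by (simp add: scaleC_one idr complex_vector.scale_minus_left zeror[OF x h(1)])
  have hy: "h \<cdot> y = r *\<^sub>C y"
  proof -
    have "0 = pev x h [:- r, 1:] \<cdot> y" using p(2) pev_mult[OF h(1)] by (simp only: g y_def)
    also have "\<dots> = h \<cdot> y - r *\<^sub>C y"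
      unfolding lin using diffl[OF y(1) h(1) arr_scale[OF I]] scalel[OF y(1) I] idl[OF y(1)] by simp
    finally show ?thesis by simp
  qed
  have yh: "star C y \<cdot> h = cnj r *\<^sub>C star C y"
    using starcmp[OF y(1) h(1)] hy starscale[OF y(1)] h(2) by simp
  have ys: "arr C x x (star C y)" using y arr_star by blast
  \<comment> \<open>Both sides are \<open>star C y \<cdot> h \<cdot> y\<close>, bracketed
    differently: an eigenvalue of a self-adjoint endomorphism is real.\<close>
  have "r *\<^sub>C (star C y \<cdot> y) = cnj r *\<^sub>C (star C y \<cdot> y)"
    by (metis assoc[OF y(1) h(1) ys] hy yh scalel[OF y(1) ys] scaler[OF y(1) ys])
  moreover have "star C y \<cdot> y \<noteq> 0" using eq_0_iff y by blast
  ultimately have r: "cnj r = r" by (metis complex_vector.scale_right_imp_eq)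
  \<comment> \<open>\<open>star C y\<close> is a left eigenvector of \<open>h\<close>, hence of
    every polynomial in \<open>h\<close>. The choice \<open>q = g\<close> gives
    \<open>star C y \<cdot> y = poly g r *\<^sub>C star C y\<close>, which shows that
    \<open>poly g r\<close> is nonzero and yields a projection after normalisation.\<close>
  have ev: "star C y \<cdot> pev x h q = poly q r *\<^sub>C star C y" for q
  proof (induction q)
    case 0
    then show ?case using zeror[OF x ys] by (simp add: h)
  next
    case (pCons a q)
    have "star C y \<cdot> (h \<cdot> pev x h q) = r *\<^sub>C (star C y \<cdot> pev x h q)"
      using assoc[OF P h(1) ys] yh r scalel[OF P ys] by simp
    then show ?case using pCons
      by (simp add: h addr[OF arr_scale[OF I] arr_cmp[OF P h(1)] ys] scaler[OF I ys] idr[OF ys]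
          scaleC_scaleC scaleC_add_left)
  qed
  have gr: "poly g r \<noteq> 0"
  proof
    assume "poly g r = 0"
    then have "star C y \<cdot> y = 0" using ev[of g] by (simp add: y_def)
    then show False using eq_0_iff y by blast
  qed
  define q where "q = (1 / poly g r) *\<^sub>C y"
  have q: "arr C x x q" "arr C x x (star C q)"
    using y by (auto simp: q_def intro: arr_scale arr_star)
  have q0: "q \<noteq> 0" using y gr by (simp add: q_def)
  \<comment> \<open>The left side is self-adjoint, so this one equation makes \<open>q\<close> both
    self-adjoint and idempotent.\<close>
  have qq: "star C q \<cdot> q = star C q"
    using ev[of g] gr y ys
    by (simp add: q_def starscale[OF y(1)] scalel[OF arr_scale[OF y(1)] ys] scaler[OF y(1) ys] scaleC_scaleC
        flip: y_def)
  have sq: "star C q = q"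
    using qq starcmp[OF q] starstar[OF q(1)] by simp
  have "q = idn C x" using triv[OF q(1)] qq sq q0 by simp
  moreover have "h \<cdot> q = r *\<^sub>C q"
    using hy scaler[OF y(1) h(1)] by (simp add: q_def scaleC_scaleC mult.commute)
  ultimately show ?thesis using idr[OF h(1)] by auto
qed

text \<open>An arbitrary \<open>f\<close> reduces to the self-adjoint case through its real and
  imaginary parts: \<open>f\<close> is half of \<open>a - \<i> *\<^sub>C b\<close>.\<close>

lemma trivial_projections_imp_scalar:
  assumes x: "x \<in> obj C"
    and triv: "\<And>q. \<lbrakk>arr C x x q; q \<cdot> q = q; star C q = q\<rbrakk> \<Longrightarrow> q = 0 \<or> q = idn C x"
  shows "hom C x x = range (\<lambda>c. c *\<^sub>C idn C x)"
proof (intro equalityI subsetI)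
  fix f assume "f \<in> hom C x x"
  then have f: "arr C x x f" using x by (simp add: arr_def)
  have fs: "arr C x x (star C f)" using f by (rule arr_star)
  define a where "a = f + star C f"
  define b where "b = \<i> *\<^sub>C (f - star C f)"
  have a: "arr C x x a" "star C a = a"
    using f fs by (auto simp: a_def staradd[OF f fs] starstar[OF f] arr_add)
  have "star C b = (- \<i>) *\<^sub>C (star C f - f)"
    unfolding b_def using starscale[OF arr_diff[OF f fs]] by (simp add: stardiff[OF f fs] starstar[OF f])
  then have b: "arr C x x b" "star C b = b"
    using f fs by (auto simp: b_def complex_vector.scale_right_diff_distrib intro!: arr_scale arr_diff)
  obtain c where c: "a = c *\<^sub>C idn C x" using selfadjoint_scalar[OF a triv] by blast
  obtain e where e: "b = e *\<^sub>C idn C x" using selfadjoint_scalar[OF b triv] by blast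
  have "f = (1/2) *\<^sub>C (a - \<i> *\<^sub>C b)"
    by (simp add: a_def b_def complex_vector.scale_right_diff_distrib scaleC_add_right scaleC_scaleC
        flip: scaleC_add_left)
  also have "\<dots> = ((1/2) * (c - \<i> * e)) *\<^sub>C idn C x"
    unfolding c e by (simp only: scaleC_scaleC complex_vector.scale_left_diff_distrib
        complex_vector.scale_right_diff_distrib right_diff_distrib)
  finally show "f \<in> range (\<lambda>c. c *\<^sub>C idn C x)" by blast
next
  fix f assume "f \<in> range (\<lambda>c. c *\<^sub>C idn C x)"
  then show "f \<in> hom C x x" using arr_scale[OF arr_idn[OF x]] by (auto simp: arr_def)
qed

end


section \<open>Decomposition into simple objects\<close>

definition coord :: "('o, 'm::complex_vector) ccat \<Rightarrow> 'o \<Rightarrow> 'm \<Rightarrow> complex" where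
  "coord C u s = (THE c. s = c *\<^sub>C idn C u)"

text \<open>An orthonormal decomposition of \<open>x\<close>. The multiplicity of a simple object is
  the number of pairs with that first component; orthogonality forces their isometries to be
  distinct, so a set suffices.\<close>

definition decomp :: "('o, 'm::complex_vector) ccat \<Rightarrow> 'o \<Rightarrow> ('o \<times> 'm) set \<Rightarrow> bool" where
  "decomp C x D \<longleftrightarrow> finite D \<and>
    (\<forall>p\<in>D. fst p \<in> reps C \<and> arr C (fst p) x (snd p) \<and> star C (snd p) \<cdot>\<^bsub>C\<^esub> snd p = idn C (fst p)) \<and>
    (\<forall>p\<in>D. \<forall>q\<in>D. p \<noteq> q \<longrightarrow> star C (snd p) \<cdot>\<^bsub>C\<^esub> snd q = 0) \<and>
    (\<Sum>p\<in>D. snd p \<cdot>\<^bsub>C\<^esub> star C (snd p)) = idn C x"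

section \<open>Scalars of simple objects and Schur's lemma\<close>

context finite_semisimple_cstar_category
begin

lemma reps_obj: "u \<in> reps C \<Longrightarrow> u \<in> obj C"
  using reps_simple by (auto simp: simple_obj_def)

lemma coord_scale: "u \<in> reps C \<Longrightarrow> coord C u (c *\<^sub>C idn C u) = c"
  using reps_simple[of u] unfolding coord_def simple_obj_def
  by (intro the_equality) (auto dest: complex_vector.scale_right_imp_eq)

lemma coord_eq: assumes "u \<in> reps C" "arr C u u s" shows "s = coord C u s *\<^sub>C idn C u"
proof -
  obtain c where "s = c *\<^sub>C idn C u"
    using reps_simple[OF assms(1)] assms(2) by (auto simp: simple_obj_def arr_def)
  then show ?thesis using coord_scale[OF assms(1)] by simp
qed

lemma coord_idn: "u \<in> reps C \<Longrightarrow> coord C u (idn C u) = 1"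
  using coord_scale[of u 1] by (simp add: scaleC_one)

lemma coord_zero: "u \<in> reps C \<Longrightarrow> coord C u 0 = 0"
  using coord_scale[of u 0] by simp

lemma coord_add: assumes "u \<in> reps C" "arr C u u s" "arr C u u t"
  shows "coord C u (s + t) = coord C u s + coord C u t"
  using coord_scale[OF assms(1), of "coord C u s + coord C u t"]
  unfolding scaleC_add_left by (simp flip: coord_eq[OF assms(1,2)] coord_eq[OF assms(1,3)])

lemma coord_scaleC: assumes "u \<in> reps C" "arr C u u s"
  shows "coord C u (c *\<^sub>C s) = c * coord C u s"
  using coord_scale[OF assms(1), of "c * coord C u s"]
  by (simp flip: scaleC_scaleC coord_eq[OF assms])

lemma coord_cmp: assumes "u \<in> reps C" "arr C u u s" "arr C u u t"
  shows "coord C u (s \<cdot> t) = coord C u s * coord C u t"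
proof -
  have "s \<cdot> t = coord C u s *\<^sub>C t"
    using coord_eq[OF assms(1,2)] scalel[OF assms(3) arr_idn] idl[OF assms(3)] reps_obj[OF assms(1)]
    by metis
  then show ?thesis using coord_scaleC[OF assms(1,3)] by simp
qed

lemma coord_star: assumes "u \<in> reps C" "arr C u u s"
  shows "coord C u (star C s) = cnj (coord C u s)"
proof -
  have "star C s = cnj (coord C u s) *\<^sub>C idn C u"
    using coord_eq[OF assms] starscale[OF arr_idn] staridn reps_obj[OF assms(1)] by metis
  then show ?thesis using coord_scale[OF assms(1)] by simp
qed

text \<open>Otherwise \<open>star C f \<cdot> f\<close> and \<open>f \<cdot> star C f\<close> are
  scalars, the first nonzero; bracketing \<open>f \<cdot> star C f \<cdot> f\<close> in two ways
  shows that they agree. A multiple of \<open>star C f\<close> then inverts \<open>f\<close>, and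
  two distinct representatives would be isomorphic.\<close>

lemma schur: assumes u: "u \<in> reps C" and v: "v \<in> reps C" and f: "arr C u v f" and "u \<noteq> v"
  shows "f = 0"
proof (rule ccontr)
  assume "f \<noteq> 0"
  note fs = arr_star[OF f]
  define c where "c = coord C u (star C f \<cdot> f)"
  define e where "e = coord C v (f \<cdot> star C f)"
  have c: "star C f \<cdot> f = c *\<^sub>C idn C u" and e: "f \<cdot> star C f = e *\<^sub>C idn C v"
    unfolding c_def e_def using coord_eq u v arr_cmp f fs by blast+
  have "c \<noteq> 0" using c eq_0_iff[OF f] \<open>f \<noteq> 0\<close> by auto
  have "c *\<^sub>C f = e *\<^sub>C f"
    using assoc[OF f fs f] unfolding c e
    using scaler[OF arr_idn f] scalel[OF f arr_idn] idl[OF f] idr[OF f] reps_obj u v by metis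
  then have "c = e" using \<open>f \<noteq> 0\<close> by (metis complex_vector.scale_right_imp_eq)
  define g where "g = (1 / c) *\<^sub>C star C f"
  have g: "arr C v u g" using fs by (simp add: g_def arr_scale)
  have "g \<cdot> f = idn C u" "f \<cdot> g = idn C v"
    using \<open>c \<noteq> 0\<close> \<open>c = e\<close> c e scalel[OF f fs] scaler[OF fs f]
    by (simp_all add: g_def scaleC_scaleC scaleC_one)
  then have "iso_obj C u v" using f g by (auto simp: iso_obj_def arr_def)
  moreover have "iso_obj C u u"
    using arr_idn[OF reps_obj[OF u]] idl[of u u "idn C u"] by (auto simp: iso_obj_def arr_def)
  ultimately show False using reps_representatives[OF reps_simple[OF u]] u v \<open>u \<noteq> v\<close> by blast
qed

text \<open>The positivity axiom replaces \<open>f\<close> by an endomorphism \<open>g\<close> of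
  \<open>u\<close>, which is a scalar; the number sought is its squared modulus.\<close>

lemma star_cmp_scalar:
  assumes u: "u \<in> reps C" and f: "arr C u y f"
  shows "\<exists>r\<ge>0. star C f \<cdot> f = complex_of_real r *\<^sub>C idn C u"
proof -
  obtain g where g: "arr C u u g" "star C f \<cdot> f = star C g \<cdot> g"
    using star_cmp_positive[of u y f] f by (auto simp: arr_def)
  define c where "c = coord C u g"
  have "star C g \<cdot> g = coord C u (star C g \<cdot> g) *\<^sub>C idn C u"
    by (rule coord_eq[OF u arr_cmp[OF g(1) arr_star[OF g(1)]]])
  also have "coord C u (star C g \<cdot> g) = complex_of_real ((cmod c)\<^sup>2)"
    unfolding coord_cmp[OF u arr_star[OF g(1)] g(1)] coord_star[OF u g(1)] c_def[symmetric]
    by (metis complex_norm_square mult.commute)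
  finally show ?thesis using g(2) by (intro exI[of _ "(cmod c)\<^sup>2"]) auto
qed

text \<open>Polar decomposition in the simplest case: for an isomorphism \<open>f\<close> from the
  representative, \<open>star C f \<cdot> f\<close> is a positive scalar \<open>r\<close>, and
  dividing by \<open>sqrt r\<close> gives an isometry \<open>h\<close>. Since \<open>x\<close> is
  simple, \<open>h \<cdot> star C h\<close> is a scalar too, and composing with \<open>h\<close>
  shows that it is 1.\<close>

lemma unitary_rep:
  assumes x: "simple_obj C x"
  shows "\<exists>u\<in>reps C. \<exists>f. arr C u x f \<and> star C f \<cdot> f = idn C u \<and> f \<cdot> star C f = idn C x"
proof -
  have xo: "x \<in> obj C" and x0: "idn C x \<noteq> 0" using x by (auto simp: simple_obj_def)
  obtain u where u: "u \<in> reps C" "iso_obj C x u" using reps_representatives[OF x] by blast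
  then obtain g f where gf: "arr C x u g" "arr C u x f" "f \<cdot> g = idn C x"
    using xo reps_obj[OF u(1)] by (auto simp: iso_obj_def arr_def)
  have f0: "f \<noteq> 0" using zerol[OF xo gf(1)] gf(3) x0 by auto
  obtain r where r: "r \<ge> 0" "star C f \<cdot> f = complex_of_real r *\<^sub>C idn C u"
    using star_cmp_scalar[OF u(1) gf(2)] by blast
  have r0: "r > 0" using r f0 eq_0_iff[OF gf(2)] by (cases "r = 0") auto
  define h where "h = complex_of_real (1 / sqrt r) *\<^sub>C f"
  have h: "arr C u x h" using gf by (simp add: h_def arr_scale)
  note hs = arr_star[OF h]
  have "star C h \<cdot> h = complex_of_real (1 / sqrt r) *\<^sub>C (complex_of_real (1 / sqrt r) *\<^sub>C (star C f \<cdot> f))"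
    unfolding h_def starscale[OF gf(2)]
    using scalel[OF arr_scale[OF gf(2)] arr_star[OF gf(2)]] scaler[OF gf(2) arr_star[OF gf(2)]]
    by simp
  also have "\<dots> = idn C u"
  proof -
    have "1 / sqrt r * (1 / sqrt r) * r = 1" using r0 by (simp add: field_simps)
    then have "complex_of_real (1 / sqrt r) * (complex_of_real (1 / sqrt r) * complex_of_real r) = 1"
      by (metis mult.assoc of_real_1 of_real_mult)
    then show ?thesis unfolding r scaleC_scaleC by (simp only: scaleC_one)
  qed
  finally have 1: "star C h \<cdot> h = idn C u" .
  obtain c where c: "h \<cdot> star C h = c *\<^sub>C idn C x"
    using x arr_cmp[OF hs h] by (auto simp: simple_obj_def arr_def)
  have h0: "h \<noteq> 0" using f0 r0 by (simp add: h_def)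
  have "c *\<^sub>C h = 1 *\<^sub>C h"
    using assoc[OF h hs h] c 1 idr[OF h] scalel[OF h arr_idn[OF xo]] idl[OF h] by (simp add: scaleC_one)
  then have "c = 1" using h0 by (metis complex_vector.scale_right_imp_eq)
  then show ?thesis using u(1) h 1 c by (auto simp: scaleC_one)
qed

section \<open>Minimal projections and maximal orthogonal families\<close>

definition proj where
  "proj x p \<longleftrightarrow> arr C x x p \<and> p \<cdot> p = p \<and> star C p = p"

text \<open>The hypothesis \<open>p \<cdot> q = q\<close> says that \<open>q\<close> is a
  subprojection of \<open>p\<close>. Splitting \<open>p\<close> through an object \<open>y\<close>
  turns minimality into the absence of nontrivial projections on \<open>y\<close>, so
  \<open>y\<close> is simple and unitarily equivalent to a representative.\<close>

lemma minimal_projection: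
  assumes p: "proj x p" "p \<noteq> 0"
    and min: "\<And>q. proj x q \<Longrightarrow> p \<cdot> q = q \<Longrightarrow> q = 0 \<or> q = p"
  shows "\<exists>u\<in>reps C. \<exists>f. arr C u x f \<and> star C f \<cdot> f = idn C u \<and> f \<cdot> star C f = p"
proof -
  have x: "x \<in> obj C" using p by (auto simp: proj_def arr_def)
  obtain y i where yi: "arr C y x i" "star C i \<cdot> i = idn C y" "i \<cdot> star C i = p"
    using subobjects[OF x, of p] p x by (auto simp: proj_def arr_def)
  note ist = arr_star[OF yi(1)]
  have y: "y \<in> obj C" using yi by (simp add: arr_def)
  have triv: "q = 0 \<or> q = idn C y" if q: "arr C y y q" "q \<cdot> q = q" "star C q = q" for q
  proof -
    \<comment> \<open>Conjugation by the isometry \<open>i\<close> carries a projection on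
      \<open>y\<close> to a subprojection of \<open>p\<close>; \<open>q\<close> is recovered as
      \<open>star C i \<cdot> r \<cdot> i\<close>.\<close>
    define r where "r = i \<cdot> (q \<cdot> star C i)"
    note qi = arr_cmp[OF ist q(1)]
    have r: "arr C x x r" unfolding r_def by (rule arr_cmp[OF qi yi(1)])
    have iqi: "star C i \<cdot> r = q \<cdot> star C i"
      unfolding r_def using assoc[OF qi yi(1) ist] yi(2) idl[OF qi] by simp
    have "r \<cdot> r = i \<cdot> (q \<cdot> (q \<cdot> star C i))"
      using assoc[OF r qi yi(1)] assoc[OF r ist q(1)] iqi by (simp add: r_def)
    then have "r \<cdot> r = r" using assoc[OF ist q(1) q(1)] q(2) by (simp add: r_def)
    moreover have "star C r = r"
      using starcmp[OF qi yi(1)] starcmp[OF ist q(1)] starstar[OF yi(1)] q(3)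
        assoc[OF ist q(1) yi(1)] by (simp add: r_def)
    moreover have "p \<cdot> r = r"
      using yi(3) assoc[OF r ist yi(1)] iqi by (simp add: r_def)
    ultimately have "r = 0 \<or> r = p" using min r by (simp add: proj_def)
    moreover have "q = (star C i \<cdot> r) \<cdot> i"
      using iqi assoc[OF yi(1) ist q(1)] yi(2) idr[OF q(1)] by simp
    moreover have "(star C i \<cdot> p) \<cdot> i = idn C y"
      using yi(3) assoc[OF ist yi(1) ist] yi(2) idl[OF ist] by simp
    moreover have "(star C i \<cdot> 0) \<cdot> i = 0" using zeror[OF x ist] zerol[OF y yi(1)] by simp
    ultimately show ?thesis by auto
  qed
  have "idn C y \<noteq> 0"
  proof
    assume "idn C y = 0"
    then have "i = 0" using idr[OF yi(1)] zeror[OF y yi(1)] by simp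
    then show False using yi(3) zerol[OF x ist] p(2) by simp
  qed
  then have "simple_obj C y"
    unfolding simple_obj_def by (intro conjI y trivial_projections_imp_scalar[OF y] triv)
  from unitary_rep[OF this]
  obtain u g where g: "u \<in> reps C" "arr C u y g" "star C g \<cdot> g = idn C u" "g \<cdot> star C g = idn C y"
    by blast
  note gs = arr_star[OF g(2)]
  note ig = arr_cmp[OF g(2) yi(1)]
  have s: "star C (i \<cdot> g) = star C g \<cdot> star C i" by (rule starcmp[OF g(2) yi(1)])
  have "star C (i \<cdot> g) \<cdot> (i \<cdot> g) = star C g \<cdot> (star C i \<cdot> (i \<cdot> g))"
    unfolding s by (rule assoc[OF ig ist gs])
  also have "star C i \<cdot> (i \<cdot> g) = g" using assoc[OF g(2) yi(1) ist] yi(2) idl[OF g(2)] by simp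
  finally have 1: "star C (i \<cdot> g) \<cdot> (i \<cdot> g) = idn C u" using g(3) by simp
  have "(i \<cdot> g) \<cdot> star C (i \<cdot> g) = i \<cdot> (g \<cdot> (star C g \<cdot> star C i))"
    unfolding s by (rule assoc[OF arr_cmp[OF ist gs] g(2) yi(1)])
  also have "g \<cdot> (star C g \<cdot> star C i) = star C i"
    using assoc[OF ist gs g(2)] g(4) idl[OF ist] by simp
  finally show ?thesis using yi(3) g(1) ig 1 by auto
qed

definition orth_family where
  "orth_family x P \<longleftrightarrow> finite P \<and> (\<forall>p\<in>P. proj x p \<and> p \<noteq> 0) \<and> (\<forall>p\<in>P. \<forall>q\<in>P. p \<noteq> q \<longrightarrow> p \<cdot> q = 0)"

lemma orth_family_arr: "orth_family x P \<Longrightarrow> p \<in> P \<Longrightarrow> arr C x x p"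
  by (auto simp: orth_family_def proj_def)

lemma orth_family_sum_cmp:
  assumes "orth_family x P" "p \<in> P" "x \<in> obj C"
  shows "p \<cdot> (\<Sum>q\<in>P. c q *\<^sub>C q) = c p *\<^sub>C p"
proof -
  have "p \<cdot> (\<Sum>q\<in>P. c q *\<^sub>C q) = (\<Sum>q\<in>P. p \<cdot> (c q *\<^sub>C q))"
    using assms by (intro sumr[of x x x]) (auto intro: arr_scale orth_family_arr)
  also have "\<dots> = (\<Sum>q\<in>P. if q = p then c p *\<^sub>C p else 0)"
  proof (rule sum.cong[OF refl])
    fix q assume q: "q \<in> P"
    have "p \<cdot> (c q *\<^sub>C q) = c q *\<^sub>C (p \<cdot> q)"
      using assms q by (intro scaler[of x x _ x]) (auto intro: orth_family_arr)
    then show "p \<cdot> (c q *\<^sub>C q) = (if q = p then c p *\<^sub>C p else 0)"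
      using assms q by (auto simp: orth_family_def proj_def)
  qed
  also have "\<dots> = c p *\<^sub>C p" using assms by (simp add: orth_family_def)
  finally show ?thesis .
qed

text \<open>Composing a vanishing linear combination with a member isolates its coefficient, so an
  orthogonal family of nonzero projections is linearly independent.\<close>

lemma orth_family_card_bound:
  assumes x: "x \<in> obj C"
  shows "\<exists>n. \<forall>P. orth_family x P \<longrightarrow> card P \<le> n"
proof -
  obtain B where B: "finite B" "hom C x x = complex_vector.span B"
    using hom_fin_dim[OF x x] by blast
  have "card P \<le> card B" if P: "orth_family x P" for P
  proof -
    have "complex_vector.independent P"
    proof
      assume dep: "complex_vector.dependent P"
      have "finite P" using P by (simp add: orth_family_def)
      from dep obtain c p where c: "(\<Sum>v\<in>P. c v *\<^sub>C v) = 0" "p \<in> P" "c p \<noteq> 0"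
        unfolding complex_vector.dependent_finite[OF \<open>finite P\<close>] by blast
      then have "c p *\<^sub>C p = 0"
        using orth_family_sum_cmp[OF P c(2) x] zeror[OF x orth_family_arr[OF P c(2)]] by metis
      then show False using c P by (auto simp: orth_family_def)
    qed
    moreover have "P \<subseteq> complex_vector.span B"
      using P B(2) by (auto simp: orth_family_def proj_def arr_def)
    ultimately show ?thesis using complex_vector.independent_span_bound[OF B(1)] by blast
  qed
  then show ?thesis by blast
qed

lemma proj_orth_sym: assumes "proj x p" "proj x q" "p \<cdot> q = 0" shows "q \<cdot> p = 0"
proof -
  have "x \<in> obj C" using assms by (auto simp: proj_def arr_def)
  then show ?thesis using assms starcmp[of x x q x p] starzero by (auto simp: proj_def)
qed

lemma orth_family_insert:
  assumes P: "orth_family x P" and r: "proj x r" "r \<noteq> 0" "\<And>p. p \<in> P \<Longrightarrow> r \<cdot> p = 0"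
  shows "orth_family x (insert r P)" "r \<notin> P"
  using assms proj_orth_sym[OF r(1)] by (auto simp: orth_family_def proj_def)

text \<open>Take an orthogonal family of nonzero projections with the most members. Its sum is the
  identity, as otherwise the complement \<open>r\<close> could be added; each member
  \<open>p\<close> is minimal, as otherwise \<open>p\<close> could be replaced by the two
  projections \<open>q\<close> and \<open>p - q\<close>. Each minimal projection then comes from an
  isometry out of a representative.\<close>

lemma ex_decomp:
  assumes x: "x \<in> obj C"
  shows "\<exists>D. decomp C x D"
proof -
  obtain n where n: "\<And>P. orth_family x P \<Longrightarrow> card P \<le> n"
    using orth_family_card_bound[OF x] by blast
  have "orth_family x {}" by (simp add: orth_family_def)
  with n have "\<exists>P. orth_family x P \<and> (\<forall>Q. orth_family x Q \<longrightarrow> card Q \<le> card P)"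
    by (intro ex_has_greatest_nat[of "orth_family x" "{}" card "Suc n"]) (auto simp: less_Suc_eq_le)
  then obtain P where P: "orth_family x P" and max: "\<And>Q. orth_family x Q \<Longrightarrow> card Q \<le> card P"
    by blast
  have fin: "finite P" using P by (simp add: orth_family_def)
  note I = arr_idn[OF x]
  have PA: "arr C x x p" if "p \<in> P" for p using P that by (rule orth_family_arr)
  define s where "s = (\<Sum>p\<in>P. p)"
  have sA: "arr C x x s" using PA x by (auto simp: s_def intro: arr_sum)
  have ps: "p \<cdot> s = p" if "p \<in> P" for p
    using orth_family_sum_cmp[OF P that x, of "\<lambda>_. 1"] by (simp add: s_def scaleC_one)
  have "star C s = s"
  proof -
    have "star C (\<Sum>p\<in>Q. p) = (\<Sum>p\<in>Q. p)" if "Q \<subseteq> P" for Q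
      using finite_subset[OF that fin] that
    proof (induction Q rule: finite_induct)
      case empty
      then show ?case using starzero x by simp
    next
      case (insert p Q)
      then have "star C p = p" using P by (auto simp: orth_family_def proj_def)
      moreover have "star C (p + sum (\<lambda>p. p) Q) = star C p + star C (sum (\<lambda>p. p) Q)"
        using insert PA x by (intro staradd[of x x] arr_sum) auto
      ultimately show ?case using insert by simp
    qed
    then show ?thesis by (simp add: s_def)
  qed
  have ss: "s \<cdot> s = s"
  proof -
    have "s \<cdot> s = (\<Sum>p\<in>P. p \<cdot> s)"
      unfolding s_def using suml[OF x sA PA] by (simp add: s_def)
    then show ?thesis using ps by (simp add: s_def)
  qed
  define r where "r = idn C x - s"
  have rA: "arr C x x r" using I sA by (simp add: r_def arr_diff)
  have rs: "r \<cdot> s = 0" using diffl[OF sA I sA] idl[OF sA] ss by (simp add: r_def)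
  have "r \<cdot> r = r" using diffr[OF I sA rA] rs idr[OF rA] by (simp add: r_def)
  moreover have rstar: "star C r = r"
    using stardiff[OF I sA] staridn[OF x] \<open>star C s = s\<close> by (simp add: r_def)
  ultimately have rp: "proj x r" using rA by (simp add: proj_def)
  have "p \<cdot> r = 0" if "p \<in> P" for p
    using diffr[OF I sA PA[OF that]] ps[OF that] idr[OF PA[OF that]] by (simp add: r_def)
  then have "r \<cdot> p = 0" if "p \<in> P" for p
    using that proj_orth_sym rp P by (auto simp: orth_family_def)
  then have "r = 0"
    using orth_family_insert[OF P rp] max[of "insert r P"] fin by fastforce
  then have sum1: "(\<Sum>p\<in>P. p) = idn C x" by (simp add: r_def s_def)
  have min: "q = 0 \<or> q = p" if p: "p \<in> P" and q: "proj x q" "p \<cdot> q = q" for p q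
  proof (rule ccontr)
    assume "\<not> ?thesis"
    then have q0: "q \<noteq> 0" "q \<noteq> p" by auto
    note pA = PA[OF p]
    have qA: "arr C x x q" and qp': "q \<cdot> q = q" "star C q = q" using q by (auto simp: proj_def)
    have pp: "proj x p" "p \<cdot> p = p" "star C p = p" using P p by (auto simp: orth_family_def proj_def)
    have qp: "q \<cdot> p = q" using starcmp[OF qA pA] q(2) qp'(2) pp(3) by simp
    have 1: "orth_family x (P - {p})" using P by (auto simp: orth_family_def)
    have "q \<cdot> t = 0" if "t \<in> P - {p}" for t
    proof -
      have "p \<cdot> t = 0" using that P p by (auto simp: orth_family_def)
      then show ?thesis using assoc[OF PA[of t] pA qA] qp zeror[OF x qA] that by auto
    qed
    note 2 = orth_family_insert[OF 1 q(1) q0(1) this]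
    have prA: "arr C x x (p - q)" using pA qA by (rule arr_diff)
    have "(p - q) \<cdot> (p - q) = p - q"
      using diffl[OF prA pA qA] diffr[OF pA qA pA] diffr[OF pA qA qA] pp qp qp' q by simp
    then have pq: "proj x (p - q)" using prA stardiff[OF pA qA] pp qp' by (simp add: proj_def)
    have "(p - q) \<cdot> t = 0" if "t \<in> insert q (P - {p})" for t
    proof (cases "t = q")
      case True
      then show ?thesis using diffl[OF qA pA qA] q qp' by simp
    next
      case False
      then have t: "t \<in> P" "t \<noteq> p" using that by auto
      have pt: "p \<cdot> t = 0" using t P p by (auto simp: orth_family_def)
      then have "q \<cdot> t = 0" using assoc[OF PA[OF t(1)] pA qA] qp zeror[OF x qA] by auto
      then show ?thesis using diffl[OF PA[OF t(1)] pA qA] pt by simp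
    qed
    note 3 = orth_family_insert[OF 2(1) pq _ this]
    have "card (insert (p - q) (insert q (P - {p}))) \<le> card P" using max 3 q0 by simp
    moreover have "card (insert (p - q) (insert q (P - {p}))) = Suc (Suc (card P - 1))"
      using 3(2) 2(2) q0 fin p by simp
    moreover have "card P > 0" using fin p card_gt_0_iff by blast
    ultimately show False by simp
  qed
  have "\<forall>p\<in>P. \<exists>uf. fst uf \<in> reps C \<and> arr C (fst uf) x (snd uf) \<and>
      star C (snd uf) \<cdot> snd uf = idn C (fst uf) \<and> snd uf \<cdot> star C (snd uf) = p"
  proof
    fix p assume p: "p \<in> P"
    then have "proj x p" "p \<noteq> 0" using P by (auto simp: orth_family_def)
    from minimal_projection[OF this min[OF p]]
    show "\<exists>uf. fst uf \<in> reps C \<and> arr C (fst uf) x (snd uf) \<and>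
      star C (snd uf) \<cdot> snd uf = idn C (fst uf) \<and> snd uf \<cdot> star C (snd uf) = p"
      by fastforce
  qed
  then obtain F where F: "\<And>p. p \<in> P \<Longrightarrow> fst (F p) \<in> reps C \<and> arr C (fst (F p)) x (snd (F p)) \<and>
      star C (snd (F p)) \<cdot> snd (F p) = idn C (fst (F p)) \<and> snd (F p) \<cdot> star C (snd (F p)) = p"
    by metis
  have inj: "inj_on F P"
  proof (rule inj_onI)
    fix p q assume "p \<in> P" "q \<in> P" "F p = F q"
    then show "p = q" using F[of p] F[of q] by metis
  qed
  have orth: "star C (snd (F p)) \<cdot> snd (F q) = 0" if pq: "p \<in> P" "q \<in> P" "p \<noteq> q" for p q
  proof -
    define f g where fg: "f = snd (F p)" "g = snd (F q)"
    have f: "arr C (fst (F p)) x f" "star C f \<cdot> f = idn C (fst (F p))" "f \<cdot> star C f = p"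
      and g: "arr C (fst (F q)) x g" "star C g \<cdot> g = idn C (fst (F q))" "g \<cdot> star C g = q"
      using F pq by (auto simp: fg)
    note fs = arr_star[OF f(1)] and gs = arr_star[OF g(1)]
    have fp: "star C f \<cdot> p = star C f"
      using assoc[OF fs f(1) fs] f(2) idl[OF fs] by (simp add: f(3))
    have qg: "q \<cdot> g = g" using assoc[OF g(1) gs g(1)] g(2) idr[OF g(1)] by (simp add: g(3))
    have "star C f \<cdot> g = (star C f \<cdot> p) \<cdot> (q \<cdot> g)" by (simp add: fp qg)
    also have "\<dots> = star C f \<cdot> ((p \<cdot> q) \<cdot> g)"
      using assoc[OF arr_cmp[OF g(1) PA[OF pq(2)]] PA[OF pq(1)] fs] assoc[OF g(1) PA[OF pq(2)] PA[OF pq(1)]]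
      by simp
    also have "p \<cdot> q = 0" using P pq by (auto simp: orth_family_def)
    finally show ?thesis
      using zerol[OF x g(1)] zeror[OF arrD(1)[OF g(1)] fs] by (simp add: fg)
  qed
  have "decomp C x (F ` P)"
    unfolding decomp_def using F fin orth sum1 by (auto simp: sum.reindex[OF inj] inj_on_def)
  then show ?thesis by blast
qed

end


section \<open>Traces\<close>

definition dec :: "('o, 'm::complex_vector) ccat \<Rightarrow> 'o \<Rightarrow> ('o \<times> 'm) set" where
  "dec C x = (SOME D. decomp C x D)"

text \<open>The weighted trace computed in the decomposition \<open>D\<close>: the projection onto
  one copy of \<open>u\<close> has trace \<open>w u\<close>.\<close>

definition trD :: "('o, 'm::complex_vector) ccat \<Rightarrow> ('o \<Rightarrow> real) \<Rightarrow> ('o \<times> 'm) set \<Rightarrow> 'm \<Rightarrow> complex" where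
  "trD C w D X = (\<Sum>p\<in>D. complex_of_real (w (fst p)) *
     coord C (fst p) (star C (snd p) \<cdot>\<^bsub>C\<^esub> (X \<cdot>\<^bsub>C\<^esub> snd p)))"

text \<open>The choice made by \<open>dec\<close> does not affect the value, see
  \<open>tr_eq\<close>.\<close>

definition tr :: "('o, 'm::complex_vector) ccat \<Rightarrow> ('o \<Rightarrow> real) \<Rightarrow> 'o \<Rightarrow> 'm \<Rightarrow> complex" where
  "tr C w x X = trD C w (dec C x) X"

text \<open>The squared Hilbert-Schmidt norm. The trace here is already real by
  \<open>tr_star_cmp\<close>; \<open>Re\<close> only changes the type.\<close>

definition qn :: "('o, 'm::complex_vector) ccat \<Rightarrow> ('o \<Rightarrow> real) \<Rightarrow> 'o \<Rightarrow> 'm \<Rightarrow> real" where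
  "qn C w x f = Re (tr C w x (star C f \<cdot>\<^bsub>C\<^esub> f))"

section \<open>Traciality, positivity and faithfulness of the weighted traces\<close>

context finite_semisimple_cstar_category
begin

lemma decompD:
  assumes "decomp C x D"
  shows "finite D" "p \<in> D \<Longrightarrow> fst p \<in> reps C" "p \<in> D \<Longrightarrow> arr C (fst p) x (snd p)"
    "p \<in> D \<Longrightarrow> star C (snd p) \<cdot> snd p = idn C (fst p)"
    "(\<Sum>p\<in>D. snd p \<cdot> star C (snd p)) = idn C x"
    "\<lbrakk>p \<in> D; q \<in> D; p \<noteq> q\<rbrakk> \<Longrightarrow> star C (snd p) \<cdot> snd q = 0"
  using assms unfolding decomp_def by blast+

lemma decomp_dec: "x \<in> obj C \<Longrightarrow> decomp C x (dec C x)"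
  unfolding dec_def by (rule someI_ex) (rule ex_decomp)

lemma expand_left:
  assumes D: "decomp C y D" and f: "arr C x y f"
  shows "(\<Sum>p\<in>D. snd p \<cdot> (star C (snd p) \<cdot> f)) = f"
proof -
  have y: "y \<in> obj C" using f by (rule arrD)
  have "idn C y \<cdot> f = (\<Sum>p\<in>D. (snd p \<cdot> star C (snd p)) \<cdot> f)"
    unfolding decompD(5)[OF D, symmetric]
    by (rule suml[OF y f]) (use decompD(3)[OF D] arr_star arr_cmp in blast)
  also have "\<dots> = (\<Sum>p\<in>D. snd p \<cdot> (star C (snd p) \<cdot> f))"
    by (rule sum.cong[OF refl], rule assoc[OF f]) (use decompD(3)[OF D] arr_star in blast)+
  finally show ?thesis using idl[OF f] by simp
qed

text \<open>Stated for arbitrary resolutions of the identity, because it is also applied to the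
  image of a decomposition under a functor, where the sources need no longer be simple.\<close>

lemma expand_right:
  assumes id: "(\<Sum>i\<in>I. f i \<cdot> star C (f i)) = idn C x" and f: "\<And>i. i \<in> I \<Longrightarrow> arr C (y i) x (f i)"
    and X: "arr C x z X"
  shows "(\<Sum>i\<in>I. (X \<cdot> f i) \<cdot> star C (f i)) = X"
proof -
  have x: "x \<in> obj C" using X by (rule arrD)
  have "X \<cdot> idn C x = (\<Sum>i\<in>I. X \<cdot> (f i \<cdot> star C (f i)))"
    unfolding id[symmetric]
    by (rule sumr[OF x X]) (use f arr_star arr_cmp in blast)
  also have "\<dots> = (\<Sum>i\<in>I. (X \<cdot> f i) \<cdot> star C (f i))"
    by (rule sum.cong[OF refl], rule assoc[symmetric, OF _ _ X]) (use f arr_star in blast)+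
  finally show ?thesis using idr[OF X] by simp
qed

lemma coord_sum:
  assumes "u \<in> reps C" "\<And>i. i \<in> I \<Longrightarrow> arr C u u (s i)"
  shows "coord C u (\<Sum>i\<in>I. s i) = (\<Sum>i\<in>I. coord C u (s i))"
  using assms(2)
proof (induction I rule: infinite_finite_induct)
  case (insert i I)
  then show ?case
    using coord_add[OF assms(1)] reps_obj[OF assms(1)] by (simp add: arr_sum)
qed (auto simp: coord_zero[OF assms(1)])

text \<open>For equal objects the scalars commute; for different ones Schur's lemma makes both sides
  vanish, so unequal weights never meet.\<close>

lemma coord_swap:
  assumes u: "u \<in> reps C" and v: "v \<in> reps C" and s: "arr C v u s" and t: "arr C u v t"
  shows "of_real (w u) * coord C u (s \<cdot> t) = of_real (w v) * coord C v (t \<cdot> s)"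
proof (cases "u = v")
  case True
  then show ?thesis using coord_cmp[OF u, of s t] coord_cmp[OF u, of t s] s t by simp
next
  case False
  then have "s = 0" using schur[OF v u s] by simp
  then show ?thesis
    using zerol[OF reps_obj[OF u] t] zeror[OF reps_obj[OF v] t] coord_zero u v by simp
qed

text \<open>Inserting the decomposition of the intermediate object \<open>y\<close> writes the trace
  of a product through matrix coefficients, where exchanging the factors becomes
  \<open>coord_swap\<close> under a double sum.\<close>

lemma trD_double:
  assumes D: "decomp C x D" and E: "decomp C y E" and f: "arr C x y f" and g: "arr C y x g"
  shows "trD C w D (g \<cdot> f) = (\<Sum>p\<in>D. \<Sum>q\<in>E. complex_of_real (w (fst p)) *
     coord C (fst p) ((star C (snd p) \<cdot> (g \<cdot> snd q)) \<cdot> (star C (snd q) \<cdot> (f \<cdot> snd p))))"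
  unfolding trD_def
proof (rule sum.cong[OF refl])
  fix p assume p: "p \<in> D"
  note pA = decompD(3)[OF D p] and pr = decompD(2)[OF D p]
  note psA = arr_star[OF pA]
  have fp: "arr C (fst p) y (f \<cdot> snd p)" using pA f by (rule arr_cmp)
  have qA: "arr C (fst q) y (snd q)" if "q \<in> E" for q using decompD(3)[OF E that] .
  have qf: "arr C (fst p) (fst q) (star C (snd q) \<cdot> (f \<cdot> snd p))" if "q \<in> E" for q
    using arr_cmp[OF fp arr_star[OF qA[OF that]]] .
  have gq: "arr C (fst q) x (g \<cdot> snd q)" if "q \<in> E" for q using arr_cmp[OF qA[OF that] g] .
  have "star C (snd p) \<cdot> ((g \<cdot> f) \<cdot> snd p) = star C (snd p) \<cdot> (g \<cdot> (f \<cdot> snd p))"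
    using assoc[OF pA f g] by simp
  also have "g \<cdot> (f \<cdot> snd p) = g \<cdot> (\<Sum>q\<in>E. snd q \<cdot> (star C (snd q) \<cdot> (f \<cdot> snd p)))"
    using expand_left[OF E fp] by simp
  also have "\<dots> = (\<Sum>q\<in>E. g \<cdot> (snd q \<cdot> (star C (snd q) \<cdot> (f \<cdot> snd p))))"
    by (rule sumr[OF arrD(1)[OF pA] g]) (rule arr_cmp[OF qf qA])
  also have "\<dots> = (\<Sum>q\<in>E. (g \<cdot> snd q) \<cdot> (star C (snd q) \<cdot> (f \<cdot> snd p)))"
    by (rule sum.cong[OF refl], rule assoc[symmetric, OF qf qA g])
  also have "star C (snd p) \<cdot> \<dots> =
      (\<Sum>q\<in>E. star C (snd p) \<cdot> ((g \<cdot> snd q) \<cdot> (star C (snd q) \<cdot> (f \<cdot> snd p))))"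
    by (rule sumr[OF arrD(1)[OF pA] psA]) (rule arr_cmp[OF qf gq])
  also have "\<dots> = (\<Sum>q\<in>E. (star C (snd p) \<cdot> (g \<cdot> snd q)) \<cdot> (star C (snd q) \<cdot> (f \<cdot> snd p)))"
    by (rule sum.cong[OF refl], rule assoc[symmetric, OF qf gq psA])
  finally have eq: "star C (snd p) \<cdot> ((g \<cdot> f) \<cdot> snd p) =
    (\<Sum>q\<in>E. (star C (snd p) \<cdot> (g \<cdot> snd q)) \<cdot> (star C (snd q) \<cdot> (f \<cdot> snd p)))" .
  show "of_real (w (fst p)) * coord C (fst p) (star C (snd p) \<cdot> ((g \<cdot> f) \<cdot> snd p)) =
     (\<Sum>q\<in>E. of_real (w (fst p)) *
       coord C (fst p) ((star C (snd p) \<cdot> (g \<cdot> snd q)) \<cdot> (star C (snd q) \<cdot> (f \<cdot> snd p))))"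
    unfolding eq sum_distrib_left[symmetric]
    by (rule arg_cong[OF coord_sum[OF pr]]) (rule arr_cmp[OF qf arr_cmp[OF gq psA]])
qed

lemma trD_comm:
  assumes D: "decomp C x D" and E: "decomp C y E" and f: "arr C x y f" and g: "arr C y x g"
  shows "trD C w D (g \<cdot> f) = trD C w E (f \<cdot> g)"
  unfolding trD_double[OF D E f g] trD_double[OF E D g f]
proof (subst sum.swap, intro sum.cong refl)
  fix p q assume q: "q \<in> E" and p: "p \<in> D"
  show "of_real (w (fst p)) * coord C (fst p) ((star C (snd p) \<cdot> (g \<cdot> snd q)) \<cdot> (star C (snd q) \<cdot> (f \<cdot> snd p)))
     = of_real (w (fst q)) * coord C (fst q) ((star C (snd q) \<cdot> (f \<cdot> snd p)) \<cdot> (star C (snd p) \<cdot> (g \<cdot> snd q)))"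
    by (rule coord_swap[OF decompD(2)[OF D p] decompD(2)[OF E q]
          arr_cmp[OF arr_cmp[OF decompD(3)[OF E q] g] arr_star[OF decompD(3)[OF D p]]]
          arr_cmp[OF arr_cmp[OF decompD(3)[OF D p] f] arr_star[OF decompD(3)[OF E q]]]])
qed

text \<open>Cyclicity with the identity as second factor compares two decompositions of the same
  object.\<close>

lemma tr_eq: assumes "decomp C x D" "arr C x x X" shows "tr C w x X = trD C w D X"
proof -
  have x: "x \<in> obj C" using assms(2) by (rule arrD)
  show ?thesis
    using trD_comm[OF decomp_dec[OF x] assms(1) assms(2) arr_idn[OF x], of w] idl[OF assms(2)] idr[OF assms(2)]
    by (simp add: tr_def)
qed

lemma tr_comm: assumes f: "arr C x y f" and g: "arr C y x g" shows "tr C w x (g \<cdot> f) = tr C w y (f \<cdot> g)"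
  unfolding tr_def by (rule trD_comm[OF decomp_dec decomp_dec f g]) (use f in \<open>auto simp: arr_def\<close>)

lemma arr_corner: assumes "decomp C x D" "p \<in> D" "arr C x x X"
  shows "arr C (fst p) (fst p) (star C (snd p) \<cdot> (X \<cdot> snd p))"
  using assms decompD(3) arr_cmp arr_star by metis

lemma tr_add: assumes X: "arr C x x X" and Y: "arr C x x Y"
  shows "tr C w x (X + Y) = tr C w x X + tr C w x Y"
proof -
  note D = decomp_dec[OF arrD(1)[OF X]]
  show ?thesis unfolding tr_def trD_def sum.distrib[symmetric]
  proof (rule sum.cong[OF refl])
    fix p assume p: "p \<in> dec C x"
    note pA = decompD(3)[OF D p]
    have "star C (snd p) \<cdot> ((X + Y) \<cdot> snd p) = star C (snd p) \<cdot> (X \<cdot> snd p) + star C (snd p) \<cdot> (Y \<cdot> snd p)"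
      using addl[OF pA X Y] addr[OF arr_cmp[OF pA X] arr_cmp[OF pA Y] arr_star[OF pA]] by simp
    then show "of_real (w (fst p)) * coord C (fst p) (star C (snd p) \<cdot> ((X + Y) \<cdot> snd p)) =
       of_real (w (fst p)) * coord C (fst p) (star C (snd p) \<cdot> (X \<cdot> snd p)) +
       of_real (w (fst p)) * coord C (fst p) (star C (snd p) \<cdot> (Y \<cdot> snd p))"
      using coord_add[OF decompD(2)[OF D p] arr_corner[OF D p X] arr_corner[OF D p Y]]
      by (simp add: distrib_left)
  qed
qed

lemma tr_scale: assumes X: "arr C x x X"
  shows "tr C w x (c *\<^sub>C X) = c * tr C w x X"
proof -
  note D = decomp_dec[OF arrD(1)[OF X]]
  show ?thesis unfolding tr_def trD_def sum_distrib_left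
  proof (rule sum.cong[OF refl])
    fix p assume p: "p \<in> dec C x"
    note pA = decompD(3)[OF D p]
    have "star C (snd p) \<cdot> ((c *\<^sub>C X) \<cdot> snd p) = c *\<^sub>C (star C (snd p) \<cdot> (X \<cdot> snd p))"
      using scalel[OF pA X] scaler[OF arr_cmp[OF pA X] arr_star[OF pA]] by simp
    then show "of_real (w (fst p)) * coord C (fst p) (star C (snd p) \<cdot> ((c *\<^sub>C X) \<cdot> snd p)) =
       c * (of_real (w (fst p)) * coord C (fst p) (star C (snd p) \<cdot> (X \<cdot> snd p)))"
      using coord_scaleC[OF decompD(2)[OF D p] arr_corner[OF D p X]] by simp
  qed
qed

lemma tr_zero: assumes "x \<in> obj C" shows "tr C w x 0 = 0"
  using tr_scale[OF arr_zero[OF assms assms], of w 0] by simp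

lemma tr_diff: assumes X: "arr C x x X" and Y: "arr C x x Y"
  shows "tr C w x (X - Y) = tr C w x X - tr C w x Y"
  using tr_add[OF arr_diff[OF X Y] Y, of w] by simp

lemma tr_sum: assumes "x \<in> obj C" "\<And>i. i \<in> I \<Longrightarrow> arr C x x (X i)"
  shows "tr C w x (\<Sum>i\<in>I. X i) = (\<Sum>i\<in>I. tr C w x (X i))"
  using assms(2)
proof (induction I rule: infinite_finite_induct)
  case (insert i I)
  then show ?case
    using assms(1) by (simp add: tr_add arr_sum)
qed (auto simp: tr_zero[OF assms(1)])

lemma tr_star: assumes X: "arr C x x X"
  shows "tr C w x (star C X) = cnj (tr C w x X)"
proof -
  note D = decomp_dec[OF arrD(1)[OF X]]
  show ?thesis unfolding tr_def trD_def cnj_sum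
  proof (rule sum.cong[OF refl])
    fix p assume p: "p \<in> dec C x"
    note pA = decompD(3)[OF D p]
    note psA = arr_star[OF pA]
    have "star C (star C (snd p) \<cdot> (X \<cdot> snd p)) = star C (snd p) \<cdot> (star C X \<cdot> snd p)"
      using starcmp[OF arr_cmp[OF pA X] psA] starcmp[OF pA X] starstar[OF pA]
        assoc[OF pA arr_star[OF X] psA] by simp
    then show "of_real (w (fst p)) * coord C (fst p) (star C (snd p) \<cdot> (star C X \<cdot> snd p)) =
       cnj (of_real (w (fst p)) * coord C (fst p) (star C (snd p) \<cdot> (X \<cdot> snd p)))"
      using coord_star[OF decompD(2)[OF D p] arr_corner[OF D p X]] by simp
  qed
qed

lemma tr_split:
  assumes id: "(\<Sum>i\<in>I. f i \<cdot> star C (f i)) = idn C x" and f: "\<And>i. i \<in> I \<Longrightarrow> arr C (y i) x (f i)"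
    and X: "arr C x x X"
  shows "tr C w x X = (\<Sum>i\<in>I. tr C w (y i) (star C (f i) \<cdot> (X \<cdot> f i)))"
proof -
  have "tr C w x X = tr C w x (\<Sum>i\<in>I. (X \<cdot> f i) \<cdot> star C (f i))"
    using expand_right[OF id f X] by simp
  also have "\<dots> = (\<Sum>i\<in>I. tr C w x ((X \<cdot> f i) \<cdot> star C (f i)))"
    using arrD[OF X] by (intro tr_sum) (auto intro!: arr_cmp[OF _ arr_cmp] arr_star f X)
  also have "\<dots> = (\<Sum>i\<in>I. tr C w (y i) (star C (f i) \<cdot> (X \<cdot> f i)))"
    by (rule sum.cong[OF refl], rule tr_comm) (auto intro!: arr_star f arr_cmp[OF f X])
  finally show ?thesis .
qed

lemma tr_rep: assumes u: "u \<in> reps C" and X: "arr C u u X"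
  shows "tr C w u X = of_real (w u) * coord C u X"
proof -
  note I = arr_idn[OF reps_obj[OF u]]
  have "decomp C u {(u, idn C u)}"
    using u I staridn[OF reps_obj[OF u]] idl[OF I] by (simp add: decomp_def)
  then show ?thesis
    using tr_eq[OF _ X, of "{(u, idn C u)}" w] idl[OF X] idr[OF X] staridn[OF reps_obj[OF u]]
    by (simp add: trD_def)
qed

lemma coord_star_cmp:
  assumes u: "u \<in> reps C" and v: "v \<in> reps C" and s: "arr C u v s"
  shows "coord C u (star C s \<cdot> s) = (if u = v then complex_of_real ((cmod (coord C u s))\<^sup>2) else 0)"
proof (cases "u = v")
  case True
  then have s': "arr C u u s" using s by simp
  show ?thesis using True unfolding coord_cmp[OF u arr_star[OF s'] s'] coord_star[OF u s']
    using complex_norm_square[of "coord C v s"] by (simp add: mult.commute)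
next
  case False
  then show ?thesis
    using schur[OF u v s] zeror[OF reps_obj[OF u] arr_star[OF s]] coord_zero[OF u] by simp
qed

text \<open>The trace is a weighted sum of squared moduli of matrix coefficients between equal
  simple summands. Positivity, faithfulness and the later passage to coordinates are all read off
  from this formula.\<close>

lemma tr_star_cmp:
  assumes f: "arr C x y f"
  shows "tr C w x (star C f \<cdot> f) = complex_of_real (\<Sum>p\<in>dec C x. \<Sum>q\<in>dec C y.
    if fst p = fst q then w (fst p) * (cmod (coord C (fst p) (star C (snd q) \<cdot> (f \<cdot> snd p))))\<^sup>2 else 0)"
  unfolding tr_def trD_double[OF decomp_dec[OF arrD(1)[OF f]] decomp_dec[OF arrD(2)[OF f]] f arr_star[OF f]]
    of_real_sum
proof (intro sum.cong refl)
  fix p q assume p: "p \<in> dec C x" and q: "q \<in> dec C y"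
  note D = decomp_dec[OF arrD(1)[OF f]] and E = decomp_dec[OF arrD(2)[OF f]]
  note pA = decompD(3)[OF D p] and qA = decompD(3)[OF E q]
  note fp = arr_cmp[OF pA f]
  note m = arr_cmp[OF fp arr_star[OF qA]]
  have "star C (star C (snd q) \<cdot> (f \<cdot> snd p)) = star C (snd p) \<cdot> (star C f \<cdot> snd q)"
    using starcmp[OF fp arr_star[OF qA]] starcmp[OF pA f] starstar[OF qA]
      assoc[OF qA arr_star[OF f] arr_star[OF pA]] by simp
  then show "of_real (w (fst p)) * coord C (fst p)
      ((star C (snd p) \<cdot> (star C f \<cdot> snd q)) \<cdot> (star C (snd q) \<cdot> (f \<cdot> snd p))) =
    of_real (if fst p = fst q then w (fst p) * (cmod (coord C (fst p) (star C (snd q) \<cdot> (f \<cdot> snd p))))\<^sup>2 else 0)"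
    using coord_star_cmp[OF decompD(2)[OF D p] decompD(2)[OF E q] m] by auto
qed

lemma qn_coords:
  assumes f: "arr C x y f"
  shows "qn C w x f = (\<Sum>p\<in>dec C x. \<Sum>q\<in>dec C y.
    if fst p = fst q then w (fst p) * (cmod (coord C (fst p) (star C (snd q) \<cdot> (f \<cdot> snd p))))\<^sup>2 else 0)"
  unfolding qn_def tr_star_cmp[OF f] by simp

lemma qn_nonneg:
  assumes f: "arr C x y f" and w: "weight_function C w"
  shows "0 \<le> qn C w x f"
proof -
  have "0 \<le> w (fst p)" if "p \<in> dec C x" for p
    using decompD(2)[OF decomp_dec[OF arrD(1)[OF f]] that] w by (auto simp: weight_function_def less_imp_le)
  then show ?thesis unfolding qn_coords[OF f] by (intro sum_nonneg) auto
qed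

text \<open>Positive weights force every coefficient between equal summands to vanish, Schur's lemma
  removes the others, and \<open>f\<close> is rebuilt from its coefficients.\<close>

lemma qn_eq_0:
  assumes f: "arr C x y f" and w: "weight_function C w" and 0: "qn C w x f = 0"
  shows "f = 0"
proof -
  note D = decomp_dec[OF arrD(1)[OF f]] and E = decomp_dec[OF arrD(2)[OF f]]
  have wp: "0 < w (fst p)" if "p \<in> dec C x" for p
    using decompD(2)[OF D that] w by (auto simp: weight_function_def)
  define t where "t = (\<lambda>p q. if fst p = fst q then w (fst p) *
    (cmod (coord C (fst p) (star C (snd q) \<cdot> (f \<cdot> snd p))))\<^sup>2 else 0)"
  have tn: "0 \<le> t p q" if "p \<in> dec C x" for p q
    using wp[OF that] by (auto simp: t_def)
  have "(\<Sum>p\<in>dec C x. \<Sum>q\<in>dec C y. t p q) = 0"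
    using 0 unfolding qn_coords[OF f] t_def .
  then have t0: "t p q = 0" if "p \<in> dec C x" "q \<in> dec C y" for p q
    using that tn decompD(1)[OF D] decompD(1)[OF E]
    by (subst (asm) sum_nonneg_eq_0_iff) (auto simp: sum_nonneg sum_nonneg_eq_0_iff)
  have fp0: "f \<cdot> snd p = 0" if p: "p \<in> dec C x" for p
  proof -
    note pA = decompD(3)[OF D p]
    note fp = arr_cmp[OF pA f]
    have "snd q \<cdot> (star C (snd q) \<cdot> (f \<cdot> snd p)) = 0" if q: "q \<in> dec C y" for q
    proof -
      note qA = decompD(3)[OF E q]
      note m = arr_cmp[OF fp arr_star[OF qA]]
      have "star C (snd q) \<cdot> (f \<cdot> snd p) = 0"
      proof (cases "fst p = fst q")
        case True
        then have "coord C (fst p) (star C (snd q) \<cdot> (f \<cdot> snd p)) = 0"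
          using t0[OF p q] wp[OF p] by (simp add: t_def)
        then show ?thesis using coord_eq[OF decompD(2)[OF D p], of "star C (snd q) \<cdot> (f \<cdot> snd p)"] m True
          by simp
      next
        case False
        then show ?thesis using schur[OF decompD(2)[OF D p] decompD(2)[OF E q] m] by simp
      qed
      then show ?thesis using zeror[OF arrD(1)[OF pA] qA] by simp
    qed
    then show ?thesis using expand_left[OF E fp] by simp
  qed
  have "(f \<cdot> snd p) \<cdot> star C (snd p) = 0" if "p \<in> dec C x" for p
    using fp0[OF that] zerol[OF arrD(2)[OF f] arr_star[OF decompD(3)[OF D that]]] by simp
  then show ?thesis
    using expand_right[OF decompD(5)[OF D] decompD(3)[OF D] f] by simp
qed

text \<open>The isometries of \<open>D\<close> starting at \<open>v\<close> form a basis: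
  orthogonality gives independence, and in the expansion of a morphism from \<open>v\<close> Schur's
  lemma leaves only these terms.\<close>

lemma dim_hom:
  assumes D: "decomp C x D" and x: "x \<in> obj C" and v: "v \<in> reps C"
  shows "complex_vector.dim (hom C v x) = card {p\<in>D. fst p = v}"
proof -
  define E where "E = {p\<in>D. fst p = v}"
  have fin: "finite E" using decompD(1)[OF D] by (simp add: E_def)
  have E: "p \<in> D" "fst p = v" "arr C v x (snd p)" "star C (snd p) \<cdot> snd p = idn C v" if "p \<in> E" for p
    using that decompD(3,4)[OF D, of p] by (auto simp: E_def)
  have id0: "idn C v \<noteq> 0" using reps_simple[OF v] by (simp add: simple_obj_def)
  have vo: "v \<in> obj C" using reps_obj[OF v] .
  have inj: "inj_on snd E"
  proof (rule inj_onI, rule ccontr)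
    \<comment> \<open>Two pairs sharing their morphism would make \<open>idn C v\<close> both a norm
      square and an orthogonality product, hence zero.\<close>
    fix p q assume "p \<in> E" "q \<in> E" "snd p = snd q" "p \<noteq> q"
    then show False using decompD(6)[OF D, of p q] E[of q] E[of p] id0 by simp
  qed
  show ?thesis unfolding E_def[symmetric]
  proof (rule complex_vector.dim_unique[of "snd ` E"])
    show "snd ` E \<subseteq> hom C v x" using E(3) by (auto simp: arr_def)
    show "card (snd ` E) = card E" using inj by (rule card_image)
    show "complex_vector.independent (snd ` E)"
    proof
      assume dep: "complex_vector.dependent (snd ` E)"
      from dep obtain c p where c: "(\<Sum>f\<in>snd ` E. c f *\<^sub>C f) = 0" "p \<in> E" "c (snd p) \<noteq> 0"
        unfolding complex_vector.dependent_finite[OF finite_imageI[OF fin]] by blast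
      note ps = arr_star[OF E(3)[OF c(2)]]
      have "star C (snd p) \<cdot> (\<Sum>q\<in>E. c (snd q) *\<^sub>C snd q) = 0"
        using c(1) zeror[OF vo ps] by (simp add: sum.reindex[OF inj])
      moreover have "star C (snd p) \<cdot> (\<Sum>q\<in>E. c (snd q) *\<^sub>C snd q) =
          (\<Sum>q\<in>E. star C (snd p) \<cdot> (c (snd q) *\<^sub>C snd q))"
        by (rule sumr[OF vo ps]) (use E(3) arr_scale in blast)
      moreover have "\<dots> = (\<Sum>q\<in>E. if q = p then c (snd p) *\<^sub>C idn C v else 0)"
        using E(1,4) c(2) decompD(6)[OF D]
        by (intro sum.cong refl) (auto simp: scaler[OF E(3) ps])
      ultimately show False using c fin id0 by simp
    qed
    show "hom C v x \<subseteq> complex_vector.span (snd ` E)"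
    proof
      fix f assume f: "f \<in> hom C v x"
      show "f \<in> complex_vector.span (snd ` E)"
      proof -
        have fA: "arr C v x f" using f x vo by (simp add: arr_def)
        have "snd p \<cdot> (star C (snd p) \<cdot> f) \<in> complex_vector.span (snd ` E)" if p: "p \<in> D" for p
        proof -
          note pA = decompD(3)[OF D p]
          note m = arr_cmp[OF fA arr_star[OF pA]]
          show ?thesis
          proof (cases "fst p = v")
            case True
            then have "star C (snd p) \<cdot> f = coord C v (star C (snd p) \<cdot> f) *\<^sub>C idn C v"
              using m by (intro coord_eq[OF v]) simp
            then have "snd p \<cdot> (star C (snd p) \<cdot> f) = coord C v (star C (snd p) \<cdot> f) *\<^sub>C snd p"
              using scaler[OF arr_idn[OF vo], of x "snd p"] idr[of v x "snd p"] pA True by metis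
            moreover have "snd p \<in> complex_vector.span (snd ` E)"
              using p True by (intro complex_vector.span_base) (simp add: E_def)
            ultimately show ?thesis by (simp add: complex_vector.span_scale)
          next
            case False
            then have "star C (snd p) \<cdot> f = 0" using schur[OF v decompD(2)[OF D p] m] by simp
            then show ?thesis using zeror[OF vo pA] complex_vector.span_zero by simp
          qed
        qed
        then have "(\<Sum>p\<in>D. snd p \<cdot> (star C (snd p) \<cdot> f)) \<in> complex_vector.span (snd ` E)"
          by (rule complex_vector.span_sum)
        then show ?thesis using expand_left[OF D fA] by simp
      qed
    qed
  qed
qed

text \<open>Rewrites a sum over simple summands with the multiplicities that appear in
  \<open>adjacency\<close>.\<close>

lemma sum_decomp:
  assumes D: "decomp C x D" and x: "x \<in> obj C"
  shows "(\<Sum>p\<in>D. g (fst p)) = (\<Sum>v\<in>reps C. real (complex_vector.dim (hom C v x)) * g v)"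
proof -
  have "(\<Sum>p\<in>D. g (fst p)) = (\<Sum>v\<in>reps C. \<Sum>p\<in>{p\<in>D. fst p = v}. g (fst p))"
    using decompD(2)[OF D]
    by (intro sum.group[OF decompD(1)[OF D] finite_reps, symmetric]) blast
  also have "\<dots> = (\<Sum>v\<in>reps C. \<Sum>p\<in>{p\<in>D. fst p = v}. g v)"
    by (intro sum.cong refl) auto
  finally show ?thesis using dim_hom[OF D x] by simp
qed

lemma nrm_idn: assumes "u \<in> reps C" shows "nrm C (idn C u) = 1"
proof -
  have u: "u \<in> obj C" using reps_obj[OF assms] .
  have "nrm C (idn C u) = (nrm C (idn C u))\<^sup>2"
    using cstar_identity[OF u u idn_hom[OF u]] staridn[OF u] idl[OF arr_idn[OF u]] by simp
  moreover have "nrm C (idn C u) \<noteq> 0"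
    using nrm_eq_0_iff[OF u u idn_hom[OF u]] reps_simple[OF assms] by (simp add: simple_obj_def)
  ultimately show ?thesis by (simp add: power2_eq_square)
qed

lemma cmod_coord: assumes u: "u \<in> reps C" and s: "arr C u u s" shows "cmod (coord C u s) = nrm C s"
proof -
  have "nrm C s = nrm C (coord C u s *\<^sub>C idn C u)" using coord_eq[OF assms] by simp
  also have "\<dots> = cmod (coord C u s) * nrm C (idn C u)"
    using reps_obj[OF u] by (intro nrm_scale) (auto intro: idn_hom)
  finally show ?thesis using nrm_idn[OF u] by simp
qed

end


section \<open>Functors and conditional expectations\<close>

lemma nat_trans_arr: "\<lbrakk>nat_trans M N F G \<eta>; x \<in> obj M; ob F x \<in> obj N; ob G x \<in> obj N\<rbrakk>
    \<Longrightarrow> arr N (ob F x) (ob G x) (\<eta> x)"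
  by (simp add: nat_trans_def arr_def)

lemma nat_trans_natural: "\<lbrakk>nat_trans M N F G \<eta>; arr M x y f\<rbrakk>
    \<Longrightarrow> ar G f \<cdot>\<^bsub>N\<^esub> \<eta> x = \<eta> y \<cdot>\<^bsub>N\<^esub> ar F f"
  by (simp add: nat_trans_def arr_def)

locale cstar_functor = C: finite_semisimple_cstar_category C + D: finite_semisimple_cstar_category D
  for C :: "('o, 'm::complex_vector) ccat" and D :: "('p, 'n::complex_vector) ccat" +
  fixes F :: "('o, 'm, 'p, 'n) cfunctor"
  assumes F: "star_functor C D F"
begin

lemma F_obj: "x \<in> obj C \<Longrightarrow> ob F x \<in> obj D"
  using F by (simp add: star_functor_def)

lemma F_idn: "x \<in> obj C \<Longrightarrow> ar F (idn C x) = idn D (ob F x)"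
  using F by (simp add: star_functor_def)

lemma F_arr: "arr C x y f \<Longrightarrow> arr D (ob F x) (ob F y) (ar F f)"
  using F unfolding star_functor_def arr_def by blast

lemma F_star: "arr C x y f \<Longrightarrow> ar F (star C f) = star D (ar F f)"
  using F unfolding star_functor_def arr_def by blast

lemma F_scale: "arr C x y f \<Longrightarrow> ar F (c *\<^sub>C f) = c *\<^sub>C ar F f"
  using F unfolding star_functor_def arr_def by blast

lemma F_add: "\<lbrakk>arr C x y f; arr C x y g\<rbrakk> \<Longrightarrow> ar F (f + g) = ar F f + ar F g"
  using F unfolding star_functor_def arr_def by blast

lemma F_cmp: "\<lbrakk>arr C x y f; arr C y z g\<rbrakk> \<Longrightarrow> ar F (g \<cdot>\<^bsub>C\<^esub> f) = ar F g \<cdot>\<^bsub>D\<^esub> ar F f"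
  using F unfolding star_functor_def arr_def by blast

lemma F_zero: "\<lbrakk>x \<in> obj C; y \<in> obj C\<rbrakk> \<Longrightarrow> ar F 0 = 0"
  using F_scale[OF C.arr_zero, of x y 0] by simp

lemma F_sum:
  assumes "x \<in> obj C" "y \<in> obj C" "\<And>i. i \<in> I \<Longrightarrow> arr C x y (f i)"
  shows "ar F (\<Sum>i\<in>I. f i) = (\<Sum>i\<in>I. ar F (f i))"
  using assms(3)
proof (induction I rule: infinite_finite_induct)
  case (insert i I)
  then have "ar F (f i + sum f I) = ar F (f i) + ar F (sum f I)"
    using assms(1,2) by (intro F_add[of x y] C.arr_sum) auto
  then show ?case using insert by simp
qed (simp_all add: F_zero[OF assms(1,2)])

lemma F_resolution:
  assumes id: "(\<Sum>i\<in>I. f i \<cdot>\<^bsub>C\<^esub> star C (f i)) = idn C x" and f: "\<And>i. i \<in> I \<Longrightarrow> arr C (y i) x (f i)"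
    and x: "x \<in> obj C"
  shows "(\<Sum>i\<in>I. ar F (f i) \<cdot>\<^bsub>D\<^esub> star D (ar F (f i))) = idn D (ob F x)"
proof -
  have "idn D (ob F x) = ar F (\<Sum>i\<in>I. f i \<cdot>\<^bsub>C\<^esub> star C (f i))" using F_idn[OF x] id by simp
  also have "\<dots> = (\<Sum>i\<in>I. ar F (f i \<cdot>\<^bsub>C\<^esub> star C (f i)))"
    by (rule F_sum[OF x x]) (use f C.arr_star C.arr_cmp in blast)
  also have "\<dots> = (\<Sum>i\<in>I. ar F (f i) \<cdot>\<^bsub>D\<^esub> star D (ar F (f i)))"
  proof (rule sum.cong[OF refl])
    fix i assume "i \<in> I"
    from f[OF this] show "ar F (f i \<cdot>\<^bsub>C\<^esub> star C (f i)) = ar F (f i) \<cdot>\<^bsub>D\<^esub> star D (ar F (f i))"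
      using F_cmp[OF C.arr_star] F_star by metis
  qed
  finally show ?thesis by simp
qed

lemma F_dec_split:
  assumes X: "arr D (ob F x) (ob F x) X" and x: "x \<in> obj C"
  shows "tr D w (ob F x) X = (\<Sum>p\<in>dec C x. tr D w (ob F (fst p))
    (star D (ar F (snd p)) \<cdot>\<^bsub>D\<^esub> (X \<cdot>\<^bsub>D\<^esub> ar F (snd p))))"
proof (rule D.tr_split[OF _ _ X])
  note d = C.decomp_dec[OF x]
  show "(\<Sum>p\<in>dec C x. ar F (snd p) \<cdot>\<^bsub>D\<^esub> star D (ar F (snd p))) = idn D (ob F x)"
    by (rule F_resolution[OF C.decompD(5)[OF d] C.decompD(3)[OF d] x])
  show "arr D (ob F (fst p)) (ob F x) (ar F (snd p))" if "p \<in> dec C x" for p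
    by (rule F_arr[OF C.decompD(3)[OF d that]])
qed

lemma tr_idn:
  assumes x: "x \<in> obj D"
  shows "tr D w x (idn D x) = of_real (\<Sum>v\<in>reps D. real (complex_vector.dim (hom D v x)) * w v)"
proof -
  note d = D.decomp_dec[OF x]
  have "tr D w x (idn D x) = (\<Sum>p\<in>dec D x. complex_of_real (w (fst p)))"
    unfolding tr_def trD_def
  proof (rule sum.cong[OF refl])
    fix p assume p: "p \<in> dec D x"
    show "of_real (w (fst p)) * coord D (fst p) (star D (snd p) \<cdot>\<^bsub>D\<^esub> (idn D x \<cdot>\<^bsub>D\<^esub> snd p)) = complex_of_real (w (fst p))"
      using D.idl[OF D.decompD(3)[OF d p]] D.decompD(4)[OF d p] D.coord_idn[OF D.decompD(2)[OF d p]] by simp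
  qed
  then show ?thesis using D.sum_decomp[OF d x, of w] by (simp flip: of_real_sum)
qed

text \<open>The trace of the identity on the image of a simple \<open>u\<close> is the entry at
  \<open>u\<close> of the transposed adjacency matrix applied to \<open>w'\<close>. The hypothesis
  equates it with \<open>w u\<close>, and cutting by a decomposition of \<open>x\<close> reduces
  everything to this case.\<close>

lemma tr_functor:
  assumes w: "\<And>u. u \<in> reps C \<Longrightarrow> (\<Sum>v\<in>reps D. adjacency D F v u * w' v) = w u"
    and X: "arr C x x X"
  shows "tr D w' (ob F x) (ar F X) = tr C w x X"
proof -
  have x: "x \<in> obj C" using X by (rule arrD)
  note d = C.decomp_dec[OF x]
  show ?thesis
    unfolding F_dec_split[OF F_arr[OF X] x]
    unfolding tr_def[of C] trD_def
  proof (rule sum.cong[OF refl])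
    fix p assume p: "p \<in> dec C x"
    note pA = C.decompD(3)[OF d p] and pr = C.decompD(2)[OF d p]
    define c where "c = coord C (fst p) (star C (snd p) \<cdot>\<^bsub>C\<^esub> (X \<cdot>\<^bsub>C\<^esub> snd p))"
    have u: "fst p \<in> obj C" using pA by (rule arrD)
    have "star D (ar F (snd p)) \<cdot>\<^bsub>D\<^esub> (ar F X \<cdot>\<^bsub>D\<^esub> ar F (snd p)) = ar F (star C (snd p) \<cdot>\<^bsub>C\<^esub> (X \<cdot>\<^bsub>C\<^esub> snd p))"
      using F_cmp[OF C.arr_cmp[OF pA X] C.arr_star[OF pA]] F_cmp[OF pA X] F_star[OF pA] by simp
    also have "star C (snd p) \<cdot>\<^bsub>C\<^esub> (X \<cdot>\<^bsub>C\<^esub> snd p) = c *\<^sub>C idn C (fst p)"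
      unfolding c_def by (rule C.coord_eq[OF pr C.arr_corner[OF d p X]])
    also have "ar F (c *\<^sub>C idn C (fst p)) = c *\<^sub>C idn D (ob F (fst p))"
      using F_scale[OF C.arr_idn[OF u]] F_idn[OF u] by simp
    also have "tr D w' (ob F (fst p)) \<dots> = c * of_real (w (fst p))"
      unfolding D.tr_scale[OF D.arr_idn[OF F_obj[OF u]]] tr_idn[OF F_obj[OF u]]
      using w[OF pr] by (simp add: adjacency_def)
    finally show "tr D w' (ob F (fst p)) (star D (ar F (snd p)) \<cdot>\<^bsub>D\<^esub> (ar F X \<cdot>\<^bsub>D\<^esub> ar F (snd p)))
      = of_real (w (fst p)) * coord C (fst p) (star C (snd p) \<cdot>\<^bsub>C\<^esub> (X \<cdot>\<^bsub>C\<^esub> snd p))"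
      by (simp add: c_def mult.commute)
  qed
qed

text \<open>Naturality at an isometry \<open>f\<close> from \<open>u\<close> to \<open>x\<close>
  turns the compression of \<open>star D (\<eta> x) \<cdot> \<eta> x\<close> by
  \<open>ar F f\<close> into the same expression at \<open>u\<close>. Thus the values at the
  representatives determine those at all objects.\<close>

lemma qn_nat_trans:
  assumes G: "star_functor C D G" and \<eta>: "nat_trans C D F G \<eta>" and x: "x \<in> obj C"
  shows "qn D w (ob F x) (\<eta> x) =
    (\<Sum>u\<in>reps C. real (complex_vector.dim (hom C u x)) * qn D w (ob F u) (\<eta> u))"
proof -
  interpret G: cstar_functor C D G by unfold_locales (rule G)
  have \<eta>A: "arr D (ob F y) (ob G y) (\<eta> y)" if "y \<in> obj C" for y
    using nat_trans_arr[OF \<eta> that F_obj G.F_obj] that by blast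
  note d = C.decomp_dec[OF x]
  have "tr D w (ob F x) (star D (\<eta> x) \<cdot>\<^bsub>D\<^esub> \<eta> x) =
    (\<Sum>p\<in>dec C x. tr D w (ob F (fst p)) (star D (\<eta> (fst p)) \<cdot>\<^bsub>D\<^esub> \<eta> (fst p)))"
    unfolding F_dec_split[OF D.arr_cmp[OF \<eta>A[OF x] D.arr_star[OF \<eta>A[OF x]]] x]
  proof (rule sum.cong[OF refl])
    fix p assume p: "p \<in> dec C x"
    define u f where uf: "u = fst p" "f = snd p"
    have f: "arr C u x f" "star C f \<cdot>\<^bsub>C\<^esub> f = idn C u" using C.decompD(3,4)[OF d p] by (simp_all add: uf)
    have u: "u \<in> obj C" using f(1) by (rule arrD)
    note Ff = F_arr[OF f(1)] and Gf = G.F_arr[OF f(1)]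
    note ex = \<eta>A[OF x] and eu = \<eta>A[OF u]
    note fe = D.arr_cmp[OF Ff ex]
    have nat: "\<eta> x \<cdot>\<^bsub>D\<^esub> ar F f = ar G f \<cdot>\<^bsub>D\<^esub> \<eta> u" using nat_trans_natural[OF \<eta> f(1)] by simp
    have "star D (ar F f) \<cdot>\<^bsub>D\<^esub> ((star D (\<eta> x) \<cdot>\<^bsub>D\<^esub> \<eta> x) \<cdot>\<^bsub>D\<^esub> ar F f)
      = (star D (ar F f) \<cdot>\<^bsub>D\<^esub> star D (\<eta> x)) \<cdot>\<^bsub>D\<^esub> (\<eta> x \<cdot>\<^bsub>D\<^esub> ar F f)"
      using D.assoc[OF Ff ex D.arr_star[OF ex]] D.assoc[OF fe D.arr_star[OF ex] D.arr_star[OF Ff]] by simp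
    also have "star D (ar F f) \<cdot>\<^bsub>D\<^esub> star D (\<eta> x) = star D (\<eta> u) \<cdot>\<^bsub>D\<^esub> star D (ar G f)"
      using D.starcmp[OF Ff ex] D.starcmp[OF eu Gf] nat by simp
    also have "\<dots> \<cdot>\<^bsub>D\<^esub> (\<eta> x \<cdot>\<^bsub>D\<^esub> ar F f) = star D (\<eta> u) \<cdot>\<^bsub>D\<^esub> ((star D (ar G f) \<cdot>\<^bsub>D\<^esub> ar G f) \<cdot>\<^bsub>D\<^esub> \<eta> u)"
      unfolding nat D.assoc[OF D.arr_cmp[OF eu Gf] D.arr_star[OF Gf] D.arr_star[OF eu]]
        D.assoc[OF eu Gf D.arr_star[OF Gf]] ..
    also have "star D (ar G f) \<cdot>\<^bsub>D\<^esub> ar G f = idn D (ob G u)"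
      using G.F_cmp[OF f(1) C.arr_star[OF f(1)]] G.F_star[OF f(1)] f(2) G.F_idn[OF u] by simp
    finally show "tr D w (ob F (fst p)) (star D (ar F (snd p)) \<cdot>\<^bsub>D\<^esub> ((star D (\<eta> x) \<cdot>\<^bsub>D\<^esub> \<eta> x) \<cdot>\<^bsub>D\<^esub> ar F (snd p)))
      = tr D w (ob F (fst p)) (star D (\<eta> (fst p)) \<cdot>\<^bsub>D\<^esub> \<eta> (fst p))"
      using D.idl[OF eu] by (simp add: uf)
  qed
  then have "qn D w (ob F x) (\<eta> x) = (\<Sum>p\<in>dec C x. qn D w (ob F (fst p)) (\<eta> (fst p)))"
    unfolding qn_def by simp
  then show ?thesis using C.sum_decomp[OF d x, of "\<lambda>u. qn D w (ob F u) (\<eta> u)"] by simp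
qed

end

lemma (in finite_semisimple_cstar_category) qn_unitary:
  assumes f: "arr C x y f" and V: "arr C x' x V" "V \<cdot> star C V = idn C x"
    and W: "arr C y' y W" "W \<cdot> star C W = idn C y"
  shows "qn C w x' (star C W \<cdot> f \<cdot> V) = qn C w x f"
proof -
  note Ws = arr_star[OF W(1)] and fs = arr_star[OF f] and Vs = arr_star[OF V(1)]
  note fV = arr_cmp[OF V(1) f] and Wf = arr_cmp[OF f Ws]
  have s: "star C (star C W \<cdot> (f \<cdot> V)) = star C (f \<cdot> V) \<cdot> W"
    using starcmp[OF fV Ws] starstar[OF W(1)] by simp
  have "star C (star C W \<cdot> (f \<cdot> V)) \<cdot> (star C W \<cdot> (f \<cdot> V)) =
      star C (f \<cdot> V) \<cdot> (W \<cdot> (star C W \<cdot> (f \<cdot> V)))"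
    unfolding s by (rule assoc[OF arr_cmp[OF fV Ws] W(1) arr_star[OF fV]])
  also have "W \<cdot> (star C W \<cdot> (f \<cdot> V)) = f \<cdot> V"
    using assoc[OF fV Ws W(1)] W(2) idl[OF fV] by simp
  finally have "tr C w x' (star C (star C W \<cdot> (f \<cdot> V)) \<cdot> (star C W \<cdot> (f \<cdot> V)))
    = tr C w x' (star C (f \<cdot> V) \<cdot> (f \<cdot> V))" by simp
  also have "star C (f \<cdot> V) \<cdot> (f \<cdot> V) = star C V \<cdot> ((star C f \<cdot> f) \<cdot> V)"
    unfolding starcmp[OF V(1) f] assoc[OF fV fs Vs] assoc[OF V(1) f fs] ..
  also have "tr C w x' \<dots> = tr C w x (((star C f \<cdot> f) \<cdot> V) \<cdot> star C V)"
    by (rule tr_comm[OF arr_cmp[OF V(1) arr_cmp[OF f fs]] Vs])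
  also have "((star C f \<cdot> f) \<cdot> V) \<cdot> star C V = star C f \<cdot> f"
    using assoc[OF Vs V(1) arr_cmp[OF f fs]] V(2) idr[OF arr_cmp[OF f fs]] by simp
  finally show ?thesis
    unfolding qn_def assoc[OF V(1) f Ws] by simp
qed

section \<open>The adjoint of a functor with respect to the traces\<close>

locale tracial_functor = cstar_functor C D F
  for C :: "('o, 'm::complex_vector) ccat" and D :: "('p, 'n::complex_vector) ccat" and F +
  fixes F' :: "('p, 'n, 'o, 'm) cfunctor" and w :: "'o \<Rightarrow> real" and w' :: "'p \<Rightarrow> real"
    and \<rho> :: "'p \<Rightarrow> 'n" and \<rho>' :: "'o \<Rightarrow> 'm"
  assumes tracial: "tracial_solution C D w w' F F' \<rho> \<rho>'"
    and w: "weight_function C w"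
begin

sublocale A: cstar_functor D C F'
  using tracial by unfold_locales (simp add: tracial_solution_def conjugate_solution_def)

text \<open>Plays the role of the conditional expectation onto the image of \<open>F\<close>. The
  loop operator is this map applied to a transformation conjugated by the unitaries
  \<open>W\<close>.\<close>

definition cexp :: "'o \<Rightarrow> 'o \<Rightarrow> 'n \<Rightarrow> 'm" where
  "cexp a b Z = star C (\<rho>' b) \<cdot>\<^bsub>C\<^esub> ar F' Z \<cdot>\<^bsub>C\<^esub> \<rho>' a"

lemma rho_arr: assumes "x \<in> obj C" shows "arr C x (ob F' (ob F x)) (\<rho>' x)"
  using tracial assms A.F_obj[OF F_obj[OF assms]]
  by (simp add: tracial_solution_def conjugate_solution_def nat_trans_def id_functor_def comp_functor_def arr_def)

lemma rho_natural: "arr C x y f \<Longrightarrow> ar F' (ar F f) \<cdot>\<^bsub>C\<^esub> \<rho>' x = \<rho>' y \<cdot>\<^bsub>C\<^esub> f"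
  using tracial
  by (simp add: tracial_solution_def conjugate_solution_def nat_trans_def id_functor_def comp_functor_def arr_def)

context
  fixes a b Z assumes a: "a \<in> obj C" and b: "b \<in> obj C" and Z: "arr D (ob F a) (ob F b) Z"
begin

lemma cexp_arr: "arr C a b (cexp a b Z)"
  unfolding cexp_def
  by (rule C.arr_cmp[OF rho_arr[OF a] C.arr_cmp[OF A.F_arr[OF Z] C.arr_star[OF rho_arr[OF b]]]])

text \<open>One half of the bimodule property of a conditional expectation, a consequence of the
  naturality of \<open>\<rho>'\<close>.\<close>

lemma cexp_left: assumes g: "arr C b c g" shows "g \<cdot>\<^bsub>C\<^esub> cexp a b Z = cexp a c (ar F g \<cdot>\<^bsub>D\<^esub> Z)"
proof -
  have c: "c \<in> obj C" using g by (rule arrD)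
  note ra = rho_arr[OF a] and rb = C.arr_star[OF rho_arr[OF b]] and rc = C.arr_star[OF rho_arr[OF c]]
  note FZ = A.F_arr[OF Z] and gs = C.arr_star[OF g] and FFg = A.F_arr[OF F_arr[OF g]]
  \<comment> \<open>Naturality is available for \<open>\<rho>'\<close> and wanted for its star,
    hence it is used at \<open>star C g\<close> and then starred.\<close>
  have "star C (ar F' (ar F (star C g)) \<cdot>\<^bsub>C\<^esub> \<rho>' c) = star C (\<rho>' b \<cdot>\<^bsub>C\<^esub> star C g)"
    using rho_natural[OF gs] by simp
  then have nat: "star C (\<rho>' c) \<cdot>\<^bsub>C\<^esub> ar F' (ar F g) = g \<cdot>\<^bsub>C\<^esub> star C (\<rho>' b)"
    using C.starcmp[OF rho_arr[OF c] A.F_arr[OF F_arr[OF gs]]] C.starcmp[OF gs rho_arr[OF b]]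
      F_star[OF g] A.F_star[OF F_arr[OF g]] C.starstar[OF g] C.starstar[OF FFg] by simp
  have "g \<cdot>\<^bsub>C\<^esub> cexp a b Z = (g \<cdot>\<^bsub>C\<^esub> (star C (\<rho>' b) \<cdot>\<^bsub>C\<^esub> ar F' Z)) \<cdot>\<^bsub>C\<^esub> \<rho>' a"
    unfolding cexp_def C.assoc[OF ra C.arr_cmp[OF FZ rb] g] ..
  also have "g \<cdot>\<^bsub>C\<^esub> (star C (\<rho>' b) \<cdot>\<^bsub>C\<^esub> ar F' Z) = (star C (\<rho>' c) \<cdot>\<^bsub>C\<^esub> ar F' (ar F g)) \<cdot>\<^bsub>C\<^esub> ar F' Z"
    unfolding nat C.assoc[OF FZ rb g] ..
  also have "\<dots> = star C (\<rho>' c) \<cdot>\<^bsub>C\<^esub> ar F' (ar F g \<cdot>\<^bsub>D\<^esub> Z)"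
    unfolding C.assoc[OF FZ FFg rc] A.F_cmp[OF Z F_arr[OF g]] ..
  finally show ?thesis by (simp add: cexp_def)
qed

lemma cexp_right: assumes h: "arr C c a h" shows "cexp a b Z \<cdot>\<^bsub>C\<^esub> h = cexp c b (Z \<cdot>\<^bsub>D\<^esub> ar F h)"
proof -
  have c: "c \<in> obj C" using h by (rule arrD)
  note ra = rho_arr[OF a] and rb = C.arr_star[OF rho_arr[OF b]] and rc = rho_arr[OF c]
  note FZ = A.F_arr[OF Z] and FFh = A.F_arr[OF F_arr[OF h]]
  have "cexp a b Z \<cdot>\<^bsub>C\<^esub> h = (star C (\<rho>' b) \<cdot>\<^bsub>C\<^esub> ar F' Z) \<cdot>\<^bsub>C\<^esub> (ar F' (ar F h) \<cdot>\<^bsub>C\<^esub> \<rho>' c)"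
    unfolding cexp_def C.assoc[OF h ra C.arr_cmp[OF FZ rb]] rho_natural[OF h] ..
  also have "\<dots> = ((star C (\<rho>' b) \<cdot>\<^bsub>C\<^esub> ar F' Z) \<cdot>\<^bsub>C\<^esub> ar F' (ar F h)) \<cdot>\<^bsub>C\<^esub> \<rho>' c"
    by (rule C.assoc[OF rc FFh C.arr_cmp[OF FZ rb], symmetric])
  also have "(star C (\<rho>' b) \<cdot>\<^bsub>C\<^esub> ar F' Z) \<cdot>\<^bsub>C\<^esub> ar F' (ar F h) = star C (\<rho>' b) \<cdot>\<^bsub>C\<^esub> ar F' (Z \<cdot>\<^bsub>D\<^esub> ar F h)"
    unfolding C.assoc[OF FFh FZ rb] A.F_cmp[OF F_arr[OF h] Z] ..
  finally show ?thesis by (simp add: cexp_def)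
qed

end

lemma cexp_sum:
  assumes a: "a \<in> obj C" and b: "b \<in> obj C" and Z: "\<And>i. i \<in> I \<Longrightarrow> arr D (ob F a) (ob F b) (Z i)"
  shows "cexp a b (\<Sum>i\<in>I. Z i) = (\<Sum>i\<in>I. cexp a b (Z i))"
proof -
  note ra = rho_arr[OF a] and rb = C.arr_star[OF rho_arr[OF b]]
  have FZ: "arr C (ob F' (ob F a)) (ob F' (ob F b)) (ar F' (Z i))" if "i \<in> I" for i
    using A.F_arr[OF Z[OF that]] .
  have "ar F' (\<Sum>i\<in>I. Z i) = (\<Sum>i\<in>I. ar F' (Z i))" by (rule A.F_sum[OF F_obj[OF a] F_obj[OF b] Z])
  moreover have "star C (\<rho>' b) \<cdot>\<^bsub>C\<^esub> (\<Sum>i\<in>I. ar F' (Z i)) = (\<Sum>i\<in>I. star C (\<rho>' b) \<cdot>\<^bsub>C\<^esub> ar F' (Z i))"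
    by (rule C.sumr[OF arrD(2)[OF ra] rb FZ])
  moreover have "(\<Sum>i\<in>I. star C (\<rho>' b) \<cdot>\<^bsub>C\<^esub> ar F' (Z i)) \<cdot>\<^bsub>C\<^esub> \<rho>' a
      = (\<Sum>i\<in>I. star C (\<rho>' b) \<cdot>\<^bsub>C\<^esub> ar F' (Z i) \<cdot>\<^bsub>C\<^esub> \<rho>' a)"
    by (rule C.suml[OF b ra C.arr_cmp[OF FZ rb]])
  ultimately show ?thesis by (simp add: cexp_def)
qed

text \<open>Inserting a decomposition writes \<open>Z\<close> as a sum of terms
  \<open>\<sigma> \<cdot> star D \<tau>\<close> with \<open>\<sigma> = Z \<cdot> \<tau>\<close>, the
  shape in which the tracial solution prescribes the value. The prescribed factor
  \<open>w' v / w u\<close> and the weight \<open>w u\<close> of the trace leave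
  \<open>w' v\<close>.\<close>

lemma tr_cexp_rep:
  assumes u: "u \<in> reps C" and Z: "arr D (ob F u) (ob F u) Z"
  shows "tr C w u (cexp u u Z) = tr D w' (ob F u) Z"
proof -
  have uo: "u \<in> obj C" using C.reps_obj[OF u] .
  have w0: "w u \<noteq> 0" using w u by (force simp: weight_function_def)
  note d = D.decomp_dec[OF F_obj[OF uo]]
  have q: "arr D (ob F u) (ob F u) ((Z \<cdot>\<^bsub>D\<^esub> snd q) \<cdot>\<^bsub>D\<^esub> star D (snd q))"
    if "q \<in> dec D (ob F u)" for q
    using D.arr_cmp[OF D.arr_star D.arr_cmp[OF _ Z]] D.decompD(3)[OF d that] by blast
  have "tr C w u (cexp u u Z) =
      tr C w u (cexp u u (\<Sum>q\<in>dec D (ob F u). (Z \<cdot>\<^bsub>D\<^esub> snd q) \<cdot>\<^bsub>D\<^esub> star D (snd q)))"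
    using D.expand_right[OF D.decompD(5)[OF d] D.decompD(3)[OF d] Z] by simp
  also have "\<dots> = (\<Sum>q\<in>dec D (ob F u). tr C w u (cexp u u ((Z \<cdot>\<^bsub>D\<^esub> snd q) \<cdot>\<^bsub>D\<^esub> star D (snd q))))"
    by (subst cexp_sum[OF uo uo q]) (auto intro: C.tr_sum[OF uo cexp_arr[OF uo uo q]])
  also have "\<dots> = tr D w' (ob F u) Z"
    unfolding tr_def[of D] trD_def
  proof (rule sum.cong[OF refl])
    fix q assume q: "q \<in> dec D (ob F u)"
    note qA = D.decompD(3)[OF d q] and qr = D.decompD(2)[OF d q]
    define e where "e = coord D (fst q) (star D (snd q) \<cdot>\<^bsub>D\<^esub> (Z \<cdot>\<^bsub>D\<^esub> snd q))"
    have "cexp u u ((Z \<cdot>\<^bsub>D\<^esub> snd q) \<cdot>\<^bsub>D\<^esub> star D (snd q)) =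
        (complex_of_real (w' (fst q) / w u) * hom_inner D (fst q) (Z \<cdot>\<^bsub>D\<^esub> snd q) (snd q)) *\<^sub>C idn C u"
      using tracial u qr qA D.arr_cmp[OF qA Z]
      unfolding tracial_solution_def cexp_def by (auto simp: arr_def)
    also have "hom_inner D (fst q) (Z \<cdot>\<^bsub>D\<^esub> snd q) (snd q) = e"
      by (simp add: hom_inner_def e_def coord_def)
    finally have "tr C w u (cexp u u ((Z \<cdot>\<^bsub>D\<^esub> snd q) \<cdot>\<^bsub>D\<^esub> star D (snd q))) =
        of_real (w u) * (complex_of_real (w' (fst q) / w u) * e)"
      using C.tr_rep[OF u C.arr_scale[OF C.arr_idn[OF uo]]] C.coord_scale[OF u] by simp
    then show "tr C w u (cexp u u ((Z \<cdot>\<^bsub>D\<^esub> snd q) \<cdot>\<^bsub>D\<^esub> star D (snd q))) =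
      of_real (w' (fst q)) * coord D (fst q) (star D (snd q) \<cdot>\<^bsub>D\<^esub> (Z \<cdot>\<^bsub>D\<^esub> snd q))"
      using w0 by (simp add: e_def)
  qed
  finally show ?thesis .
qed

text \<open>Both traces are cut along a decomposition of \<open>a\<close>; the bimodule property
  carries the cut through \<open>cexp\<close> to the representatives.\<close>

lemma tr_cexp:
  assumes a: "a \<in> obj C" and Z: "arr D (ob F a) (ob F a) Z"
  shows "tr C w a (cexp a a Z) = tr D w' (ob F a) Z"
proof -
  note d = C.decomp_dec[OF a]
  have "tr C w a (cexp a a Z) =
      (\<Sum>p\<in>dec C a. tr C w (fst p) (star C (snd p) \<cdot>\<^bsub>C\<^esub> (cexp a a Z \<cdot>\<^bsub>C\<^esub> snd p)))"
    by (rule C.tr_split[OF C.decompD(5)[OF d] C.decompD(3)[OF d] cexp_arr[OF a a Z]])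
  also have "\<dots> = (\<Sum>p\<in>dec C a. tr D w' (ob F (fst p)) (star D (ar F (snd p)) \<cdot>\<^bsub>D\<^esub> (Z \<cdot>\<^bsub>D\<^esub> ar F (snd p))))"
  proof (rule sum.cong[OF refl])
    fix p assume p: "p \<in> dec C a"
    note pA = C.decompD(3)[OF d p] and pr = C.decompD(2)[OF d p]
    note u = arrD(1)[OF pA]
    note m = D.arr_cmp[OF F_arr[OF pA] Z]
    have "star C (snd p) \<cdot>\<^bsub>C\<^esub> (cexp a a Z \<cdot>\<^bsub>C\<^esub> snd p) =
        cexp (fst p) (fst p) (star D (ar F (snd p)) \<cdot>\<^bsub>D\<^esub> (Z \<cdot>\<^bsub>D\<^esub> ar F (snd p)))"
      unfolding cexp_right[OF a a Z pA] cexp_left[OF u a m C.arr_star[OF pA]] F_star[OF pA] ..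
    then show "tr C w (fst p) (star C (snd p) \<cdot>\<^bsub>C\<^esub> (cexp a a Z \<cdot>\<^bsub>C\<^esub> snd p)) =
        tr D w' (ob F (fst p)) (star D (ar F (snd p)) \<cdot>\<^bsub>D\<^esub> (Z \<cdot>\<^bsub>D\<^esub> ar F (snd p)))"
      using tr_cexp_rep[OF pr D.arr_cmp[OF m D.arr_star[OF F_arr[OF pA]]]] by simp
  qed
  also have "\<dots> = tr D w' (ob F a) Z" by (rule F_dec_split[OF Z a, symmetric])
  finally show ?thesis .
qed

text \<open>The precise sense in which the loop operator is an adjoint: the bimodule property
  absorbs \<open>star C g\<close>, and \<open>cexp\<close> preserves traces.\<close>

lemma cexp_adjoint:
  assumes g: "arr C a b g" and Z: "arr D (ob F a) (ob F b) Z"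
  shows "tr C w a (star C g \<cdot>\<^bsub>C\<^esub> cexp a b Z) = tr D w' (ob F a) (star D (ar F g) \<cdot>\<^bsub>D\<^esub> Z)"
proof -
  note a = arrD(1)[OF g] and b = arrD(2)[OF g]
  have "star C g \<cdot>\<^bsub>C\<^esub> cexp a b Z = cexp a a (star D (ar F g) \<cdot>\<^bsub>D\<^esub> Z)"
    using cexp_left[OF a b Z C.arr_star[OF g]] F_star[OF g] by simp
  then show ?thesis
    using tr_cexp[OF a D.arr_cmp[OF Z D.arr_star[OF F_arr[OF g]]]] by simp
qed

end


section \<open>Natural transformations\<close>

text \<open>If \<open>a\<close> exceeded \<open>b > 0\<close>, the powers of \<open>a / b\<close>
  would outgrow any constant; equivalently, the constant disappears on taking roots of growing
  order.\<close>

lemma le_of_power_le: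
  fixes a b K :: real
  assumes "0 \<le> a" "0 \<le> b" and le: "\<And>n. a ^ (2 ^ n) \<le> K * b ^ (2 ^ n)"
  shows "a \<le> b"
proof (rule ccontr)
  assume "\<not> a \<le> b"
  then have ab: "b < a" by simp
  show False
  proof (cases "b = 0")
    case True
    then show ?thesis using le[of 0] ab by simp
  next
    case False
    then have b: "b > 0" using assms by simp
    have "1 < a / b" using ab b by simp
    then obtain n where n: "K < (a / b) ^ n" using real_arch_pow by blast
    have "(a / b) ^ n \<le> (a / b) ^ (2 ^ n)"
      using \<open>1 < a / b\<close> by (intro power_increasing) (auto simp: less_imp_le)
    also have "\<dots> \<le> K" using le[of n] b by (simp add: power_divide divide_le_eq)
    finally show False using n by simp
  qed
qed

definition square :: "('p, 'n) ccat \<Rightarrow> 'n \<Rightarrow> 'n" where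
  "square D a = a \<cdot>\<^bsub>D\<^esub> a"

context cstar_functor
begin

context
  fixes G assumes G: "star_functor C D G"
begin

interpretation G: cstar_functor C D G by unfold_locales (rule G)

lemma nat_trans_star:
  assumes \<eta>: "nat_trans C D F G \<eta>"
  shows "nat_trans C D G F (\<lambda>x. star D (\<eta> x))"
  unfolding nat_trans_def
proof (intro conjI ballI)
  have \<eta>A: "arr D (ob F y) (ob G y) (\<eta> y)" if "y \<in> obj C" for y
    using nat_trans_arr[OF \<eta> that F_obj G.F_obj] that by blast
  show "star D (\<eta> x) \<in> hom D (ob G x) (ob F x)" if "x \<in> obj C" for x
    using D.arr_star[OF \<eta>A[OF that]] by (simp add: arr_def)
  fix x y f assume "x \<in> obj C" "y \<in> obj C" "f \<in> hom C x y"
  then have f: "arr C x y f" by (simp add: arr_def)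
  note fs = C.arr_star[OF f]
  have "star D (ar G (star C f) \<cdot>\<^bsub>D\<^esub> \<eta> y) = star D (\<eta> x \<cdot>\<^bsub>D\<^esub> ar F (star C f))"
    using nat_trans_natural[OF \<eta> fs] by simp
  then show "ar F f \<cdot>\<^bsub>D\<^esub> star D (\<eta> x) = star D (\<eta> y) \<cdot>\<^bsub>D\<^esub> ar G f"
    using D.starcmp[OF \<eta>A G.F_arr[OF fs]] D.starcmp[OF F_arr[OF fs] \<eta>A] arrD[OF f]
      F_star[OF fs] G.F_star[OF fs] C.starstar[OF f] by simp
qed

lemma nat_trans_diff:
  assumes \<eta>: "nat_trans C D F G \<eta>" and \<xi>: "nat_trans C D F G \<xi>"
  shows "nat_trans C D F G (\<lambda>x. \<eta> x - \<xi> x)"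
  unfolding nat_trans_def
proof (intro conjI ballI)
  have A: "arr D (ob F y) (ob G y) (\<eta> y)" "arr D (ob F y) (ob G y) (\<xi> y)" if "y \<in> obj C" for y
    using nat_trans_arr[OF \<eta> that F_obj G.F_obj] nat_trans_arr[OF \<xi> that F_obj G.F_obj] that by blast+
  show "\<eta> x - \<xi> x \<in> hom D (ob F x) (ob G x)" if "x \<in> obj C" for x
    using D.arr_diff[OF A[OF that]] by (simp add: arr_def)
  fix x y f assume "x \<in> obj C" "y \<in> obj C" "f \<in> hom C x y"
  then have f: "arr C x y f" and xy: "x \<in> obj C" "y \<in> obj C" by (simp_all add: arr_def)
  show "ar G f \<cdot>\<^bsub>D\<^esub> (\<eta> x - \<xi> x) = (\<eta> y - \<xi> y) \<cdot>\<^bsub>D\<^esub> ar F f"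
    unfolding D.diffr[OF A[OF xy(1)] G.F_arr[OF f]] D.diffl[OF F_arr[OF f] A[OF xy(2)]]
      nat_trans_natural[OF \<eta> f] nat_trans_natural[OF \<xi> f] ..
qed

lemma nat_trans_cmp:
  assumes H: "star_functor C D H" and \<eta>: "nat_trans C D F G \<eta>" and \<xi>: "nat_trans C D G H \<xi>"
  shows "nat_trans C D F H (\<lambda>x. \<xi> x \<cdot>\<^bsub>D\<^esub> \<eta> x)"
  unfolding nat_trans_def
proof (intro conjI ballI)
  interpret H: cstar_functor C D H by unfold_locales (rule H)
  have A: "arr D (ob F y) (ob G y) (\<eta> y)" "arr D (ob G y) (ob H y) (\<xi> y)" if "y \<in> obj C" for y
    using nat_trans_arr[OF \<eta> that F_obj G.F_obj] nat_trans_arr[OF \<xi> that G.F_obj H.F_obj] that by blast+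
  show "\<xi> x \<cdot>\<^bsub>D\<^esub> \<eta> x \<in> hom D (ob F x) (ob H x)" if "x \<in> obj C" for x
    using D.arr_cmp[OF A[OF that]] by (simp add: arr_def)
  fix x y f assume "x \<in> obj C" "y \<in> obj C" "f \<in> hom C x y"
  then have f: "arr C x y f" and xy: "x \<in> obj C" "y \<in> obj C" by (simp_all add: arr_def)
  show "ar H f \<cdot>\<^bsub>D\<^esub> (\<xi> x \<cdot>\<^bsub>D\<^esub> \<eta> x) = (\<xi> y \<cdot>\<^bsub>D\<^esub> \<eta> y) \<cdot>\<^bsub>D\<^esub> ar F f"
    using D.assoc[OF A(1)[OF xy(1)] A(2)[OF xy(1)] H.F_arr[OF f]]
      D.assoc[OF A(1)[OF xy(1)] G.F_arr[OF f] A(2)[OF xy(2)]]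
      D.assoc[OF F_arr[OF f] A[OF xy(2)]]
      nat_trans_natural[OF \<eta> f] nat_trans_natural[OF \<xi> f] by simp
qed

end

section \<open>Boundedness of natural transformations over all objects\<close>

lemma nrm_sum:
  assumes "x \<in> obj D" "y \<in> obj D" "\<And>i. i \<in> I \<Longrightarrow> arr D x y (f i)"
  shows "nrm D (\<Sum>i\<in>I. f i) \<le> (\<Sum>i\<in>I. nrm D (f i))"
  using assms(3)
proof (induction I rule: infinite_finite_induct)
  case (insert i I)
  have "nrm D (f i + sum f I) \<le> nrm D (f i) + nrm D (sum f I)"
    using insert.prems assms(1,2) D.arr_sum[of x y I f] by (intro D.nrm_triangle[of x y]) (auto simp: arr_def)
  then show ?case using insert by auto
qed (use D.nrm_eq_0_iff[OF assms(1,2) arrD(3)[OF D.arr_zero[OF assms(1,2)]]] in auto)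

lemma nrm_mult: assumes "arr D x y f" "arr D y z g" shows "nrm D (g \<cdot>\<^bsub>D\<^esub> f) \<le> nrm D g * nrm D f"
  using assms by (auto simp: arr_def intro: D.nrm_cmp)

lemma nrm_pos: "arr D x y f \<Longrightarrow> 0 \<le> nrm D f"
  by (auto simp: arr_def intro: D.nrm_nonneg)

text \<open>Naturality moves \<open>b x\<close> past the images of the isometries in a decomposition
  of \<open>x\<close>, where it becomes \<open>b\<close> at a representative. The order of the
  quantifiers matters: \<open>K\<close> depends on \<open>x\<close> alone and so serves all iterated
  squares of a transformation at once.\<close>

lemma nat_endo_bound:
  assumes x: "x \<in> obj C"
  shows "\<exists>K. \<forall>b c. nat_trans C D F F b \<longrightarrow> (\<forall>u\<in>reps C. nrm D (b u) \<le> c) \<longrightarrow> nrm D (b x) \<le> K * c"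
proof -
  note d = C.decomp_dec[OF x]
  define K where "K = (\<Sum>p\<in>dec C x. nrm D (ar F (snd p)) * nrm D (star D (ar F (snd p))))"
  have "nrm D (b x) \<le> K * c" if b: "nat_trans C D F F b" and c: "\<And>u. u \<in> reps C \<Longrightarrow> nrm D (b u) \<le> c" for b c
  proof -
    have bA: "arr D (ob F y) (ob F y) (b y)" if "y \<in> obj C" for y
      using nat_trans_arr[OF b that] F_obj that by blast
    have FA: "arr D (ob F (fst p)) (ob F x) (ar F (snd p))" if "p \<in> dec C x" for p
      using F_arr[OF C.decompD(3)[OF d that]] .
    have res: "(\<Sum>p\<in>dec C x. ar F (snd p) \<cdot>\<^bsub>D\<^esub> star D (ar F (snd p))) = idn D (ob F x)"
      by (rule F_resolution[OF C.decompD(5)[OF d] C.decompD(3)[OF d] x])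
    have "nrm D (b x) = nrm D (\<Sum>p\<in>dec C x. (b x \<cdot>\<^bsub>D\<^esub> ar F (snd p)) \<cdot>\<^bsub>D\<^esub> star D (ar F (snd p)))"
      using D.expand_right[OF res FA bA[OF x]] by simp
    also have "\<dots> \<le> (\<Sum>p\<in>dec C x. nrm D ((b x \<cdot>\<^bsub>D\<^esub> ar F (snd p)) \<cdot>\<^bsub>D\<^esub> star D (ar F (snd p))))"
      by (rule nrm_sum[OF F_obj[OF x] F_obj[OF x]])
        (rule D.arr_cmp[OF D.arr_star[OF FA] D.arr_cmp[OF FA bA[OF x]]])
    also have "\<dots> \<le> (\<Sum>p\<in>dec C x. (nrm D (ar F (snd p)) * nrm D (star D (ar F (snd p)))) * c)"
    proof (rule sum_mono)
      fix p assume p: "p \<in> dec C x"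
      note pr = C.decompD(2)[OF d p]
      note Fs = D.arr_star[OF FA[OF p]] and bu = bA[OF C.reps_obj[OF pr]]
      have nat: "b x \<cdot>\<^bsub>D\<^esub> ar F (snd p) = ar F (snd p) \<cdot>\<^bsub>D\<^esub> b (fst p)"
        using nat_trans_natural[OF b C.decompD(3)[OF d p]] by simp
      have "nrm D (ar F (snd p) \<cdot>\<^bsub>D\<^esub> b (fst p)) \<le> nrm D (ar F (snd p)) * nrm D (b (fst p))"
        by (rule nrm_mult[OF bu FA[OF p]])
      also have "\<dots> \<le> nrm D (ar F (snd p)) * c"
        by (rule mult_left_mono[OF c[OF pr] nrm_pos[OF FA[OF p]]])
      finally have "nrm D (ar F (snd p) \<cdot>\<^bsub>D\<^esub> b (fst p)) * nrm D (star D (ar F (snd p)))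
          \<le> (nrm D (ar F (snd p)) * c) * nrm D (star D (ar F (snd p)))"
        by (rule mult_right_mono[OF _ nrm_pos[OF Fs]])
      then show "nrm D ((b x \<cdot>\<^bsub>D\<^esub> ar F (snd p)) \<cdot>\<^bsub>D\<^esub> star D (ar F (snd p)))
          \<le> (nrm D (ar F (snd p)) * nrm D (star D (ar F (snd p)))) * c"
        using nrm_mult[OF Fs D.arr_cmp[OF bu FA[OF p]]] unfolding nat by (simp add: mult_ac)
    qed
    finally show ?thesis by (simp add: K_def sum_distrib_right)
  qed
  then show ?thesis by blast
qed

text \<open>For a self-adjoint element the C*-identity makes the norm exactly multiplicative under
  squaring, which is why the exponents are powers of two.\<close>

lemma nrm_square_iter:
  assumes a: "arr D y y a" "star D a = a"
  shows "arr D y y ((square D ^^ n) a) \<and> star D ((square D ^^ n) a) = (square D ^^ n) a \<and>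
    nrm D ((square D ^^ n) a) = nrm D a ^ (2 ^ n)"
proof (induction n)
  case (Suc n)
  define s where "s = (square D ^^ n) a"
  have s: "arr D y y s" "star D s = s" "nrm D s = nrm D a ^ (2 ^ n)" using Suc by (auto simp: s_def)
  have "nrm D (star D s \<cdot>\<^bsub>D\<^esub> s) = (nrm D s)\<^sup>2"
    using s(1) by (intro D.cstar_identity) (auto simp: arr_def)
  moreover have "(square D ^^ Suc n) a = s \<cdot>\<^bsub>D\<^esub> s"
    unfolding funpow.simps o_apply s_def[symmetric] by (rule square_def)
  ultimately show ?case
    using s D.arr_cmp[OF s(1,1)] D.starcmp[OF s(1,1)]
    by (simp add: power_mult[symmetric] mult.commute)
qed (use a in auto)

text \<open>For a natural endomorphism that is self-adjoint, comparing the norms of its \<open>2 ^ n\<close>-th powers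
  removes the constant of \<open>nat_endo_bound\<close>, which depends on the object.\<close>

lemma bdd_nat_trans:
  assumes G: "star_functor C D G" and \<eta>: "nat_trans C D F G \<eta>"
  shows "bdd_above ((\<lambda>x. nrm D (star D (\<eta> x) \<cdot>\<^bsub>D\<^esub> \<eta> x)) ` obj C)"
proof -
  interpret G: cstar_functor C D G by unfold_locales (rule G)
  define a where "a = (\<lambda>x. star D (\<eta> x) \<cdot>\<^bsub>D\<^esub> \<eta> x)"
  have \<eta>A: "arr D (ob F y) (ob G y) (\<eta> y)" if "y \<in> obj C" for y
    using nat_trans_arr[OF \<eta> that F_obj G.F_obj] that by blast
  have aA: "arr D (ob F y) (ob F y) (a y)" if "y \<in> obj C" for y
    unfolding a_def by (rule D.arr_cmp[OF \<eta>A[OF that] D.arr_star[OF \<eta>A[OF that]]])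
  have as: "star D (a y) = a y" if "y \<in> obj C" for y
    unfolding a_def
    using D.starcmp[OF \<eta>A[OF that] D.arr_star[OF \<eta>A[OF that]]] D.starstar[OF \<eta>A[OF that]] by simp
  have nat: "nat_trans C D F F (\<lambda>x. (square D ^^ n) (a x))" for n
  proof (induction n)
    case 0
    show ?case
      using nat_trans_cmp[OF G F \<eta> nat_trans_star[OF G \<eta>]] by (simp add: a_def)
  next
    case (Suc n)
    show ?case using nat_trans_cmp[OF F F Suc Suc] by (simp add: square_def)
  qed
  define c where "c = (\<Sum>u\<in>reps C. nrm D (a u))"
  have cu: "nrm D (a u) \<le> c" if "u \<in> reps C" for u
    unfolding c_def using that nrm_pos[OF aA[OF C.reps_obj]]
    by (intro member_le_sum) (auto intro: C.finite_reps)
  have c0: "0 \<le> c" unfolding c_def using nrm_pos[OF aA[OF C.reps_obj]] by (intro sum_nonneg) auto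
  have "nrm D (a x) \<le> c" if x: "x \<in> obj C" for x
  proof -
    obtain K where K: "\<And>b c. nat_trans C D F F b \<Longrightarrow> (\<And>u. u \<in> reps C \<Longrightarrow> nrm D (b u) \<le> c) \<Longrightarrow>
        nrm D (b x) \<le> K * c"
      using nat_endo_bound[OF x] by blast
    have "nrm D (a x) ^ (2 ^ n) \<le> K * c ^ (2 ^ n)" for n
    proof -
      have "nrm D ((square D ^^ n) (a u)) \<le> c ^ (2 ^ n)" if "u \<in> reps C" for u
        using nrm_square_iter[OF aA as, OF C.reps_obj C.reps_obj, OF that that, of n] cu[OF that]
          nrm_pos[OF aA[OF C.reps_obj[OF that]]] by (simp add: power_mono)
      from K[OF nat this] show ?thesis using nrm_square_iter[OF aA as, OF x x, of n] by simp
    qed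
    then show ?thesis by (rule le_of_power_le[OF nrm_pos[OF aA[OF x]] c0])
  qed
  then show ?thesis unfolding a_def by (intro bdd_aboveI[of _ c]) auto
qed

text \<open>A real \<open>SUP\<close> bounds the members of its set only if the set is bounded
  above, so \<open>bdd_nat_trans\<close> is needed before \<open>nt_norm\<close> says anything about
  a component.\<close>

lemma nrm_le_nt_norm:
  assumes G: "star_functor C D G" and \<eta>: "nat_trans C D F G \<eta>" and x: "x \<in> obj C"
  shows "nrm D (\<eta> x) \<le> nt_norm C D \<eta>"
proof -
  interpret G: cstar_functor C D G by unfold_locales (rule G)
  have A: "arr D (ob F x) (ob G x) (\<eta> x)" using nat_trans_arr[OF \<eta> x F_obj G.F_obj] x by blast
  have "(nrm D (\<eta> x))\<^sup>2 = nrm D (star D (\<eta> x) \<cdot>\<^bsub>D\<^esub> \<eta> x)"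
    using A D.cstar_identity[of "ob F x" "ob G x" "\<eta> x"] by (simp add: arr_def)
  also have "\<dots> \<le> (SUP x\<in>obj C. nrm D (star D (\<eta> x) \<cdot>\<^bsub>D\<^esub> \<eta> x))"
    by (rule cSUP_upper[OF x bdd_nat_trans[OF G \<eta>]])
  finally show ?thesis unfolding nt_norm_def by (rule real_le_rsqrt)
qed

lemma nat_trans_whisker_left:
  assumes G: "star_functor C D G" and \<eta>: "nat_trans C D F G \<eta>" and H: "cstar_functor D E H"
  shows "nat_trans C E (comp_functor H F) (comp_functor H G) (\<lambda>x. ar H (\<eta> x))"
  unfolding nat_trans_def comp_functor_def cfunctor.select_convs
proof (intro conjI ballI)
  interpret G: cstar_functor C D G by unfold_locales (rule G)
  interpret H: cstar_functor D E H by (rule H)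
  have A: "arr D (ob F y) (ob G y) (\<eta> y)" if "y \<in> obj C" for y
    using nat_trans_arr[OF \<eta> that F_obj G.F_obj] that by blast
  show "ar H (\<eta> x) \<in> hom E (ob H (ob F x)) (ob H (ob G x))" if "x \<in> obj C" for x
    using H.F_arr[OF A[OF that]] by (simp add: arr_def)
  fix x y f assume "x \<in> obj C" "y \<in> obj C" "f \<in> hom C x y"
  then have f: "arr C x y f" and xy: "x \<in> obj C" "y \<in> obj C" by (simp_all add: arr_def)
  show "ar H (ar G f) \<cdot>\<^bsub>E\<^esub> ar H (\<eta> x) = ar H (\<eta> y) \<cdot>\<^bsub>E\<^esub> ar H (ar F f)"
    using H.F_cmp[OF A[OF xy(1)] G.F_arr[OF f]] H.F_cmp[OF F_arr[OF f] A[OF xy(2)]]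
      nat_trans_natural[OF \<eta> f] by simp
qed

lemma nat_trans_whisker_right:
  assumes "nat_trans D E P Q \<eta>"
  shows "nat_trans C E (comp_functor P F) (comp_functor Q F) (\<lambda>x. \<eta> (ob F x))"
  using assms F_obj F_arr unfolding nat_trans_def comp_functor_def cfunctor.select_convs arr_def by blast

lemma cstar_functor_comp:
  assumes H: "cstar_functor D E H"
  shows "cstar_functor C E (comp_functor H F)"
proof -
  interpret H: cstar_functor D E H by (rule H)
  show ?thesis
  proof
    show "star_functor C E (comp_functor H F)"
      unfolding star_functor_def comp_functor_def cfunctor.select_convs
    proof (intro conjI ballI allI)
      show "ob H (ob F x) \<in> obj E" "ar H (ar F (idn C x)) = idn E (ob H (ob F x))" if "x \<in> obj C" for x
        using H.F_obj[OF F_obj[OF that]] F_idn[OF that] H.F_idn[OF F_obj[OF that]] by simp_all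
      fix x y f assume xy: "x \<in> obj C" "y \<in> obj C" and "f \<in> hom C x y"
      then have f: "arr C x y f" by (simp add: arr_def)
      note Ff = F_arr[OF f]
      show "ar H (ar F f) \<in> hom E (ob H (ob F x)) (ob H (ob F y))"
        using H.F_arr[OF Ff] by (simp add: arr_def)
      show "ar H (ar F (star C f)) = star E (ar H (ar F f))"
        using F_star[OF f] H.F_star[OF Ff] by simp
      show "ar H (ar F (c *\<^sub>C f)) = c *\<^sub>C ar H (ar F f)" for c
        using F_scale[OF f] H.F_scale[OF Ff] by simp
      show "ar H (ar F (f + g)) = ar H (ar F f) + ar H (ar F g)" if "g \<in> hom C x y" for g
      proof -
        have g: "arr C x y g" using that xy by (simp add: arr_def)
        show ?thesis using F_add[OF f g] H.F_add[OF Ff F_arr[OF g]] by simp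
      qed
      show "ar H (ar F (g \<cdot>\<^bsub>C\<^esub> f)) = ar H (ar F g) \<cdot>\<^bsub>E\<^esub> ar H (ar F f)"
        if "z \<in> obj C" "g \<in> hom C y z" for z g
      proof -
        have g: "arr C y z g" using that xy by (simp add: arr_def)
        show ?thesis using F_cmp[OF f g] H.F_cmp[OF Ff F_arr[OF g]] by simp
      qed
    qed
  qed
qed

end


section \<open>Recurrence of bounded backward orbits\<close>

text \<open>Bolzano-Weierstrass, refining the subsequence for one coordinate at a time.\<close>

lemma simultaneous_convergent_subsequence:
  fixes c :: "nat \<Rightarrow> 't \<Rightarrow> complex"
  assumes "finite T" "\<And>t. t \<in> T \<Longrightarrow> \<exists>B. \<forall>n. cmod (c n t) \<le> B"
  shows "\<exists>r. strict_mono (r :: nat \<Rightarrow> nat) \<and> (\<forall>t\<in>T. convergent (\<lambda>n. c (r n) t))"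
  using assms
proof (induction T rule: finite_induct)
  case empty
  then show ?case using strict_mono_id by (auto simp: id_def intro: strict_mono_def)
next
  case (insert t T)
  then obtain r where r: "strict_mono r" "\<And>s. s \<in> T \<Longrightarrow> convergent (\<lambda>n. c (r n) s)" by auto
  obtain B where "\<And>n. cmod (c n t) \<le> B" using insert.prems by blast
  then have "bounded (range (\<lambda>n. c (r n) t))" by (auto simp: bounded_iff)
  then obtain l q where q: "strict_mono q" "((\<lambda>n. c (r n) t) \<circ> q) \<longlonglongrightarrow> l"
    using bounded_imp_convergent_subsequence by blast
  have "convergent (\<lambda>n. c ((r \<circ> q) n) s)" if "s \<in> insert t T" for s
  proof (cases "s = t")
    case True
    then show ?thesis using q(2) by (auto simp: convergent_def o_def)
  next
    case False
    then show ?thesis using convergent_subseq_convergent[OF r(2)[of s] q(1)] that by (simp add: o_def)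
  qed
  then show ?case using strict_mono_o[OF r(1) q(1)] by blast
qed

text \<open>A bounded backward orbit of a contraction is recurrent: two nearby points of the orbit are
  moved back to its beginning without increasing their distance.\<close>

lemma recurrence:
  fixes c :: "nat \<Rightarrow> 't \<Rightarrow> complex" and \<omega> :: "'t \<Rightarrow> real"
  assumes T: "finite T" and bdd: "\<And>t. t \<in> T \<Longrightarrow> \<exists>B. \<forall>n. cmod (c n t) \<le> B"
    and pos: "\<And>t. t \<in> T \<Longrightarrow> 0 < \<omega> t"
    and mono: "\<And>n. (\<Sum>t\<in>T. \<omega> t * (cmod (c n t))\<^sup>2) \<le> (\<Sum>t\<in>T. \<omega> t * (cmod (c (Suc n) t))\<^sup>2)"
    and contr: "\<And>i m. (\<Sum>t\<in>T. \<omega> t * (cmod (c 0 t - c m t))\<^sup>2) \<le>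
      (\<Sum>t\<in>T. \<omega> t * (cmod (c i t - c (i + m) t))\<^sup>2)"
  shows "(\<Sum>t\<in>T. \<omega> t * (cmod (c 1 t))\<^sup>2) \<le> (\<Sum>t\<in>T. \<omega> t * (cmod (c 0 t))\<^sup>2)"
proof -
  define E where "E = (\<lambda>f. \<Sum>t\<in>T. \<omega> t * (cmod (f t))\<^sup>2)"
  obtain r where r: "strict_mono r" and conv: "\<And>t. t \<in> T \<Longrightarrow> convergent (\<lambda>n. c (r n) t)"
    using simultaneous_convergent_subsequence[OF T, of c] bdd by blast
  \<comment> \<open>The gaps of the subsequence. By \<open>contr\<close> at \<open>i = r j\<close>,
    the distance from \<open>c 0\<close> to \<open>c (m j)\<close> is at most that of two
    consecutive members of a convergent sequence.\<close>
  define m where "m = (\<lambda>j. r (Suc j) - r j)"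
  have rm: "r j + m j = r (Suc j)" "1 \<le> m j" for j
    using strict_mono_Suc_iff[of r] r by (auto simp: m_def Suc_le_eq less_imp_le)
  have "(\<lambda>j. E (\<lambda>t. c (r j) t - c (r (Suc j)) t)) \<longlonglongrightarrow> (\<Sum>t\<in>T. \<omega> t * (cmod 0)\<^sup>2)"
    unfolding E_def
  proof (intro tendsto_intros)
    fix t assume "t \<in> T"
    from conv[OF this] obtain l where l: "(\<lambda>n. c (r n) t) \<longlonglongrightarrow> l" by (auto simp: convergent_def)
    show "(\<lambda>j. c (r j) t - c (r (Suc j)) t) \<longlonglongrightarrow> 0"
      using tendsto_diff[OF l LIMSEQ_Suc[OF l]] by simp
  qed
  then have lim: "(\<lambda>j. E (\<lambda>t. c (r j) t - c (r (Suc j)) t)) \<longlonglongrightarrow> 0" by simp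
  have "(\<lambda>j. c (m j) t) \<longlonglongrightarrow> c 0 t" if t: "t \<in> T" for t
  proof -
    have le: "\<omega> t * (cmod (c 0 t - c (m j) t))\<^sup>2 \<le> E (\<lambda>t. c (r j) t - c (r (Suc j)) t)" for j
    proof -
      have "\<omega> t * (cmod (c 0 t - c (m j) t))\<^sup>2 \<le> E (\<lambda>t. c 0 t - c (m j) t)"
        unfolding E_def using pos by (intro member_le_sum[OF t _ T]) (auto simp: less_imp_le)
      also have "\<dots> \<le> E (\<lambda>t. c (r j) t - c (r (Suc j)) t)"
        unfolding E_def using contr[of "m j" "r j"] rm by simp
      finally show ?thesis .
    qed
    have "(\<lambda>j. \<omega> t * (cmod (c 0 t - c (m j) t))\<^sup>2) \<longlonglongrightarrow> 0"
      by (rule tendsto_sandwich[OF _ _ tendsto_const lim]) (use le pos[OF t] in \<open>auto simp: less_imp_le\<close>)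
    from tendsto_mult_left[OF this, of "1 / \<omega> t"]
    have "(\<lambda>j. (cmod (c 0 t - c (m j) t))\<^sup>2) \<longlonglongrightarrow> 0" using pos[OF t] by simp
    then have "(\<lambda>j. sqrt ((cmod (c 0 t - c (m j) t))\<^sup>2)) \<longlonglongrightarrow> sqrt 0" by (rule tendsto_real_sqrt)
    then have "(\<lambda>j. c 0 t - c (m j) t) \<longlonglongrightarrow> 0" by (simp add: tendsto_norm_zero_iff)
    from tendsto_diff[OF tendsto_const[of "c 0 t"] this] show ?thesis by simp
  qed
  then have lim: "(\<lambda>j. E (c (m j))) \<longlonglongrightarrow> E (c 0)"
    unfolding E_def by (intro tendsto_intros) auto
  \<comment> \<open>Every gap is at least 1, so monotonicity applies however small the gaps
    stay.\<close>
  have "E (c 1) \<le> E (c (m j))" for j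
    using lift_Suc_mono_le[of "\<lambda>n. E (c n)", OF _ rm(2)] mono by (simp add: E_def)
  then have "E (c 1) \<le> E (c 0)" by (intro LIMSEQ_le_const[OF lim]) auto
  then show ?thesis by (simp add: E_def)
qed


section \<open>Energy of transformations between 1-cells\<close>

text \<open>Pythagoras: \<open>adj\<close> says that the inner product of \<open>Z\<close> with
  \<open>ar F f\<close> is the squared norm of \<open>f\<close>, and \<open>F\<close> is isometric
  by \<open>tr_functor\<close>. Hence \<open>Z - ar F f\<close> is orthogonal to
  \<open>ar F f\<close>.\<close>

lemma (in cstar_functor) qn_diff_image:
  assumes w: "\<And>u. u \<in> reps C \<Longrightarrow> (\<Sum>v\<in>reps D. adjacency D F v u * w' v) = w u"
    and f: "arr C a b f" and Z: "arr D (ob F a) (ob F b) Z"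
    and adj: "tr C w a (star C f \<cdot>\<^bsub>C\<^esub> f) = tr D w' (ob F a) (star D (ar F f) \<cdot>\<^bsub>D\<^esub> Z)"
  shows "qn D w' (ob F a) (Z - ar F f) = qn D w' (ob F a) Z - qn C w a f"
proof -
  note Ff = F_arr[OF f]
  note Zs = D.arr_star[OF Z] and Fs = D.arr_star[OF Ff]
  note ZZ = D.arr_cmp[OF Z Zs] and ZF = D.arr_cmp[OF Ff Zs] and FZ = D.arr_cmp[OF Z Fs] and FF = D.arr_cmp[OF Ff Fs]
  have "star D (Z - ar F f) \<cdot>\<^bsub>D\<^esub> (Z - ar F f) =
      (star D Z \<cdot>\<^bsub>D\<^esub> Z - star D Z \<cdot>\<^bsub>D\<^esub> ar F f) - (star D (ar F f) \<cdot>\<^bsub>D\<^esub> Z - star D (ar F f) \<cdot>\<^bsub>D\<^esub> ar F f)"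
    unfolding D.stardiff[OF Z Ff] D.diffl[OF D.arr_diff[OF Z Ff] Zs Fs] D.diffr[OF Z Ff Zs] D.diffr[OF Z Ff Fs] ..
  then have "tr D w' (ob F a) (star D (Z - ar F f) \<cdot>\<^bsub>D\<^esub> (Z - ar F f)) =
      (tr D w' (ob F a) (star D Z \<cdot>\<^bsub>D\<^esub> Z) - tr D w' (ob F a) (star D Z \<cdot>\<^bsub>D\<^esub> ar F f)) -
      (tr D w' (ob F a) (star D (ar F f) \<cdot>\<^bsub>D\<^esub> Z) - tr D w' (ob F a) (star D (ar F f) \<cdot>\<^bsub>D\<^esub> ar F f))"
    using D.tr_diff[OF D.arr_diff[OF ZZ ZF] D.arr_diff[OF FZ FF]] D.tr_diff[OF ZZ ZF] D.tr_diff[OF FZ FF] by simp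
  moreover have "tr D w' (ob F a) (star D Z \<cdot>\<^bsub>D\<^esub> ar F f) = cnj (tr D w' (ob F a) (star D (ar F f) \<cdot>\<^bsub>D\<^esub> Z))"
    using D.tr_star[OF FZ] D.starcmp[OF Z Fs] D.starstar[OF Ff] by simp
  moreover have "tr D w' (ob F a) (star D (ar F f) \<cdot>\<^bsub>D\<^esub> ar F f) = tr C w a (star C f \<cdot>\<^bsub>C\<^esub> f)"
    using tr_functor[OF w C.arr_cmp[OF f C.arr_star[OF f]]] F_cmp[OF f C.arr_star[OF f]] F_star[OF f] by simp
  ultimately show ?thesis using adj by (simp add: qn_def)
qed

locale cell_pair =
  fixes M :: "nat \<Rightarrow> ('o, 'm::complex_vector) ccat"
    and N :: "nat \<Rightarrow> ('p, 'n::complex_vector) ccat"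
    and \<Gamma> :: "nat \<Rightarrow> ('o, 'm, 'o, 'm) cfunctor"
    and \<Delta> :: "nat \<Rightarrow> ('p, 'n, 'p, 'n) cfunctor"
    and \<mu> :: "nat \<Rightarrow> 'o \<Rightarrow> real"
    and \<nu> :: "nat \<Rightarrow> 'p \<Rightarrow> real"
    and \<Lambda> \<Omega> :: "nat \<Rightarrow> ('o, 'm, 'p, 'n) cfunctor"
    and W\<Lambda> W\<Omega> :: "nat \<Rightarrow> 'o \<Rightarrow> 'n"
  assumes zero_M: "zero_cell M \<Gamma> \<mu>"
    and zero_N: "zero_cell N \<Delta> \<nu>"
    and one_\<Lambda>: "one_cell M \<Gamma> \<mu> N \<Delta> \<nu> \<Lambda> W\<Lambda>"
    and one_\<Omega>: "one_cell M \<Gamma> \<mu> N \<Delta> \<nu> \<Omega> W\<Omega>"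
begin

lemma cat_M: "finite_semisimple_cstar_category (M k)"
  and cat_N: "finite_semisimple_cstar_category (N k)"
  using zero_M zero_N by (auto simp: zero_cell_def)

lemma functor_\<Gamma>: "cstar_functor (M k) (M (Suc k)) (\<Gamma> (Suc k))"
  and functor_\<Delta>: "cstar_functor (N k) (N (Suc k)) (\<Delta> (Suc k))"
  and functor_\<Lambda>: "cstar_functor (M k) (N k) (\<Lambda> k)"
  and functor_\<Omega>: "cstar_functor (M k) (N k) (\<Omega> k)"
  using zero_M zero_N one_\<Lambda> one_\<Omega> cat_M cat_N
  by (auto simp: zero_cell_def one_cell_def bifaithful_def cstar_functor_def cstar_functor_axioms_def)

lemma weight_\<mu>: "weight_function (M k) (\<mu> k)"
  and weight_\<nu>: "weight_function (N k) (\<nu> k)"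
  using zero_M zero_N by (auto simp: zero_cell_def)

lemma \<nu>_transpose: "u \<in> reps (N k) \<Longrightarrow>
    (\<Sum>v\<in>reps (N (Suc k)). adjacency (N (Suc k)) (\<Delta> (Suc k)) v u * \<nu> (Suc k) v) = \<nu> k u"
  using zero_N by (simp add: zero_cell_def)

definition nat_at :: "nat \<Rightarrow> ('o \<Rightarrow> 'n) \<Rightarrow> bool" where
  "nat_at k \<alpha> \<longleftrightarrow> nat_trans (M k) (N k) (\<Lambda> k) (\<Omega> k) \<alpha>"

text \<open>The argument to which the loop operator applies the adjoint functor:
  \<open>\<beta>\<close> at \<open>\<Gamma>\<close>, conjugated by the unitaries so that it runs
  between images under \<open>\<Delta>\<close>.\<close>

definition pullback :: "nat \<Rightarrow> ('o \<Rightarrow> 'n) \<Rightarrow> 'o \<Rightarrow> 'n" where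
  "pullback k \<beta> x = star (N (Suc k)) (W\<Omega> (Suc k) x) \<cdot>\<^bsub>N (Suc k)\<^esub> \<beta> (ob (\<Gamma> (Suc k)) x)
     \<cdot>\<^bsub>N (Suc k)\<^esub> W\<Lambda> (Suc k) x"

text \<open>For tracial weights the loop operator is the adjoint of \<open>\<alpha> \<mapsto> W \<Delta>(\<alpha>) W\<^sup>*\<close>; unlike the loop
  operator itself, the following description of \<open>\<alpha> = S \<beta>\<close> does not involve the adjoint functors, whose
  periodicity is not assumed.\<close>

definition loop_rel :: "nat \<Rightarrow> ('o \<Rightarrow> 'n) \<Rightarrow> ('o \<Rightarrow> 'n) \<Rightarrow> bool" where
  "loop_rel k \<alpha> \<beta> \<longleftrightarrow> (\<forall>x\<in>obj (M k). \<forall>g. arr (N k) (ob (\<Lambda> k) x) (ob (\<Omega> k) x) g \<longrightarrow>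
     tr (N k) (\<nu> k) (ob (\<Lambda> k) x) (star (N k) g \<cdot>\<^bsub>N k\<^esub> \<alpha> x) =
     tr (N (Suc k)) (\<nu> (Suc k)) (ob (\<Delta> (Suc k)) (ob (\<Lambda> k) x))
       (star (N (Suc k)) (ar (\<Delta> (Suc k)) g) \<cdot>\<^bsub>N (Suc k)\<^esub> pullback k \<beta> x))"

text \<open>The weight is a parameter because transport along \<open>\<Gamma>\<close> leads away
  from the family \<open>\<mu>\<close>; only after a full period is the transported weight again a
  multiple of a member of it.\<close>

definition energy :: "nat \<Rightarrow> ('o \<Rightarrow> real) \<Rightarrow> ('o \<Rightarrow> 'n) \<Rightarrow> real" where
  "energy k w \<alpha> = (\<Sum>u\<in>reps (M k). w u * qn (N k) (\<nu> k) (ob (\<Lambda> k) u) (\<alpha> u))"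

text \<open>Since the unitaries are invertible, this vanishes exactly where the exchange relation
  holds.\<close>

definition defect :: "nat \<Rightarrow> ('o \<Rightarrow> 'n) \<Rightarrow> ('o \<Rightarrow> 'n) \<Rightarrow> 'o \<Rightarrow> 'n" where
  "defect k \<alpha> \<beta> x = pullback k \<beta> x - ar (\<Delta> (Suc k)) (\<alpha> x)"

definition defect_energy :: "nat \<Rightarrow> ('o \<Rightarrow> real) \<Rightarrow> ('o \<Rightarrow> 'n) \<Rightarrow> ('o \<Rightarrow> 'n) \<Rightarrow> real" where
  "defect_energy k w \<alpha> \<beta> = (\<Sum>u\<in>reps (M k). w u *
     qn (N (Suc k)) (\<nu> (Suc k)) (ob (\<Delta> (Suc k)) (ob (\<Lambda> k) u)) (defect k \<alpha> \<beta> u))"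

section \<open>Transformations between the two 1-cells and the energy balance of one loop
  step\<close>

lemma nat_at_arr: assumes "nat_at k \<alpha>" "x \<in> obj (M k)"
  shows "arr (N k) (ob (\<Lambda> k) x) (ob (\<Omega> k) x) (\<alpha> x)"
proof -
  interpret L: cstar_functor "M k" "N k" "\<Lambda> k" by (rule functor_\<Lambda>)
  interpret O: cstar_functor "M k" "N k" "\<Omega> k" by (rule functor_\<Omega>)
  show ?thesis using nat_trans_arr[OF _ assms(2) L.F_obj O.F_obj] assms by (auto simp: nat_at_def)
qed

lemma nat_at_diff: assumes "nat_at k \<alpha>" "nat_at k \<beta>" shows "nat_at k (\<lambda>x. \<alpha> x - \<beta> x)"
proof -
  interpret L: cstar_functor "M k" "N k" "\<Lambda> k" by (rule functor_\<Lambda>)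
  interpret O: cstar_functor "M k" "N k" "\<Omega> k" by (rule functor_\<Omega>)
  show ?thesis using assms L.nat_trans_diff[OF O.F] by (simp add: nat_at_def)
qed

lemma W\<Lambda>_unitary: "nat_unitary (M k) (N (Suc k)) (comp_functor (\<Delta> (Suc k)) (\<Lambda> k))
    (comp_functor (\<Lambda> (Suc k)) (\<Gamma> (Suc k))) (W\<Lambda> (Suc k))"
  using one_\<Lambda> by (simp add: one_cell_def)

lemma W\<Omega>_unitary: "nat_unitary (M k) (N (Suc k)) (comp_functor (\<Delta> (Suc k)) (\<Omega> k))
    (comp_functor (\<Omega> (Suc k)) (\<Gamma> (Suc k))) (W\<Omega> (Suc k))"
  using one_\<Omega> by (simp add: one_cell_def)

lemma W_arr:
  assumes x: "x \<in> obj (M k)"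
  shows "arr (N (Suc k)) (ob (\<Delta> (Suc k)) (ob (\<Lambda> k) x)) (ob (\<Lambda> (Suc k)) (ob (\<Gamma> (Suc k)) x)) (W\<Lambda> (Suc k) x)"
    and "arr (N (Suc k)) (ob (\<Delta> (Suc k)) (ob (\<Omega> k) x)) (ob (\<Omega> (Suc k)) (ob (\<Gamma> (Suc k)) x)) (W\<Omega> (Suc k) x)"
proof -
  interpret L: cstar_functor "M k" "N k" "\<Lambda> k" by (rule functor_\<Lambda>)
  interpret O: cstar_functor "M k" "N k" "\<Omega> k" by (rule functor_\<Omega>)
  interpret L1: cstar_functor "M (Suc k)" "N (Suc k)" "\<Lambda> (Suc k)" by (rule functor_\<Lambda>)
  interpret O1: cstar_functor "M (Suc k)" "N (Suc k)" "\<Omega> (Suc k)" by (rule functor_\<Omega>)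
  interpret G: cstar_functor "M k" "M (Suc k)" "\<Gamma> (Suc k)" by (rule functor_\<Gamma>)
  interpret D: cstar_functor "N k" "N (Suc k)" "\<Delta> (Suc k)" by (rule functor_\<Delta>)
  show "arr (N (Suc k)) (ob (\<Delta> (Suc k)) (ob (\<Lambda> k) x)) (ob (\<Lambda> (Suc k)) (ob (\<Gamma> (Suc k)) x)) (W\<Lambda> (Suc k) x)"
    using W\<Lambda>_unitary x D.F_obj[OF L.F_obj[OF x]] L1.F_obj[OF G.F_obj[OF x]]
    by (simp add: nat_unitary_def nat_trans_def comp_functor_def arr_def)
  show "arr (N (Suc k)) (ob (\<Delta> (Suc k)) (ob (\<Omega> k) x)) (ob (\<Omega> (Suc k)) (ob (\<Gamma> (Suc k)) x)) (W\<Omega> (Suc k) x)"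
    using W\<Omega>_unitary x D.F_obj[OF O.F_obj[OF x]] O1.F_obj[OF G.F_obj[OF x]]
    by (simp add: nat_unitary_def nat_trans_def comp_functor_def arr_def)
qed

lemma W_cmp_star:
  assumes x: "x \<in> obj (M k)"
  shows "W\<Lambda> (Suc k) x \<cdot>\<^bsub>N (Suc k)\<^esub> star (N (Suc k)) (W\<Lambda> (Suc k) x) = idn (N (Suc k)) (ob (\<Lambda> (Suc k)) (ob (\<Gamma> (Suc k)) x))"
    and "W\<Omega> (Suc k) x \<cdot>\<^bsub>N (Suc k)\<^esub> star (N (Suc k)) (W\<Omega> (Suc k) x) = idn (N (Suc k)) (ob (\<Omega> (Suc k)) (ob (\<Gamma> (Suc k)) x))"
  using W\<Lambda>_unitary[of k] W\<Omega>_unitary[of k] x by (simp_all add: nat_unitary_def comp_functor_def)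

lemma pullback_arr:
  assumes "nat_at (Suc k) \<beta>" "x \<in> obj (M k)"
  shows "arr (N (Suc k)) (ob (\<Delta> (Suc k)) (ob (\<Lambda> k) x)) (ob (\<Delta> (Suc k)) (ob (\<Omega> k) x)) (pullback k \<beta> x)"
proof -
  interpret N1: finite_semisimple_cstar_category "N (Suc k)" by (rule cat_N)
  interpret G: cstar_functor "M k" "M (Suc k)" "\<Gamma> (Suc k)" by (rule functor_\<Gamma>)
  show ?thesis unfolding pullback_def
    by (rule N1.arr_cmp[OF W_arr(1)[OF assms(2)]
          N1.arr_cmp[OF nat_at_arr[OF assms(1) G.F_obj[OF assms(2)]] N1.arr_star[OF W_arr(2)[OF assms(2)]]]])
qed

text \<open>Naturality of the defect allows \<open>qn_nat_trans\<close> to extend its vanishing from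
  the representatives to all objects.\<close>

lemma nat_trans_defect:
  assumes \<alpha>: "nat_at k \<alpha>" and \<beta>: "nat_at (Suc k) \<beta>"
  shows "nat_trans (M k) (N (Suc k)) (comp_functor (\<Delta> (Suc k)) (\<Lambda> k)) (comp_functor (\<Delta> (Suc k)) (\<Omega> k))
    (defect k \<alpha> \<beta>)"
proof -
  interpret L: cstar_functor "M k" "N k" "\<Lambda> k" by (rule functor_\<Lambda>)
  interpret O: cstar_functor "M k" "N k" "\<Omega> k" by (rule functor_\<Omega>)
  interpret G: cstar_functor "M k" "M (Suc k)" "\<Gamma> (Suc k)" by (rule functor_\<Gamma>)
  interpret DL: cstar_functor "M k" "N (Suc k)" "comp_functor (\<Delta> (Suc k)) (\<Lambda> k)"
    by (rule L.cstar_functor_comp[OF functor_\<Delta>])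
  interpret DO: cstar_functor "M k" "N (Suc k)" "comp_functor (\<Delta> (Suc k)) (\<Omega> k)"
    by (rule O.cstar_functor_comp[OF functor_\<Delta>])
  interpret LG: cstar_functor "M k" "N (Suc k)" "comp_functor (\<Lambda> (Suc k)) (\<Gamma> (Suc k))"
    by (rule G.cstar_functor_comp[OF functor_\<Lambda>])
  interpret OG: cstar_functor "M k" "N (Suc k)" "comp_functor (\<Omega> (Suc k)) (\<Gamma> (Suc k))"
    by (rule G.cstar_functor_comp[OF functor_\<Omega>])
  have 1: "nat_trans (M k) (N (Suc k)) (comp_functor (\<Lambda> (Suc k)) (\<Gamma> (Suc k)))
      (comp_functor (\<Omega> (Suc k)) (\<Gamma> (Suc k))) (\<lambda>x. \<beta> (ob (\<Gamma> (Suc k)) x))"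
    using \<beta> unfolding nat_at_def by (rule G.nat_trans_whisker_right)
  have 2: "nat_trans (M k) (N (Suc k)) (comp_functor (\<Omega> (Suc k)) (\<Gamma> (Suc k)))
      (comp_functor (\<Delta> (Suc k)) (\<Omega> k)) (\<lambda>x. star (N (Suc k)) (W\<Omega> (Suc k) x))"
    using W\<Omega>_unitary unfolding nat_unitary_def by (intro DO.nat_trans_star[OF OG.F]) blast
  have 3: "nat_trans (M k) (N (Suc k)) (comp_functor (\<Delta> (Suc k)) (\<Lambda> k))
      (comp_functor (\<Lambda> (Suc k)) (\<Gamma> (Suc k))) (W\<Lambda> (Suc k))"
    using W\<Lambda>_unitary unfolding nat_unitary_def by blast
  have 4: "nat_trans (M k) (N (Suc k)) (comp_functor (\<Delta> (Suc k)) (\<Lambda> k))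
      (comp_functor (\<Delta> (Suc k)) (\<Omega> k)) (pullback k \<beta>)"
    unfolding pullback_def by (rule DL.nat_trans_cmp[OF LG.F DO.F 3 LG.nat_trans_cmp[OF OG.F DO.F 1 2]])
  have 5: "nat_trans (M k) (N (Suc k)) (comp_functor (\<Delta> (Suc k)) (\<Lambda> k))
      (comp_functor (\<Delta> (Suc k)) (\<Omega> k)) (\<lambda>x. ar (\<Delta> (Suc k)) (\<alpha> x))"
    using L.nat_trans_whisker_left[OF O.F _ functor_\<Delta>] \<alpha> by (simp add: nat_at_def)
  show ?thesis unfolding defect_def by (rule DL.nat_trans_diff[OF DO.F 4 5])
qed

text \<open>\<open>loop_rel\<close> tested at \<open>g = \<alpha> x\<close> is the orthogonality
  required by \<open>qn_diff_image\<close>; conjugation by unitaries does not change the norm of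
  \<open>\<beta>\<close>.\<close>

lemma qn_defect:
  assumes \<alpha>: "nat_at k \<alpha>" and \<beta>: "nat_at (Suc k) \<beta>" and rel: "loop_rel k \<alpha> \<beta>" and x: "x \<in> obj (M k)"
  shows "qn (N (Suc k)) (\<nu> (Suc k)) (ob (\<Lambda> (Suc k)) (ob (\<Gamma> (Suc k)) x)) (\<beta> (ob (\<Gamma> (Suc k)) x)) =
    qn (N k) (\<nu> k) (ob (\<Lambda> k) x) (\<alpha> x) +
    qn (N (Suc k)) (\<nu> (Suc k)) (ob (\<Delta> (Suc k)) (ob (\<Lambda> k) x)) (defect k \<alpha> \<beta> x)"
proof -
  interpret N1: finite_semisimple_cstar_category "N (Suc k)" by (rule cat_N)
  interpret D: cstar_functor "N k" "N (Suc k)" "\<Delta> (Suc k)" by (rule functor_\<Delta>)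
  interpret G: cstar_functor "M k" "M (Suc k)" "\<Gamma> (Suc k)" by (rule functor_\<Gamma>)
  note \<alpha>A = nat_at_arr[OF \<alpha> x] and \<beta>A = nat_at_arr[OF \<beta> G.F_obj[OF x]]
  have "qn (N (Suc k)) (\<nu> (Suc k)) (ob (\<Delta> (Suc k)) (ob (\<Lambda> k) x)) (defect k \<alpha> \<beta> x) =
      qn (N (Suc k)) (\<nu> (Suc k)) (ob (\<Delta> (Suc k)) (ob (\<Lambda> k) x)) (pullback k \<beta> x) -
      qn (N k) (\<nu> k) (ob (\<Lambda> k) x) (\<alpha> x)"
    unfolding defect_def
    using rel x \<alpha>A by (intro D.qn_diff_image[OF \<nu>_transpose \<alpha>A pullback_arr[OF \<beta> x]]) (simp_all add: loop_rel_def)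
  moreover have "qn (N (Suc k)) (\<nu> (Suc k)) (ob (\<Delta> (Suc k)) (ob (\<Lambda> k) x)) (pullback k \<beta> x) =
      qn (N (Suc k)) (\<nu> (Suc k)) (ob (\<Lambda> (Suc k)) (ob (\<Gamma> (Suc k)) x)) (\<beta> (ob (\<Gamma> (Suc k)) x))"
    unfolding pullback_def
    by (rule N1.qn_unitary[OF \<beta>A W_arr(1)[OF x] W_cmp_star(1)[OF x] W_arr(2)[OF x] W_cmp_star(2)[OF x]])
  ultimately show ?thesis by simp
qed

text \<open>The object \<open>ob (\<Gamma> (Suc k)) u\<close> contains each \<open>v\<close> with
  multiplicity given by the adjacency matrix. Summing \<open>qn_defect\<close> over \<open>u\<close>
  with weight \<open>w\<close> and exchanging the sums therefore puts the image of \<open>w\<close>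
  under this matrix on the side of \<open>\<beta>\<close>.\<close>

lemma energy_step:
  assumes \<alpha>: "nat_at k \<alpha>" and \<beta>: "nat_at (Suc k) \<beta>" and rel: "loop_rel k \<alpha> \<beta>"
  shows "energy (Suc k) (\<lambda>v. \<Sum>u\<in>reps (M k). adjacency (M (Suc k)) (\<Gamma> (Suc k)) v u * w u) \<beta> =
    energy k w \<alpha> + defect_energy k w \<alpha> \<beta>"
proof -
  interpret M0: finite_semisimple_cstar_category "M k" by (rule cat_M)
  interpret G: cstar_functor "M k" "M (Suc k)" "\<Gamma> (Suc k)" by (rule functor_\<Gamma>)
  interpret L1: cstar_functor "M (Suc k)" "N (Suc k)" "\<Lambda> (Suc k)" by (rule functor_\<Lambda>)
  interpret O1: cstar_functor "M (Suc k)" "N (Suc k)" "\<Omega> (Suc k)" by (rule functor_\<Omega>)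
  define q where "q = (\<lambda>v. qn (N (Suc k)) (\<nu> (Suc k)) (ob (\<Lambda> (Suc k)) v) (\<beta> v))"
  have "energy (Suc k) (\<lambda>v. \<Sum>u\<in>reps (M k). adjacency (M (Suc k)) (\<Gamma> (Suc k)) v u * w u) \<beta> =
      (\<Sum>v\<in>reps (M (Suc k)). \<Sum>u\<in>reps (M k). w u * (adjacency (M (Suc k)) (\<Gamma> (Suc k)) v u * q v))"
    unfolding energy_def q_def sum_distrib_right by (intro sum.cong refl) (simp add: mult_ac)
  also have "\<dots> = (\<Sum>u\<in>reps (M k). w u * (\<Sum>v\<in>reps (M (Suc k)). adjacency (M (Suc k)) (\<Gamma> (Suc k)) v u * q v))"
    unfolding sum_distrib_left by (rule sum.swap)
  also have "\<dots> = (\<Sum>u\<in>reps (M k). w u * (qn (N k) (\<nu> k) (ob (\<Lambda> k) u) (\<alpha> u) +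
      qn (N (Suc k)) (\<nu> (Suc k)) (ob (\<Delta> (Suc k)) (ob (\<Lambda> k) u)) (defect k \<alpha> \<beta> u)))"
  proof (intro sum.cong refl arg_cong[where f = "(*) _"])
    fix u assume "u \<in> reps (M k)"
    then have u: "u \<in> obj (M k)" by (rule M0.reps_obj)
    have "(\<Sum>v\<in>reps (M (Suc k)). adjacency (M (Suc k)) (\<Gamma> (Suc k)) v u * q v) = q (ob (\<Gamma> (Suc k)) u)"
      using L1.qn_nat_trans[OF O1.F _ G.F_obj[OF u]] \<beta> by (simp add: nat_at_def q_def adjacency_def)
    then show "(\<Sum>v\<in>reps (M (Suc k)). adjacency (M (Suc k)) (\<Gamma> (Suc k)) v u * q v) =
        qn (N k) (\<nu> k) (ob (\<Lambda> k) u) (\<alpha> u) +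
        qn (N (Suc k)) (\<nu> (Suc k)) (ob (\<Delta> (Suc k)) (ob (\<Lambda> k) u)) (defect k \<alpha> \<beta> u)"
      using qn_defect[OF assms u] by (simp add: q_def)
  qed
  finally show ?thesis by (simp add: energy_def defect_energy_def distrib_left sum.distrib)
qed

lemma defect_arr:
  assumes \<alpha>: "nat_at k \<alpha>" and \<beta>: "nat_at (Suc k) \<beta>" and x: "x \<in> obj (M k)"
  shows "arr (N (Suc k)) (ob (\<Delta> (Suc k)) (ob (\<Lambda> k) x)) (ob (\<Delta> (Suc k)) (ob (\<Omega> k) x)) (defect k \<alpha> \<beta> x)"
proof -
  interpret D: cstar_functor "N k" "N (Suc k)" "\<Delta> (Suc k)" by (rule functor_\<Delta>)
  show ?thesis unfolding defect_def
    by (rule D.D.arr_diff[OF pullback_arr[OF \<beta> x] D.F_arr[OF nat_at_arr[OF \<alpha> x]]])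
qed

lemma defect_energy_nonneg:
  assumes "nat_at k \<alpha>" "nat_at (Suc k) \<beta>" "\<And>u. u \<in> reps (M k) \<Longrightarrow> 0 \<le> w u"
  shows "0 \<le> defect_energy k w \<alpha> \<beta>"
proof -
  interpret M0: finite_semisimple_cstar_category "M k" by (rule cat_M)
  interpret N1: finite_semisimple_cstar_category "N (Suc k)" by (rule cat_N)
  show ?thesis unfolding defect_energy_def
    using N1.qn_nonneg[OF defect_arr[OF assms(1,2) M0.reps_obj] weight_\<nu>] assms(3)
    by (intro sum_nonneg mult_nonneg_nonneg) auto
qed

lemma adj_product_nonneg:
  assumes "\<And>u. u \<in> reps (M k) \<Longrightarrow> 0 \<le> w u" "v \<in> reps (M (k + n))"
  shows "0 \<le> adj_product M \<Gamma> k n w v"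
  using assms(2)
proof (induction n arbitrary: v)
  case (Suc n)
  then show ?case by (auto intro!: sum_nonneg mult_nonneg_nonneg simp: adjacency_def)
qed (use assms(1) in simp)

lemma energy_mono:
  assumes nat: "\<And>l. k \<le> l \<Longrightarrow> nat_at l (\<xi> l)" and rel: "\<And>l. k \<le> l \<Longrightarrow> loop_rel l (\<xi> l) (\<xi> (Suc l))"
    and w: "\<And>u. u \<in> reps (M k) \<Longrightarrow> 0 \<le> w u" and "m \<le> n"
  shows "energy (k + m) (adj_product M \<Gamma> k m w) (\<xi> (k + m)) \<le> energy (k + n) (adj_product M \<Gamma> k n w) (\<xi> (k + n))"
  using \<open>m \<le> n\<close>
proof (rule lift_Suc_mono_le[rotated])
  fix n
  have "energy (k + Suc n) (adj_product M \<Gamma> k (Suc n) w) (\<xi> (k + Suc n)) =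
      energy (k + n) (adj_product M \<Gamma> k n w) (\<xi> (k + n)) +
      defect_energy (k + n) (adj_product M \<Gamma> k n w) (\<xi> (k + n)) (\<xi> (Suc (k + n)))"
    using energy_step[OF nat nat rel, of "k + n"] by simp
  moreover have "0 \<le> defect_energy (k + n) (adj_product M \<Gamma> k n w) (\<xi> (k + n)) (\<xi> (Suc (k + n)))"
    using adj_product_nonneg[OF w] by (intro defect_energy_nonneg nat) auto
  ultimately show "energy (k + n) (adj_product M \<Gamma> k n w) (\<xi> (k + n)) \<le>
      energy (k + Suc n) (adj_product M \<Gamma> k (Suc n) w) (\<xi> (k + Suc n))" by simp
qed

text \<open>A nonpositive sum of nonnegative terms vanishes termwise, and positive
  \<open>\<mu>\<close> and faithful traces kill the defect at the representatives. Naturality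
  carries this to every object, and multiplying by the unitary \<open>W\<Omega>\<close> gives the
  exchange relation.\<close>

lemma exchange_of_defect_energy:
  assumes \<eta>: "nat_at k (\<eta> k)" "nat_at (Suc k) (\<eta> (Suc k))"
    and 0: "defect_energy k (\<mu> k) (\<eta> k) (\<eta> (Suc k)) \<le> 0"
  shows "exchange_relation M N \<Gamma> \<Delta> W\<Lambda> W\<Omega> \<eta> k"
proof -
  interpret M0: finite_semisimple_cstar_category "M k" by (rule cat_M)
  interpret N1: finite_semisimple_cstar_category "N (Suc k)" by (rule cat_N)
  interpret L: cstar_functor "M k" "N k" "\<Lambda> k" by (rule functor_\<Lambda>)
  interpret O: cstar_functor "M k" "N k" "\<Omega> k" by (rule functor_\<Omega>)
  interpret G: cstar_functor "M k" "M (Suc k)" "\<Gamma> (Suc k)" by (rule functor_\<Gamma>)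
  interpret DL: cstar_functor "M k" "N (Suc k)" "comp_functor (\<Delta> (Suc k)) (\<Lambda> k)"
    by (rule L.cstar_functor_comp[OF functor_\<Delta>])
  interpret DO: cstar_functor "M k" "N (Suc k)" "comp_functor (\<Delta> (Suc k)) (\<Omega> k)"
    by (rule O.cstar_functor_comp[OF functor_\<Delta>])
  define q where "q = (\<lambda>x. qn (N (Suc k)) (\<nu> (Suc k)) (ob (\<Delta> (Suc k)) (ob (\<Lambda> k) x)) (defect k (\<eta> k) (\<eta> (Suc k)) x))"
  have q: "0 \<le> q u" if "u \<in> reps (M k)" for u
    unfolding q_def by (rule N1.qn_nonneg[OF defect_arr[OF \<eta> M0.reps_obj[OF that]] weight_\<nu>])
  have \<mu>: "0 < \<mu> k u" if "u \<in> reps (M k)" for u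
    using weight_\<mu>[of k] that by (auto simp: weight_function_def)
  have "(\<Sum>u\<in>reps (M k). \<mu> k u * q u) = 0"
    using 0 q \<mu> by (intro antisym sum_nonneg) (auto simp: defect_energy_def q_def less_imp_le)
  then have q0: "q u = 0" if "u \<in> reps (M k)" for u
    using that q \<mu> M0.finite_reps
    by (subst (asm) sum_nonneg_eq_0_iff) (auto simp: less_imp_le, fastforce)
  show ?thesis unfolding exchange_relation_def
  proof
    fix x assume x: "x \<in> obj (M k)"
    have "q x = (\<Sum>u\<in>reps (M k). real (complex_vector.dim (hom (M k) u x)) * q u)"
      using DL.qn_nat_trans[OF DO.F nat_trans_defect[OF \<eta>] x]
      by (simp add: q_def comp_functor_def)
    then have "q x = 0" using q0 by simp
    then have "defect k (\<eta> k) (\<eta> (Suc k)) x = 0"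
      unfolding q_def by (rule N1.qn_eq_0[OF defect_arr[OF \<eta> x] weight_\<nu>])
    then have eq: "ar (\<Delta> (Suc k)) (\<eta> k x) = pullback k (\<eta> (Suc k)) x" by (simp add: defect_def)
    note W = W_arr[OF x] and \<beta>A = nat_at_arr[OF \<eta>(2) G.F_obj[OF x]]
    note m = N1.arr_cmp[OF W(1) \<beta>A] and Ws = N1.arr_star[OF W(2)]
    show "W\<Omega> (Suc k) x \<cdot>\<^bsub>N (Suc k)\<^esub> ar (\<Delta> (Suc k)) (\<eta> k x) =
        \<eta> (Suc k) (ob (\<Gamma> (Suc k)) x) \<cdot>\<^bsub>N (Suc k)\<^esub> W\<Lambda> (Suc k) x"
      unfolding eq pullback_def N1.assoc[OF W(1) \<beta>A Ws]
      using N1.assoc[OF m Ws W(2)] W_cmp_star(2)[OF x] N1.idl[OF m] by simp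
  qed
qed

text \<open>The tracial solution is consumed here: the loop operator is \<open>cexp\<close> of the
  pullback, and \<open>cexp_adjoint\<close> expresses it through \<open>\<Delta>\<close>
  alone.\<close>

lemma loop_rel_loop_operator:
  assumes tracial: "tracial_solution (N k) (N (Suc k)) (\<nu> k) (\<nu> (Suc k)) (\<Delta> (Suc k)) (\<Delta>' (Suc k)) (\<rho> (Suc k)) (\<rho>' (Suc k))"
    and \<beta>: "nat_at (Suc k) \<beta>"
    and S: "\<And>x. x \<in> obj (M k) \<Longrightarrow> loop_operator N \<Delta>' \<rho>' \<Gamma> \<Lambda> \<Omega> W\<Lambda> W\<Omega> k \<beta> x = \<alpha> x"
  shows "loop_rel k \<alpha> \<beta>"
  unfolding loop_rel_def
proof (intro ballI allI impI)
  interpret D: cstar_functor "N k" "N (Suc k)" "\<Delta> (Suc k)" by (rule functor_\<Delta>)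
  interpret tracial_functor "N k" "N (Suc k)" "\<Delta> (Suc k)" "\<Delta>' (Suc k)" "\<nu> k" "\<nu> (Suc k)" "\<rho> (Suc k)" "\<rho>' (Suc k)"
    using tracial weight_\<nu> by unfold_locales
  fix x g assume x: "x \<in> obj (M k)" and g: "arr (N k) (ob (\<Lambda> k) x) (ob (\<Omega> k) x) g"
  have "\<alpha> x = cexp (ob (\<Lambda> k) x) (ob (\<Omega> k) x) (pullback k \<beta> x)"
    using S[OF x] by (simp add: loop_operator_def cexp_def pullback_def)
  then show "tr (N k) (\<nu> k) (ob (\<Lambda> k) x) (star (N k) g \<cdot>\<^bsub>N k\<^esub> \<alpha> x) =
     tr (N (Suc k)) (\<nu> (Suc k)) (ob (\<Delta> (Suc k)) (ob (\<Lambda> k) x))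
       (star (N (Suc k)) (ar (\<Delta> (Suc k)) g) \<cdot>\<^bsub>N (Suc k)\<^esub> pullback k \<beta> x)"
    using cexp_adjoint[OF g pullback_arr[OF \<beta> x]] by simp
qed

text \<open>Linearity, needed because recurrence compares a sequence with its own translate by whole
  periods.\<close>

lemma loop_rel_diff:
  assumes \<alpha>: "nat_at k \<alpha>" "nat_at k \<alpha>'" and \<beta>: "nat_at (Suc k) \<beta>" "nat_at (Suc k) \<beta>'"
    and rel: "loop_rel k \<alpha> \<beta>" "loop_rel k \<alpha>' \<beta>'"
  shows "loop_rel k (\<lambda>x. \<alpha> x - \<alpha>' x) (\<lambda>x. \<beta> x - \<beta>' x)"
  unfolding loop_rel_def
proof (intro ballI allI impI)
  interpret D: cstar_functor "N k" "N (Suc k)" "\<Delta> (Suc k)" by (rule functor_\<Delta>)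
  interpret G: cstar_functor "M k" "M (Suc k)" "\<Gamma> (Suc k)" by (rule functor_\<Gamma>)
  fix x g assume x: "x \<in> obj (M k)" and g: "arr (N k) (ob (\<Lambda> k) x) (ob (\<Omega> k) x) g"
  note gs = D.C.arr_star[OF g] and Fgs = D.D.arr_star[OF D.F_arr[OF g]]
  note a = nat_at_arr[OF \<alpha>(1) x] nat_at_arr[OF \<alpha>(2) x]
  note b = nat_at_arr[OF \<beta>(1) G.F_obj[OF x]] nat_at_arr[OF \<beta>(2) G.F_obj[OF x]]
  note W = W_arr[OF x]
  note Ws = D.D.arr_star[OF W(2)]
  note p = pullback_arr[OF \<beta>(1) x] pullback_arr[OF \<beta>(2) x]
  have "pullback k (\<lambda>x. \<beta> x - \<beta>' x) x = pullback k \<beta> x - pullback k \<beta>' x"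
    unfolding pullback_def D.D.diffr[OF b Ws] D.D.diffl[OF W(1) D.D.arr_cmp[OF b(1) Ws] D.D.arr_cmp[OF b(2) Ws]] ..
  then show "tr (N k) (\<nu> k) (ob (\<Lambda> k) x) (star (N k) g \<cdot>\<^bsub>N k\<^esub> (\<alpha> x - \<alpha>' x)) =
     tr (N (Suc k)) (\<nu> (Suc k)) (ob (\<Delta> (Suc k)) (ob (\<Lambda> k) x))
       (star (N (Suc k)) (ar (\<Delta> (Suc k)) g) \<cdot>\<^bsub>N (Suc k)\<^esub> pullback k (\<lambda>x. \<beta> x - \<beta>' x) x)"
    using rel x g
    by (simp add: loop_rel_def D.C.diffr[OF a gs] D.C.tr_diff[OF D.C.arr_cmp[OF a(1) gs] D.C.arr_cmp[OF a(2) gs]]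
        D.D.diffr[OF p Fgs] D.D.tr_diff[OF D.D.arr_cmp[OF p(1) Fgs] D.D.arr_cmp[OF p(2) Fgs]])
qed

text \<open>Index set of the matrix coefficients of a transformation: a representative
  \<open>u\<close> with a simple summand of each of its two images. Summands of different type are
  left out, their coefficients being zero by Schur's lemma.\<close>

definition coord_set :: "nat \<Rightarrow> ('o \<times> ('p \<times> 'n) \<times> ('p \<times> 'n)) set" where
  "coord_set k = (SIGMA u:reps (M k). {pq \<in> dec (N k) (ob (\<Lambda> k) u) \<times> dec (N k) (ob (\<Omega> k) u).
     fst (fst pq) = fst (snd pq)})"

definition coord_val :: "nat \<Rightarrow> ('o \<Rightarrow> 'n) \<Rightarrow> 'o \<times> ('p \<times> 'n) \<times> ('p \<times> 'n) \<Rightarrow> complex" where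
  "coord_val k \<alpha> = (\<lambda>(u, p, q). coord (N k) (fst p)
     (star (N k) (snd q) \<cdot>\<^bsub>N k\<^esub> (\<alpha> u \<cdot>\<^bsub>N k\<^esub> snd p)))"

definition coord_weight :: "nat \<Rightarrow> ('o \<Rightarrow> real) \<Rightarrow> 'o \<times> ('p \<times> 'n) \<times> ('p \<times> 'n) \<Rightarrow> real" where
  "coord_weight k w t = w (fst t) * \<nu> k (fst (fst (snd t)))"

lemma coord_setD:
  assumes "(u, p, q) \<in> coord_set k"
  shows "u \<in> reps (M k)" "u \<in> obj (M k)" "fst p \<in> reps (N k)"
    "arr (N k) (fst p) (ob (\<Lambda> k) u) (snd p)" "arr (N k) (fst p) (ob (\<Omega> k) u) (snd q)"
proof -
  interpret L: cstar_functor "M k" "N k" "\<Lambda> k" by (rule functor_\<Lambda>)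
  interpret O: cstar_functor "M k" "N k" "\<Omega> k" by (rule functor_\<Omega>)
  show u: "u \<in> reps (M k)" using assms by (auto simp: coord_set_def)
  then show uo: "u \<in> obj (M k)" by (rule L.C.reps_obj)
  have pq: "p \<in> dec (N k) (ob (\<Lambda> k) u)" "q \<in> dec (N k) (ob (\<Omega> k) u)" "fst p = fst q"
    using assms by (auto simp: coord_set_def)
  show "fst p \<in> reps (N k)" "arr (N k) (fst p) (ob (\<Lambda> k) u) (snd p)"
    using L.D.decompD(2,3)[OF L.D.decomp_dec[OF L.F_obj[OF uo]] pq(1)] .
  show "arr (N k) (fst p) (ob (\<Omega> k) u) (snd q)"
    using L.D.decompD(3)[OF L.D.decomp_dec[OF O.F_obj[OF uo]] pq(2)] pq(3) by simp
qed

lemma finite_dec: "u \<in> reps (M k) \<Longrightarrow> finite (dec (N k) (ob (\<Lambda> k) u))"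
  "u \<in> reps (M k) \<Longrightarrow> finite (dec (N k) (ob (\<Omega> k) u))"
proof -
  interpret L: cstar_functor "M k" "N k" "\<Lambda> k" by (rule functor_\<Lambda>)
  interpret O: cstar_functor "M k" "N k" "\<Omega> k" by (rule functor_\<Omega>)
  assume "u \<in> reps (M k)"
  then have u: "u \<in> obj (M k)" by (rule L.C.reps_obj)
  show "finite (dec (N k) (ob (\<Lambda> k) u))" "finite (dec (N k) (ob (\<Omega> k) u))"
    using L.D.decompD(1)[OF L.D.decomp_dec[OF L.F_obj[OF u]]]
      L.D.decompD(1)[OF L.D.decomp_dec[OF O.F_obj[OF u]]] .
qed

lemma finite_reps_M: "finite (reps (M k))"
  using finite_semisimple_cstar_category.finite_reps[OF cat_M] .

lemma finite_coord_set: "finite (coord_set k)"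
  unfolding coord_set_def by (intro finite_SigmaI finite_reps_M finite_Collect_conjI disjI1) (simp add: finite_dec)

text \<open>Brings the energy into the form of a weighted square sum over a finite set, as
  \<open>recurrence\<close> requires.\<close>

lemma energy_coords:
  assumes \<alpha>: "nat_at k \<alpha>"
  shows "energy k w \<alpha> = (\<Sum>t\<in>coord_set k. coord_weight k w t * (cmod (coord_val k \<alpha> t))\<^sup>2)"
proof -
  interpret M0: finite_semisimple_cstar_category "M k" by (rule cat_M)
  interpret N0: finite_semisimple_cstar_category "N k" by (rule cat_N)
  define S where "S = (\<lambda>u. {pq \<in> dec (N k) (ob (\<Lambda> k) u) \<times> dec (N k) (ob (\<Omega> k) u). fst (fst pq) = fst (snd pq)})"
  have "energy k w \<alpha> = (\<Sum>u\<in>reps (M k). \<Sum>pq\<in>S u.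
      w u * \<nu> k (fst (fst pq)) * (cmod (coord_val k \<alpha> (u, pq)))\<^sup>2)"
    unfolding energy_def
  proof (rule sum.cong[OF refl])
    fix u assume u: "u \<in> reps (M k)"
    have "qn (N k) (\<nu> k) (ob (\<Lambda> k) u) (\<alpha> u) =
        (\<Sum>pq\<in>dec (N k) (ob (\<Lambda> k) u) \<times> dec (N k) (ob (\<Omega> k) u). if fst (fst pq) = fst (snd pq)
          then \<nu> k (fst (fst pq)) * (cmod (coord_val k \<alpha> (u, pq)))\<^sup>2 else 0)"
      unfolding N0.qn_coords[OF nat_at_arr[OF \<alpha> M0.reps_obj[OF u]]] sum.cartesian_product
      by (intro sum.cong refl) (auto simp: coord_val_def)
    also have "\<dots> = (\<Sum>pq\<in>S u. \<nu> k (fst (fst pq)) * (cmod (coord_val k \<alpha> (u, pq)))\<^sup>2)"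
      unfolding S_def by (rule sum.inter_filter[symmetric]) (simp add: finite_dec[OF u])
    finally show "w u * qn (N k) (\<nu> k) (ob (\<Lambda> k) u) (\<alpha> u) =
        (\<Sum>pq\<in>S u. w u * \<nu> k (fst (fst pq)) * (cmod (coord_val k \<alpha> (u, pq)))\<^sup>2)"
      by (simp add: sum_distrib_left mult.assoc)
  qed
  also have "\<dots> = (\<Sum>(u, pq)\<in>Sigma (reps (M k)) S.
      w u * \<nu> k (fst (fst pq)) * (cmod (coord_val k \<alpha> (u, pq)))\<^sup>2)"
    by (rule sum.Sigma[OF finite_reps_M]) (auto simp: S_def finite_dec)
  finally show ?thesis by (simp add: coord_set_def coord_weight_def S_def case_prod_beta)
qed

lemma coord_val_diff:
  assumes \<alpha>: "nat_at k \<alpha>" and \<beta>: "nat_at k \<beta>" and t: "t \<in> coord_set k"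
  shows "coord_val k (\<lambda>x. \<alpha> x - \<beta> x) t = coord_val k \<alpha> t - coord_val k \<beta> t"
proof -
  interpret N0: finite_semisimple_cstar_category "N k" by (rule cat_N)
  obtain u p q where t': "t = (u, p, q)" by (cases t)
  note T = coord_setD[OF t[unfolded t']]
  note a = nat_at_arr[OF \<alpha> T(2)] and b = nat_at_arr[OF \<beta> T(2)]
  note ap = N0.arr_cmp[OF T(4) a] and bp = N0.arr_cmp[OF T(4) b] and qs = N0.arr_star[OF T(5)]
  note qa = N0.arr_cmp[OF ap qs] and qb = N0.arr_cmp[OF bp qs]
  have "coord (N k) (fst p) (star (N k) (snd q) \<cdot>\<^bsub>N k\<^esub> ((\<alpha> u - \<beta> u) \<cdot>\<^bsub>N k\<^esub> snd p)) +
      coord (N k) (fst p) (star (N k) (snd q) \<cdot>\<^bsub>N k\<^esub> (\<beta> u \<cdot>\<^bsub>N k\<^esub> snd p)) =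
      coord (N k) (fst p) (star (N k) (snd q) \<cdot>\<^bsub>N k\<^esub> (\<alpha> u \<cdot>\<^bsub>N k\<^esub> snd p))"
    using N0.coord_add[OF T(3) N0.arr_diff[OF qa qb] qb]
    by (simp add: N0.diffl[OF T(4) a b] N0.diffr[OF ap bp qs])
  then show ?thesis by (simp add: coord_val_def t' algebra_simps)
qed

text \<open>The constant is uniform in \<open>\<alpha>\<close>, so a bound on C*-norms along the
  sequence bounds every coordinate.\<close>

lemma coord_val_bound:
  assumes t: "t \<in> coord_set k"
  shows "\<exists>C\<ge>0. \<forall>\<alpha>. nat_at k \<alpha> \<longrightarrow> cmod (coord_val k \<alpha> t) \<le> C * nrm (N k) (\<alpha> (fst t))"
proof -
  interpret L: cstar_functor "M k" "N k" "\<Lambda> k" by (rule functor_\<Lambda>)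
  obtain u p q where t': "t = (u, p, q)" by (cases t)
  note T = coord_setD[OF t[unfolded t']]
  note qs = L.D.arr_star[OF T(5)]
  have "cmod (coord_val k \<alpha> t) \<le> nrm (N k) (star (N k) (snd q)) * nrm (N k) (snd p) * nrm (N k) (\<alpha> u)"
    if \<alpha>: "nat_at k \<alpha>" for \<alpha>
  proof -
    note a = nat_at_arr[OF \<alpha> T(2)]
    note ap = L.D.arr_cmp[OF T(4) a]
    have "cmod (coord_val k \<alpha> t) = nrm (N k) (star (N k) (snd q) \<cdot>\<^bsub>N k\<^esub> (\<alpha> u \<cdot>\<^bsub>N k\<^esub> snd p))"
      using L.D.cmod_coord[OF T(3) L.D.arr_cmp[OF ap qs]] by (simp add: coord_val_def t')
    also have "\<dots> \<le> nrm (N k) (star (N k) (snd q)) * nrm (N k) (\<alpha> u \<cdot>\<^bsub>N k\<^esub> snd p)"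
      by (rule L.nrm_mult[OF ap qs])
    also have "\<dots> \<le> nrm (N k) (star (N k) (snd q)) * (nrm (N k) (\<alpha> u) * nrm (N k) (snd p))"
      by (rule mult_left_mono[OF L.nrm_mult[OF T(4) a] L.nrm_pos[OF qs]])
    finally show ?thesis by (simp add: mult_ac)
  qed
  then show ?thesis using L.nrm_pos[OF qs] L.nrm_pos[OF T(4)] t'
    by (intro exI[of _ "nrm (N k) (star (N k) (snd q)) * nrm (N k) (snd p)"]) auto
qed

end


section \<open>Periodicity\<close>

lemma same_cat_obj: "same_cat C D \<Longrightarrow> obj C = obj D"
  and same_cat_reps: "same_cat C D \<Longrightarrow> reps C = reps D"
  and same_cat_hom: "\<lbrakk>same_cat C D; x \<in> obj D; y \<in> obj D\<rbrakk> \<Longrightarrow> hom C x y = hom D x y"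
  and same_cat_idn: "\<lbrakk>same_cat C D; x \<in> obj D\<rbrakk> \<Longrightarrow> idn C x = idn D x"
  by (auto simp: same_cat_def)

lemma same_cat_arr: "same_cat C D \<Longrightarrow> arr C x y f \<longleftrightarrow> arr D x y f"
  by (auto simp: same_cat_def arr_def)

lemma
  assumes same: "same_cat C D" and f: "arr D x y f"
  shows same_cat_star: "star C f = star D f" and same_cat_nrm: "nrm C f = nrm D f"
proof -
  have "\<forall>x\<in>obj C. \<forall>y\<in>obj C. hom C x y = hom D x y \<and>
      (\<forall>f\<in>hom C x y. star C f = star D f \<and> nrm C f = nrm D f)"
    using same unfolding same_cat_def by (elim conjE)
  from bspec[OF bspec[OF this, of x], of y] show "star C f = star D f" "nrm C f = nrm D f"
    using f same_cat_obj[OF same] by (auto simp: arr_def)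
qed

lemma same_cat_cmp:
  assumes same: "same_cat C D" and f: "arr D x y f" and g: "arr D y z g"
  shows "g \<cdot>\<^bsub>C\<^esub> f = g \<cdot>\<^bsub>D\<^esub> f"
proof -
  have "\<forall>x\<in>obj C. \<forall>y\<in>obj C. \<forall>z\<in>obj C. \<forall>f\<in>hom C x y. \<forall>g\<in>hom C y z. g \<cdot>\<^bsub>C\<^esub> f = g \<cdot>\<^bsub>D\<^esub> f"
    using same unfolding same_cat_def by (elim conjE)
  from bspec[OF bspec[OF bspec[OF bspec[OF bspec[OF this, of x], of y], of z], of f], of g]
  show ?thesis using f g same_cat_obj[OF same] same_cat_hom[OF same] by (simp add: arr_def)
qed

lemma same_functorD: "\<lbrakk>same_functor M F G; x \<in> obj M\<rbrakk> \<Longrightarrow> ob F x = ob G x"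
  "\<lbrakk>same_functor M F G; arr M x y f\<rbrakk> \<Longrightarrow> ar F f = ar G f"
  unfolding same_functor_def arr_def by blast+

context finite_semisimple_cstar_category
begin

lemma same_cat_decomp:
  assumes same: "same_cat B C" and D: "decomp C x D" and x: "x \<in> obj C"
  shows "decomp B x D"
  unfolding decomp_def
proof (intro conjI ballI impI)
  have obj: "fst p \<in> obj C" if "p \<in> D" for p using decompD(2)[OF D that] by (rule reps_obj)
  show "finite D" using D by (rule decompD)
  fix p assume p: "p \<in> D"
  note pA = decompD(3)[OF D p]
  show "fst p \<in> reps B" using same_cat_reps[OF same] decompD(2)[OF D p] by simp
  show "arr B (fst p) x (snd p)" using same_cat_arr[OF same] pA by simp
  show "star B (snd p) \<cdot>\<^bsub>B\<^esub> snd p = idn B (fst p)"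
    using same_cat_star[OF same pA] same_cat_cmp[OF same pA arr_star[OF pA]] same_cat_idn[OF same obj[OF p]]
      decompD(4)[OF D p] by simp
  fix q assume q: "q \<in> D" "p \<noteq> q"
  show "star B (snd p) \<cdot>\<^bsub>B\<^esub> snd q = 0"
    using same_cat_star[OF same pA] same_cat_cmp[OF same decompD(3)[OF D q(1)] arr_star[OF pA]]
      decompD(6)[OF D p q] by simp
next
  have "(\<Sum>p\<in>D. snd p \<cdot>\<^bsub>B\<^esub> star B (snd p)) = (\<Sum>p\<in>D. snd p \<cdot> star C (snd p))"
  proof (rule sum.cong[OF refl])
    fix p assume p: "p \<in> D"
    note pA = decompD(3)[OF D p]
    show "snd p \<cdot>\<^bsub>B\<^esub> star B (snd p) = snd p \<cdot> star C (snd p)"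
      using same_cat_star[OF same pA] same_cat_cmp[OF same arr_star[OF pA] pA] by simp
  qed
  then show "(\<Sum>p\<in>D. snd p \<cdot>\<^bsub>B\<^esub> star B (snd p)) = idn B x" using decompD(5)[OF D] same_cat_idn[OF same x] by simp
qed

text \<open>The records need agree only on objects and morphisms, so \<open>dec\<close> may choose
  differently for \<open>B\<close> and \<open>C\<close>. A decomposition in \<open>C\<close> is also
  one in \<open>B\<close>, and \<open>tr_eq\<close> permits its use on both sides.\<close>

lemma same_cat_tr:
  assumes B: "finite_semisimple_cstar_category B" and same: "same_cat B C"
    and w: "\<And>u. u \<in> reps C \<Longrightarrow> w' u = c * w u" and X: "arr C x x X"
  shows "tr B w' x X = of_real c * tr C w x X"
proof -
  interpret B: finite_semisimple_cstar_category B by (rule B)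
  note D = decomp_dec[OF arrD(1)[OF X]]
  have "tr B w' x X = trD B w' (dec C x) X"
    using X same_cat_arr[OF same] by (intro B.tr_eq same_cat_decomp[OF same D arrD(1)[OF X]]) simp
  also have "\<dots> = of_real c * trD C w (dec C x) X"
    unfolding trD_def sum_distrib_left
  proof (rule sum.cong[OF refl])
    fix p assume p: "p \<in> dec C x"
    note pA = decompD(3)[OF D p] and pr = decompD(2)[OF D p]
    note m = arr_cmp[OF pA X]
    have "star B (snd p) \<cdot>\<^bsub>B\<^esub> (X \<cdot>\<^bsub>B\<^esub> snd p) = star C (snd p) \<cdot> (X \<cdot> snd p)"
      using same_cat_star[OF same pA] same_cat_cmp[OF same pA X] same_cat_cmp[OF same m arr_star[OF pA]] by simp
    moreover have "coord B (fst p) = coord C (fst p)"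
      unfolding coord_def using same_cat_idn[OF same reps_obj[OF pr]] by simp
    ultimately show "of_real (w' (fst p)) * coord B (fst p) (star B (snd p) \<cdot>\<^bsub>B\<^esub> (X \<cdot>\<^bsub>B\<^esub> snd p)) =
        of_real c * (of_real (w (fst p)) * coord C (fst p) (star C (snd p) \<cdot> (X \<cdot> snd p)))"
      using w[OF pr] by simp
  qed
  finally show ?thesis by (simp add: tr_def)
qed

lemma same_cat_qn:
  assumes B: "finite_semisimple_cstar_category B" and same: "same_cat B C"
    and w: "\<And>u. u \<in> reps C \<Longrightarrow> w' u = c * w u" and f: "arr C x y f"
  shows "qn B w' x f = c * qn C w x f"
  using same_cat_tr[OF B same w arr_cmp[OF f arr_star[OF f]]] same_cat_star[OF same f]
    same_cat_cmp[OF same f arr_star[OF f]] by (simp add: qn_def)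

end

locale periodic_cell_pair = cell_pair +
  fixes K L :: nat and d :: real
  assumes K: "1 \<le> K" and d: "0 < d"
    and per_M: "\<And>k. L \<le> k \<Longrightarrow> same_cat (M (k + K)) (M k)"
    and per_N: "\<And>k. L \<le> k \<Longrightarrow> same_cat (N (k + K)) (N k)"
    and per_\<Gamma>: "\<And>k. L \<le> k \<Longrightarrow> same_functor (M k) (\<Gamma> (Suc (k + K))) (\<Gamma> (Suc k))"
    and per_\<Delta>: "\<And>k. L \<le> k \<Longrightarrow> same_functor (N k) (\<Delta> (Suc (k + K))) (\<Delta> (Suc k))"
    and per_\<Lambda>: "\<And>k. L \<le> k \<Longrightarrow> same_functor (M k) (\<Lambda> (k + K)) (\<Lambda> k)"
    and per_\<Omega>: "\<And>k. L \<le> k \<Longrightarrow> same_functor (M k) (\<Omega> (k + K)) (\<Omega> k)"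
    and per_W\<Lambda>: "\<And>k x. \<lbrakk>L \<le> k; x \<in> obj (M k)\<rbrakk> \<Longrightarrow> W\<Lambda> (Suc (k + K)) x = W\<Lambda> (Suc k) x"
    and per_W\<Omega>: "\<And>k x. \<lbrakk>L \<le> k; x \<in> obj (M k)\<rbrakk> \<Longrightarrow> W\<Omega> (Suc (k + K)) x = W\<Omega> (Suc k) x"
    and PF_product: "\<And>k v. \<lbrakk>L \<le> k; v \<in> reps (M k)\<rbrakk> \<Longrightarrow> adj_product M \<Gamma> k K (\<mu> k) v = d * \<mu> k v"
    and PF_\<mu>: "\<And>k v. \<lbrakk>L \<le> k; v \<in> reps (M k)\<rbrakk> \<Longrightarrow> \<mu> k v = d * \<mu> (k + K) v"
    and PF_\<nu>: "\<And>k v. \<lbrakk>L \<le> k; v \<in> reps (N k)\<rbrakk> \<Longrightarrow> \<nu> k v = d * \<nu> (k + K) v"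
begin

section \<open>Shifts by whole periods\<close>

lemma tr_shift:
  assumes "L \<le> k" "arr (N k) x x X"
  shows "tr (N (k + K)) (\<nu> (k + K)) x X = of_real (1 / d) * tr (N k) (\<nu> k) x X"
  using PF_\<nu>[OF assms(1)] d
  by (intro finite_semisimple_cstar_category.same_cat_tr[OF cat_N cat_N per_N[OF assms(1)] _ assms(2)]) simp

text \<open>The same function on objects is read at level \<open>k\<close>; this places all members
  of the orbit in a single space.\<close>

lemma nat_at_shift:
  assumes k: "L \<le> k" and \<alpha>: "nat_at (k + K) \<alpha>"
  shows "nat_at k \<alpha>"
proof -
  interpret L: cstar_functor "M k" "N k" "\<Lambda> k" by (rule functor_\<Lambda>)
  interpret O: cstar_functor "M k" "N k" "\<Omega> k" by (rule functor_\<Omega>)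
  note obM = same_cat_obj[OF per_M[OF k]]
  note sF = same_functorD[OF per_\<Lambda>[OF k]] same_functorD[OF per_\<Omega>[OF k]]
  have A: "arr (N k) (ob (\<Lambda> k) x) (ob (\<Omega> k) x) (\<alpha> x)" if x: "x \<in> obj (M k)" for x
    using nat_at_arr[OF \<alpha>, of x] x obM same_cat_arr[OF per_N[OF k]] sF by simp
  show ?thesis unfolding nat_at_def nat_trans_def
  proof (intro conjI ballI)
    show "\<alpha> x \<in> hom (N k) (ob (\<Lambda> k) x) (ob (\<Omega> k) x)" if "x \<in> obj (M k)" for x
      using A[OF that] by (simp add: arr_def)
    fix x y f assume xy: "x \<in> obj (M k)" "y \<in> obj (M k)" and "f \<in> hom (M k) x y"
    then have f: "arr (M k) x y f" by (simp add: arr_def)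
    then have "arr (M (k + K)) x y f" using same_cat_arr[OF per_M[OF k]] by simp
    from nat_trans_natural[OF \<alpha>[unfolded nat_at_def] this]
    have "ar (\<Omega> k) f \<cdot>\<^bsub>N (k + K)\<^esub> \<alpha> x = \<alpha> y \<cdot>\<^bsub>N (k + K)\<^esub> ar (\<Lambda> k) f"
      using sF(2)[OF f] sF(4)[OF f] by simp
    then show "ar (\<Omega> k) f \<cdot>\<^bsub>N k\<^esub> \<alpha> x = \<alpha> y \<cdot>\<^bsub>N k\<^esub> ar (\<Lambda> k) f"
      using same_cat_cmp[OF per_N[OF k] A[OF xy(1)] O.F_arr[OF f]]
        same_cat_cmp[OF per_N[OF k] L.F_arr[OF f] A[OF xy(2)]] by simp
  qed
qed

lemma nat_at_shifts: "\<lbrakk>L \<le> k; nat_at (k + n * K) \<alpha>\<rbrakk> \<Longrightarrow> nat_at k \<alpha>"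
proof (induction n arbitrary: k)
  case (Suc n)
  have "nat_at (k + K) \<alpha>"
    using Suc.prems by (intro Suc.IH[of "k + K"]) (simp_all add: add.assoc)
  then show ?case by (rule nat_at_shift[OF Suc.prems(1)])
qed simp

text \<open>Passing from \<open>k + K\<close> to \<open>k\<close> multiplies the traces at both
  levels of the relation by the same factor \<open>d\<close>, which cancels.\<close>

lemma loop_rel_shift:
  assumes k: "L \<le> k" and \<alpha>: "nat_at k \<alpha>" and \<beta>: "nat_at (Suc k) \<beta>" and rel: "loop_rel (k + K) \<alpha> \<beta>"
  shows "loop_rel k \<alpha> \<beta>"
  unfolding loop_rel_def
proof (intro ballI allI impI)
  interpret D: cstar_functor "N k" "N (Suc k)" "\<Delta> (Suc k)" by (rule functor_\<Delta>)
  interpret G: cstar_functor "M k" "M (Suc k)" "\<Gamma> (Suc k)" by (rule functor_\<Gamma>)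
  fix x g assume x: "x \<in> obj (M k)" and g: "arr (N k) (ob (\<Lambda> k) x) (ob (\<Omega> k) x) g"
  have k1: "L \<le> Suc k" using k by simp
  note N0 = per_N[OF k] and N1 = per_N[OF k1, simplified]
  note eqs = same_functorD(1)[OF per_\<Lambda>[OF k] x] same_functorD(1)[OF per_\<Omega>[OF k] x]
    same_functorD(1)[OF per_\<Gamma>[OF k] x] same_functorD(1)[OF per_\<Delta>[OF k] arrD(1)[OF g]]
    same_functorD(2)[OF per_\<Delta>[OF k] g] per_W\<Lambda>[OF k x] per_W\<Omega>[OF k x]
  note a = nat_at_arr[OF \<alpha> x] and b = nat_at_arr[OF \<beta> G.F_obj[OF x]] and W = W_arr[OF x]
  note gs = D.C.arr_star[OF g] and Fg = D.F_arr[OF g]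
  note Fgs = D.D.arr_star[OF Fg] and Ws = D.D.arr_star[OF W(2)] and p = pullback_arr[OF \<beta> x]
  have pb: "pullback (k + K) \<beta> x = pullback k \<beta> x"
    unfolding pullback_def
    by (simp add: eqs same_cat_star[OF N1 W(2)] same_cat_cmp[OF N1 b Ws]
        same_cat_cmp[OF N1 W(1) D.D.arr_cmp[OF b Ws]])
  have x': "x \<in> obj (M (k + K))" using x same_cat_obj[OF per_M[OF k]] by simp
  have g': "arr (N (k + K)) (ob (\<Lambda> (k + K)) x) (ob (\<Omega> (k + K)) x) g"
    using g unfolding same_cat_arr[OF N0] eqs(1,2) .
  have "tr (N (k + K)) (\<nu> (k + K)) (ob (\<Lambda> k) x) (star (N k) g \<cdot>\<^bsub>N k\<^esub> \<alpha> x) =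
      tr (N (Suc (k + K))) (\<nu> (Suc (k + K))) (ob (\<Delta> (Suc k)) (ob (\<Lambda> k) x))
       (star (N (Suc k)) (ar (\<Delta> (Suc k)) g) \<cdot>\<^bsub>N (Suc k)\<^esub> pullback k \<beta> x)"
    using rel[unfolded loop_rel_def, rule_format, OF x' g']
    unfolding eqs pb same_cat_star[OF N0 g] same_cat_cmp[OF N0 a gs] same_cat_star[OF N1 Fg]
      same_cat_cmp[OF N1 p Fgs] .
  then show "tr (N k) (\<nu> k) (ob (\<Lambda> k) x) (star (N k) g \<cdot>\<^bsub>N k\<^esub> \<alpha> x) =
     tr (N (Suc k)) (\<nu> (Suc k)) (ob (\<Delta> (Suc k)) (ob (\<Lambda> k) x))
       (star (N (Suc k)) (ar (\<Delta> (Suc k)) g) \<cdot>\<^bsub>N (Suc k)\<^esub> pullback k \<beta> x)"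
    using tr_shift[OF k D.C.arr_cmp[OF a gs]] tr_shift[OF k1 D.D.arr_cmp[OF p Fgs]] d by simp
qed

lemma loop_rel_shifts:
  "\<lbrakk>L \<le> k; nat_at (k + n * K) \<alpha>; nat_at (Suc (k + n * K)) \<beta>; loop_rel (k + n * K) \<alpha> \<beta>\<rbrakk> \<Longrightarrow> loop_rel k \<alpha> \<beta>"
proof (induction n arbitrary: k)
  case (Suc n)
  have 1: "nat_at k \<alpha>" using nat_at_shifts[OF Suc.prems(1,2)] .
  have 2: "nat_at (Suc k) \<beta>" using nat_at_shifts[of "Suc k" "Suc n" \<beta>] Suc.prems(1,3) by simp
  have "loop_rel (k + K) \<alpha> \<beta>" using Suc.IH[of "k + K"] Suc.prems by (simp add: add.assoc)
  then show ?case by (rule loop_rel_shift[OF Suc.prems(1) 1 2])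
qed simp

text \<open>One factor \<open>d\<close> comes from \<open>\<mu>\<close> and the other from
  \<open>\<nu>\<close> inside the traces.\<close>

lemma energy_shift:
  assumes k: "L \<le> k" and \<alpha>: "nat_at k \<alpha>"
  shows "energy k (\<mu> k) \<alpha> = d\<^sup>2 * energy (k + K) (\<mu> (k + K)) \<alpha>"
proof -
  interpret M0: finite_semisimple_cstar_category "M k" by (rule cat_M)
  have "\<mu> k u * qn (N k) (\<nu> k) (ob (\<Lambda> k) u) (\<alpha> u) =
      d\<^sup>2 * (\<mu> (k + K) u * qn (N (k + K)) (\<nu> (k + K)) (ob (\<Lambda> (k + K)) u) (\<alpha> u))"
    if u: "u \<in> reps (M k)" for u
  proof -
    note uo = M0.reps_obj[OF u]
    have "qn (N (k + K)) (\<nu> (k + K)) (ob (\<Lambda> k) u) (\<alpha> u) = 1 / d * qn (N k) (\<nu> k) (ob (\<Lambda> k) u) (\<alpha> u)"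
      using PF_\<nu>[OF k] d
      by (intro finite_semisimple_cstar_category.same_cat_qn[OF cat_N cat_N per_N[OF k] _ nat_at_arr[OF \<alpha> uo]]) simp
    then show ?thesis
      using PF_\<mu>[OF k u] d same_functorD(1)[OF per_\<Lambda>[OF k] uo] by (simp add: power2_eq_square)
  qed
  then show ?thesis
    unfolding energy_def same_cat_reps[OF per_M[OF k]] sum_distrib_left by (intro sum.cong refl) auto
qed

lemma energy_shifts:
  "\<lbrakk>L \<le> k; nat_at (k + n * K) \<alpha>\<rbrakk> \<Longrightarrow>
    energy k (\<mu> k) \<alpha> = (d\<^sup>2) ^ n * energy (k + n * K) (\<mu> (k + n * K)) \<alpha>"
proof (induction n arbitrary: k)
  case (Suc n)
  show ?case
    using Suc.prems Suc.IH[of "k + K"] energy_shift[OF Suc.prems(1) nat_at_shifts[OF Suc.prems]] by (simp add: add.assoc)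
qed simp

lemma nrm_shifts:
  "\<lbrakk>L \<le> k; nat_at (k + n * K) \<alpha>; x \<in> obj (M k)\<rbrakk> \<Longrightarrow> nrm (N (k + n * K)) (\<alpha> x) = nrm (N k) (\<alpha> x)"
proof (induction n arbitrary: k)
  case (Suc n)
  have "nat_at k \<alpha>" using nat_at_shifts[OF Suc.prems(1,2)] .
  then have "nrm (N (k + K)) (\<alpha> x) = nrm (N k) (\<alpha> x)"
    using same_cat_nrm[OF per_N[OF Suc.prems(1)] nat_at_arr] Suc.prems(3) by blast
  then show ?case
    using Suc.IH[of "k + K"] Suc.prems same_cat_obj[OF per_M[OF Suc.prems(1)]] by (simp add: add.assoc)
qed simp

text \<open>Transport over a period multiplies \<open>\<mu> k\<close> by \<open>d\<close>, and
  \<open>\<mu> k\<close> is \<open>d\<close> times \<open>\<mu> (k + K)\<close>. The resulting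
  \<open>d\<^sup>2\<close> is exactly the factor in \<open>energy_shift\<close>, so no scalar is
  left over.\<close>

lemma energy_period:
  assumes k: "L \<le> k" and \<alpha>: "nat_at (k + K) \<alpha>"
  shows "energy (k + K) (adj_product M \<Gamma> k K (\<mu> k)) \<alpha> = energy k (\<mu> k) \<alpha>"
proof -
  have "adj_product M \<Gamma> k K (\<mu> k) u = d\<^sup>2 * \<mu> (k + K) u" if "u \<in> reps (M (k + K))" for u
    using PF_product[OF k, of u] PF_\<mu>[OF k, of u] that same_cat_reps[OF per_M[OF k]]
    by (simp add: power2_eq_square)
  then show ?thesis
    unfolding energy_shift[OF k nat_at_shift[OF k \<alpha>]]
    by (simp add: energy_def sum_distrib_left mult.assoc)
qed

section \<open>Monotonicity over periods, recurrence and the exchange relation\<close>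

lemma energy_periods_mono:
  assumes k: "L \<le> k" and nat: "\<And>l. k \<le> l \<Longrightarrow> nat_at l (\<xi> l)"
    and rel: "\<And>l. k \<le> l \<Longrightarrow> loop_rel l (\<xi> l) (\<xi> (Suc l))" and "m \<le> n"
  shows "energy k (\<mu> k) (\<xi> (k + m * K)) \<le> energy k (\<mu> k) (\<xi> (k + n * K))"
  using \<open>m \<le> n\<close>
proof (rule lift_Suc_mono_le[rotated])
  fix n
  define l where "l = k + n * K"
  have l: "L \<le> l" "k \<le> l" using k by (auto simp: l_def)
  have w: "0 \<le> \<mu> l u" if "u \<in> reps (M l)" for u
    using weight_\<mu>[of l] that by (auto simp: weight_function_def less_imp_le)
  have "energy l (\<mu> l) (\<xi> l) \<le> energy (l + K) (adj_product M \<Gamma> l K (\<mu> l)) (\<xi> (l + K))"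
    using energy_mono[of l \<xi> "\<mu> l" 0 K, OF nat rel w] l by simp
  also have "\<dots> = energy l (\<mu> l) (\<xi> (l + K))" using l by (intro energy_period nat) auto
  \<comment> \<open>The comparison is made at level \<open>l\<close>; \<open>energy_shifts\<close>
    moves both sides down to level \<open>k\<close> at the cost of the common factor
    \<open>(d\<^sup>2) ^ n\<close>.\<close>
  finally have "(d\<^sup>2) ^ n * energy l (\<mu> l) (\<xi> l) \<le> (d\<^sup>2) ^ n * energy l (\<mu> l) (\<xi> (l + K))"
    by (intro mult_left_mono) auto
  moreover have "nat_at l (\<xi> l)" "nat_at l (\<xi> (l + K))"
    using nat nat_at_shift[of l "\<xi> (l + K)"] l by auto
  ultimately have "energy k (\<mu> k) (\<xi> l) \<le> energy k (\<mu> k) (\<xi> (l + K))"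
    using energy_shifts[OF k, of n] by (simp add: l_def)
  then show "energy k (\<mu> k) (\<xi> (k + n * K)) \<le> energy k (\<mu> k) (\<xi> (k + Suc n * K))"
    by (simp add: l_def add.assoc add.commute[of K])
qed

lemma energy_recurrent:
  assumes k: "L \<le> k" and nat: "\<And>l. k \<le> l \<Longrightarrow> nat_at l (\<eta> l)"
    and rel: "\<And>l. k \<le> l \<Longrightarrow> loop_rel l (\<eta> l) (\<eta> (Suc l))"
    and bdd: "\<And>l. nt_norm (M l) (N l) (\<eta> l) \<le> B"
  shows "energy k (\<mu> k) (\<eta> (k + K)) \<le> energy k (\<mu> k) (\<eta> k)"
proof -
  interpret Lk: cstar_functor "M k" "N k" "\<Lambda> k" by (rule functor_\<Lambda>)
  \<comment> \<open>Coordinates at level \<open>k\<close> of the members one period apart. A period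
    of loop operators lowers \<open>n\<close> by one, so \<open>c\<close> is a backward
    orbit.\<close>
  define c where "c = (\<lambda>n. coord_val k (\<eta> (k + n * K)))"
  define \<omega> where "\<omega> = coord_weight k (\<mu> k)"
  have nk: "nat_at k (\<eta> (k + n * K))" for n using nat_at_shifts[OF k nat] by simp
  have e: "energy k (\<mu> k) (\<eta> (k + n * K)) = (\<Sum>t\<in>coord_set k. \<omega> t * (cmod (c n t))\<^sup>2)" for n
    unfolding energy_coords[OF nk] by (simp add: \<omega>_def coord_weight_def c_def)
  have ed: "energy k (\<mu> k) (\<lambda>x. \<eta> (k + m * K) x - \<eta> (k + n * K) x) =
      (\<Sum>t\<in>coord_set k. \<omega> t * (cmod (c m t - c n t))\<^sup>2)" for m n
    unfolding energy_coords[OF nat_at_diff[OF nk nk]]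
    by (intro sum.cong refl) (simp add: \<omega>_def coord_weight_def c_def coord_val_diff[OF nk nk])
  have "(\<Sum>t\<in>coord_set k. \<omega> t * (cmod (c 1 t))\<^sup>2) \<le> (\<Sum>t\<in>coord_set k. \<omega> t * (cmod (c 0 t))\<^sup>2)"
  proof (rule recurrence[OF finite_coord_set])
    fix t assume t: "t \<in> coord_set k"
    obtain u p q where t': "t = (u, p, q)" by (cases t)
    note T = coord_setD[OF t[unfolded t']]
    obtain C where C: "0 \<le> C" "\<And>\<alpha>. nat_at k \<alpha> \<Longrightarrow> cmod (coord_val k \<alpha> t) \<le> C * nrm (N k) (\<alpha> (fst t))"
      using coord_val_bound[OF t] by blast
    have "cmod (c n t) \<le> C * B" for n
    proof -
      define l where "l = k + n * K"
      interpret L: cstar_functor "M l" "N l" "\<Lambda> l" by (rule functor_\<Lambda>)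
      interpret O: cstar_functor "M l" "N l" "\<Omega> l" by (rule functor_\<Omega>)
      have nl: "nat_at l (\<eta> l)" using nat by (simp add: l_def)
      have "obj (M l) = obj (M k)" unfolding l_def
      proof (induction n)
        case (Suc n)
        then show ?case using same_cat_obj[OF per_M[of "k + n * K"]] k by (simp add: add.assoc add.commute[of K])
      qed simp
      then have u: "u \<in> obj (M l)" using T(2) by simp
      have "nrm (N k) (\<eta> l u) = nrm (N l) (\<eta> l u)"
        using nrm_shifts[OF k _ T(2), of n "\<eta> l"] nl by (simp add: l_def)
      also have "\<dots> \<le> nt_norm (M l) (N l) (\<eta> l)"
        using L.nrm_le_nt_norm[OF O.F _ u] nl by (simp add: nat_at_def)
      also have "\<dots> \<le> B" by (rule bdd)
      finally have "C * nrm (N k) (\<eta> l u) \<le> C * B" using C(1) by (rule mult_left_mono)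
      then show ?thesis using C(2)[OF nk[of n]] by (simp add: c_def t' l_def)
    qed
    then show "\<exists>B. \<forall>n. cmod (c n t) \<le> B" by blast
    show "0 < \<omega> t"
      using weight_\<mu>[of k] weight_\<nu>[of k] T(1,3) by (auto simp: \<omega>_def coord_weight_def t' weight_function_def)
  next
    fix n
    show "(\<Sum>t\<in>coord_set k. \<omega> t * (cmod (c n t))\<^sup>2) \<le> (\<Sum>t\<in>coord_set k. \<omega> t * (cmod (c (Suc n) t))\<^sup>2)"
      unfolding e[symmetric] by (rule energy_periods_mono[OF k nat rel]) auto
  next
    fix i m
    \<comment> \<open>The difference of the sequence and its translate by \<open>m\<close> periods
      again satisfies the loop relations. Monotonicity of its energy between 0 and \<open>i\<close>
      periods is the contraction estimate asked for by \<open>recurrence\<close>.\<close>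
    define \<xi> where "\<xi> = (\<lambda>l x. \<eta> l x - \<eta> (l + m * K) x)"
    have nat': "nat_at l (\<eta> (l + m * K))" if "k \<le> l" for l
      using nat_at_shifts[of l m "\<eta> (l + m * K)"] nat k that by simp
    have rel': "loop_rel l (\<eta> (l + m * K)) (\<eta> (Suc l + m * K))" if "k \<le> l" for l
      using loop_rel_shifts[of l m "\<eta> (l + m * K)" "\<eta> (Suc l + m * K)"] nat rel k that by simp
    have "energy k (\<mu> k) (\<xi> (k + 0 * K)) \<le> energy k (\<mu> k) (\<xi> (k + i * K))"
    proof (rule energy_periods_mono[OF k])
      fix l assume l: "k \<le> l"
      then have l': "k \<le> Suc l" by simp
      show "nat_at l (\<xi> l)" unfolding \<xi>_def by (rule nat_at_diff[OF nat[OF l] nat'[OF l]])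
      show "loop_rel l (\<xi> l) (\<xi> (Suc l))" unfolding \<xi>_def
        by (rule loop_rel_diff[OF nat[OF l] nat'[OF l] nat[OF l'] nat'[OF l'] rel[OF l] rel'[OF l]])
    qed simp
    then show "(\<Sum>t\<in>coord_set k. \<omega> t * (cmod (c 0 t - c m t))\<^sup>2) \<le>
        (\<Sum>t\<in>coord_set k. \<omega> t * (cmod (c i t - c (i + m) t))\<^sup>2)"
      using ed[of 0 m] ed[of i "i + m"] by (simp add: \<xi>_def add.assoc distrib_right)
  qed
  then show ?thesis using e[of 0] e[of 1] by simp
qed

text \<open>A squeeze: the energy at the start plus the defect of the first step is at most the
  energy after a period, which recurrence brings back below the energy at the start. Any
  \<open>k\<close> beyond the threshold may serve as the start.\<close>

lemma exchange_from:
  assumes k: "L \<le> k" and nat: "\<And>l. k \<le> l \<Longrightarrow> nat_at l (\<eta> l)"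
    and rel: "\<And>l. k \<le> l \<Longrightarrow> loop_rel l (\<eta> l) (\<eta> (Suc l))"
    and bdd: "\<And>l. nt_norm (M l) (N l) (\<eta> l) \<le> B"
  shows "exchange_relation M N \<Gamma> \<Delta> W\<Lambda> W\<Omega> \<eta> k"
proof (rule exchange_of_defect_energy)
  show "nat_at k (\<eta> k)" "nat_at (Suc k) (\<eta> (Suc k))" using nat by auto
  have w: "0 \<le> \<mu> k u" if "u \<in> reps (M k)" for u
    using weight_\<mu>[of k] that by (auto simp: weight_function_def less_imp_le)
  have "energy k (\<mu> k) (\<eta> k) + defect_energy k (\<mu> k) (\<eta> k) (\<eta> (Suc k)) =
      energy (k + 1) (adj_product M \<Gamma> k 1 (\<mu> k)) (\<eta> (k + 1))"
    using energy_step[OF nat nat rel, of k "\<mu> k"] by simp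
  \<comment> \<open>Here \<open>1 \<le> K\<close> ensures that the first step lies within the
    period.\<close>
  also have "\<dots> \<le> energy (k + K) (adj_product M \<Gamma> k K (\<mu> k)) (\<eta> (k + K))"
    by (rule energy_mono[OF nat rel w K]) auto
  also have "\<dots> = energy k (\<mu> k) (\<eta> (k + K))" by (rule energy_period[OF k nat]) simp
  also have "\<dots> \<le> energy k (\<mu> k) (\<eta> k)" by (rule energy_recurrent[OF k nat rel bdd])
  finally show "defect_energy k (\<mu> k) (\<eta> k) (\<eta> (Suc k)) \<le> 0" by simp
qed

end

theorem proposition6p6:
  fixes M :: "nat \<Rightarrow> ('o, 'm::complex_vector) ccat"
    and N :: "nat \<Rightarrow> ('p, 'n::complex_vector) ccat"
    and \<Gamma> :: "nat \<Rightarrow> ('o, 'm, 'o, 'm) cfunctor"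
    and \<Delta> \<Delta>' :: "nat \<Rightarrow> ('p, 'n, 'p, 'n) cfunctor"
    and \<mu> :: "nat \<Rightarrow> 'o \<Rightarrow> real"
    and \<nu> :: "nat \<Rightarrow> 'p \<Rightarrow> real"
    and \<Lambda> \<Omega> :: "nat \<Rightarrow> ('o, 'm, 'p, 'n) cfunctor"
    and W\<Lambda> W\<Omega> :: "nat \<Rightarrow> 'o \<Rightarrow> 'n"
    and \<rho> \<rho>' :: "nat \<Rightarrow> 'p \<Rightarrow> 'n"
    and K :: nat and d :: real
    and \<eta> :: "nat \<Rightarrow> 'o \<Rightarrow> 'n"
  assumes "zero_cell M \<Gamma> \<mu>"
    and "zero_cell N \<Delta> \<nu>"
    and "one_cell M \<Gamma> \<mu> N \<Delta> \<nu> \<Lambda> W\<Lambda>"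
    and "one_cell M \<Gamma> \<mu> N \<Delta> \<nu> \<Omega> W\<Omega>"
    and "\<And>k. tracial_solution (N k) (N (Suc k)) (\<nu> k) (\<nu> (Suc k))
              (\<Delta> (Suc k)) (\<Delta>' (Suc k)) (\<rho> (Suc k)) (\<rho>' (Suc k))"
    and "K \<ge> 1" and "d > 0"
    and "eventually_periodic K M \<Gamma>"
    and "eventually_periodic K N \<Delta>"
    and "eventually_periodic_cell K M \<Lambda> W\<Lambda>"
    and "eventually_periodic_cell K M \<Omega> W\<Omega>"
    and "PF_condition K d M \<Gamma> \<mu>"
    and "PF_condition K d N \<Delta> \<nu>"
    and "bounded_quasi_flat M N \<Delta>' \<rho>' \<Gamma> \<Lambda> \<Omega> W\<Lambda> W\<Omega> \<eta>"
  shows "flat M N \<Gamma> \<Delta> W\<Lambda> W\<Omega> \<eta>"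
proof -
  interpret cell_pair M N \<Gamma> \<Delta> \<mu> \<nu> \<Lambda> \<Omega> W\<Lambda> W\<Omega>
    using assms(1-4) by unfold_locales
  have "\<forall>\<^sub>F k in sequentially.
      (same_cat (M (k + K)) (M k) \<and> same_functor (M k) (\<Gamma> (Suc k + K)) (\<Gamma> (Suc k))) \<and>
      (same_cat (N (k + K)) (N k) \<and> same_functor (N k) (\<Delta> (Suc k + K)) (\<Delta> (Suc k))) \<and>
      (same_functor (M k) (\<Lambda> (k + K)) (\<Lambda> k) \<and> (\<forall>x \<in> obj (M k). W\<Lambda> (Suc k + K) x = W\<Lambda> (Suc k) x)) \<and>
      (same_functor (M k) (\<Omega> (k + K)) (\<Omega> k) \<and> (\<forall>x \<in> obj (M k). W\<Omega> (Suc k + K) x = W\<Omega> (Suc k) x)) \<and>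
      (\<forall>v \<in> reps (M k). inverse d * adj_product M \<Gamma> k K (\<mu> k) v = \<mu> k v \<and> \<mu> k v = d * \<mu> (k + K) v) \<and>
      (\<forall>v \<in> reps (N k). inverse d * adj_product N \<Delta> k K (\<nu> k) v = \<nu> k v \<and> \<nu> k v = d * \<nu> (k + K) v)"
    using assms(8-13) unfolding eventually_periodic_def eventually_periodic_cell_def PF_condition_def
    by (simp only: eventually_conj_iff)
  \<comment> \<open>The six eventual conditions are conjoined beforehand so that a single threshold
    serves all of them.\<close>
  then obtain L where L: "\<And>k. L \<le> k \<Longrightarrow>
      (same_cat (M (k + K)) (M k) \<and> same_functor (M k) (\<Gamma> (Suc k + K)) (\<Gamma> (Suc k))) \<and>
      (same_cat (N (k + K)) (N k) \<and> same_functor (N k) (\<Delta> (Suc k + K)) (\<Delta> (Suc k))) \<and>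
      (same_functor (M k) (\<Lambda> (k + K)) (\<Lambda> k) \<and> (\<forall>x \<in> obj (M k). W\<Lambda> (Suc k + K) x = W\<Lambda> (Suc k) x)) \<and>
      (same_functor (M k) (\<Omega> (k + K)) (\<Omega> k) \<and> (\<forall>x \<in> obj (M k). W\<Omega> (Suc k + K) x = W\<Omega> (Suc k) x)) \<and>
      (\<forall>v \<in> reps (M k). inverse d * adj_product M \<Gamma> k K (\<mu> k) v = \<mu> k v \<and> \<mu> k v = d * \<mu> (k + K) v) \<and>
      (\<forall>v \<in> reps (N k). inverse d * adj_product N \<Delta> k K (\<nu> k) v = \<nu> k v \<and> \<nu> k v = d * \<nu> (k + K) v)"
    unfolding eventually_sequentially by blast
  interpret periodic_cell_pair M N \<Gamma> \<Delta> \<mu> \<nu> \<Lambda> \<Omega> W\<Lambda> W\<Omega> K L d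
  proof
    show "1 \<le> K" "0 < d" using assms(6,7) .
    fix k assume k: "L \<le> k"
    note Lk = L[OF k, simplified]
    show "same_cat (M (k + K)) (M k)" "same_cat (N (k + K)) (N k)"
      "same_functor (M k) (\<Gamma> (Suc (k + K))) (\<Gamma> (Suc k))" "same_functor (N k) (\<Delta> (Suc (k + K))) (\<Delta> (Suc k))"
      "same_functor (M k) (\<Lambda> (k + K)) (\<Lambda> k)" "same_functor (M k) (\<Omega> (k + K)) (\<Omega> k)"
      using Lk by blast+
    show "W\<Lambda> (Suc (k + K)) x = W\<Lambda> (Suc k) x" "W\<Omega> (Suc (k + K)) x = W\<Omega> (Suc k) x" if "x \<in> obj (M k)" for x
      using Lk that by blast+
    show "\<mu> k v = d * \<mu> (k + K) v" if "v \<in> reps (M k)" for v using Lk that by blast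
    show "\<nu> k v = d * \<nu> (k + K) v" if "v \<in> reps (N k)" for v using Lk that by blast
    show "adj_product M \<Gamma> k K (\<mu> k) v = d * \<mu> k v" if "v \<in> reps (M k)" for v
    proof -
      have "inverse d * adj_product M \<Gamma> k K (\<mu> k) v = \<mu> k v" using L[OF k] that by blast
      then show ?thesis using assms(7) by (simp add: field_simps)
    qed
  qed
  have nat: "nat_at k (\<eta> k)" for k
    using assms(14) by (simp add: bounded_quasi_flat_def quasi_flat_def nat_at_def)
  have rel: "loop_rel k (\<eta> k) (\<eta> (Suc k))" for k
    using assms(14) by (intro loop_rel_loop_operator[where \<Delta>' = \<Delta>' and \<rho> = \<rho> and \<rho>' = \<rho>', OF assms(5)[of k] nat])
      (simp add: bounded_quasi_flat_def quasi_flat_def)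
  obtain B where B: "\<And>k. nt_norm (M k) (N k) (\<eta> k) \<le> B"
    using assms(14) by (auto simp: bounded_quasi_flat_def bdd_above_def)
  show ?thesis
    unfolding flat_def using exchange_from[OF _ nat rel B] by blast
qed

end
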